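(* Let $\Gamma\subset\mathbb R^n$ be a regular cone such that for every $y'\in\Gamma$ $$(\ast)\qquad \lim_{\widetilde y\in\overline{y'+\Gamma},\ |\widetilde y|\to\infty}K(x+i\widetilde y,\overline{x+i\widetilde y})=0 .$$ Let $1<p<\infty$ and $F\in H^p(T_\Gamma)$, and write $z=x+iy\in T_\Gamma$. Then: (1) for every $\beta\in\partial\Gamma$, $\displaystyle\lim_{y\in\Gamma,\,y\to\beta}\frac{|F(z)|}{K(z,\overline z)^{1/p}}=0$ uniformly for $x\in\mathbb R^n$; (2) $\displaystyle\lim_{y\in\Gamma,\,|y|\to\infty}\frac{|F(z)|}{K(z,\overline z)^{1/p}}=0$ uniformly for $x\in\mathbb R^n$; (3) $\displaystyle\lim_{|x|\to\infty}\frac{|F(z)|}{K(z,\overline z)^{1/p}}=0$ uniformly for $y\in\Gamma$. In particular, condition $(\ast)$ is automatically satisfied (and need not be assumed) when $\Gamma$ is a regular cone in $\mathbb R^2$, and when $\Gamma$ is a polygonal cone or a circular cone in $\mathbb R^n$.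
   Context: An open cone is a nonempty open $\Gamma\subset\mathbb R^n$ with $0\notin\Gamma$ and $ax+by\in\Gamma$ whenever $x,y\in\Gamma$, $a,b>0$. Its dual is $\Gamma^*=\{t\in\mathbb R^n: x\cdot t\ge0\ \text{for all } x\in\Gamma\}$; $\Gamma$ is regular if $\Gamma^*$ has nonempty interior. $T_\Gamma=\{x+iy:x\in\mathbb R^n,y\in\Gamma\}\subset\mathbb C^n$. $H^p(T_\Gamma)$ is the space of holomorphic $F$ on $T_\Gamma$ with $\sup_{y\in\Gamma}\int_{\mathbb R^n}|F(x+iy)|^pdx<\infty$. The Cauchy-Szegő kernel is $K(w,\overline z)=\int_{\Gamma^*}e^{2\pi iw\cdot t}\,\overline{e^{2\pi iz\cdot t}}\,dt$, $w,z\in T_\Gamma$; thus $K(x+iy,\overline{x+iy})=\int_{\Gamma^*}e^{-4\pi y\cdot t}dt$, which does not depend on $x$. A polygonal cone is a regular cone that is the interior of the convex hull of finitely many rays meeting at the origin. A circular cone is the image under a rotation of $\mathbb R^n$ of a cone $\{y\in\mathbb R^n:\sqrt{\sum_{j=1}^{n-1}|y_j|^2}<\kappa y_n\}$ with $\kappa>0$. *)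

theory Defs
  imports "HOL-Analysis.Analysis"
begin

text \<open>The library predicate \<^const>\<open>cone\<close> allows the scalar 0, hence forces a nonempty cone to
  contain the origin; the cones below exclude it.\<close>

definition open_cone :: "(real^'n) set \<Rightarrow> bool" where
  "open_cone \<Gamma> \<longleftrightarrow> open \<Gamma> \<and> \<Gamma> \<noteq> {} \<and> 0 \<notin> \<Gamma> \<and>
     (\<forall>x\<in>\<Gamma>. \<forall>y\<in>\<Gamma>. \<forall>a>0. \<forall>b>0. a *\<^sub>R x + b *\<^sub>R y \<in> \<Gamma>)"

definition dual_cone :: "(real^'n) set \<Rightarrow> (real^'n) set" where
  "dual_cone \<Gamma> = {t. \<forall>x\<in>\<Gamma>. x \<bullet> t \<ge> 0}"

definition regular_cone :: "(real^'n) set \<Rightarrow> bool" where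
  "regular_cone \<Gamma> \<longleftrightarrow> open_cone \<Gamma> \<and> interior (dual_cone \<Gamma>) \<noteq> {}"

definition polygonal_cone :: "(real^'n) set \<Rightarrow> bool" where
  "polygonal_cone \<Gamma> \<longleftrightarrow> regular_cone \<Gamma> \<and>
     (\<exists>V. finite V \<and> 0 \<notin> V \<and> \<Gamma> = interior (convex hull (\<Union>v\<in>V. {s *\<^sub>R v |s. s \<ge> 0})))"

text \<open>The index type has no last element, so the axis \<open>k\<close> of the model cone is existentially
  quantified. Any choice of \<open>k\<close> gives the same class of sets: if there is more than one axis,
  rotations carry each axis to any other.\<close>

definition circular_cone :: "(real^'n) set \<Rightarrow> bool" where
  "circular_cone \<Gamma> \<longleftrightarrow>
     (\<exists>k \<kappa> Q. \<kappa> > 0 \<and> rotation_matrix Q \<and>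
        \<Gamma> = (\<lambda>y. Q *v y) ` {y. sqrt (\<Sum>j\<in>UNIV - {k}. \<bar>y $ j\<bar>\<^sup>2) < \<kappa> * y $ k})"

definition cvec :: "real^'n \<Rightarrow> real^'n \<Rightarrow> complex^'n" where
  "cvec x y = (\<chi> j. Complex (x $ j) (y $ j))"

definition tube :: "(real^'n) set \<Rightarrow> (complex^'n) set" where
  "tube \<Gamma> = {cvec x y |x y. y \<in> \<Gamma>}"

text \<open>Holomorphy in several variables: complex (i.e. real Frechet with complex-linear derivative)
  differentiability at every point.\<close>

definition holomorphic_vec_on :: "(complex^'n \<Rightarrow> complex) \<Rightarrow> (complex^'n) set \<Rightarrow> bool" where
  "holomorphic_vec_on F S \<longleftrightarrow>
     (\<forall>z\<in>S. \<exists>D. (F has_derivative D) (at z within S) \<and> (\<forall>c v. D (c *s v) = c * D v))"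

definition hardy_space :: "real \<Rightarrow> (real^'n) set \<Rightarrow> (complex^'n \<Rightarrow> complex) set" where
  "hardy_space p \<Gamma> = {F. holomorphic_vec_on F (tube \<Gamma>) \<and>
     (SUP y\<in>\<Gamma>. \<integral>\<^sup>+x. ennreal (cmod (F (cvec x y)) powr p) \<partial>lborel) < \<infinity>}"

definition cdot :: "complex^'n \<Rightarrow> real^'n \<Rightarrow> complex" where
  "cdot w t = (\<Sum>j\<in>UNIV. w $ j * of_real (t $ j))"

text \<open>\<open>cauchy_szego \<Gamma> w z\<close> is the kernel usually written \<open>K(w, zbar)\<close>: the conjugation of the second
  argument is built in.\<close>

definition cauchy_szego :: "(real^'n) set \<Rightarrow> complex^'n \<Rightarrow> complex^'n \<Rightarrow> complex" where
  "cauchy_szego \<Gamma> w z =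
     (LINT t:dual_cone \<Gamma>|lborel.
        exp (2 * of_real pi * \<i> * cdot w t) * cnj (exp (2 * of_real pi * \<i> * cdot z t)))"

text \<open>The kernel on the diagonal does not depend on the real part \<open>x\<close>, so quantifying over all
  \<open>x\<close> is the same as fixing one.\<close>

definition kernel_vanishes_at_infinity :: "(real^'n) set \<Rightarrow> bool" where
  "kernel_vanishes_at_infinity \<Gamma> \<longleftrightarrow>
     (\<forall>y'\<in>\<Gamma>. \<forall>x. ((\<lambda>y. cauchy_szego \<Gamma> (cvec x y) (cvec x y)) \<longlongrightarrow> 0)
        (inf at_infinity (principal (closure ((+) y' ` \<Gamma>)))))"

text \<open>\<open>|F(z)| / K(z, zbar)\<^sup>1\<^sup>/\<^sup>p\<close> at \<open>z = x + iy\<close>. The diagonal value of the kernel is real and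
  positive on the tube, so taking its real part only changes the type.\<close>

definition kernel_quotient ::
  "(real^'n) set \<Rightarrow> real \<Rightarrow> (complex^'n \<Rightarrow> complex) \<Rightarrow> real^'n \<Rightarrow> real^'n \<Rightarrow> real" where
  "kernel_quotient \<Gamma> p F x y =
     cmod (F (cvec x y)) / Re (cauchy_szego \<Gamma> (cvec x y) (cvec x y)) powr (1 / p)"

end

theory Submission
  imports Defs "HOL-Complex_Analysis.Cauchy_Integral_Formula"
begin

text \<open>Write \<open>k(y)\<close> for the kernel on the diagonal. Averaging \<open>|F|\<^sup>p\<close> over a polydisc adapted to a
  basis of maximal volume in the slice \<open>{t \<in> \<Gamma>\<^sup>*. y \<bullet> t \<le> 1}\<close> gives \<open>|F(x + iy)|\<^sup>p \<le> C k(y) \<parallel>F\<parallel>\<^sup>p\<close> for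
  \<open>p \<ge> 1\<close>, so the assertions need only be shown for a class of functions dense in \<open>H\<^sup>p\<close>. The Poisson
  formula on half planes makes the integral means decrease along the cone. With the uniform
  convexity of \<open>L\<^sup>p\<close> this shows that \<open>F(\<cdot> + iw) \<rightarrow> F\<close> in \<open>H\<^sup>p\<close> for suitable small \<open>w \<in> \<Gamma>\<close>, and
  multiplying by a rational cutoff \<open>\<phi>\<close> brings the translate into \<open>H\<^sup>1\<close>. For the resulting
  approximants \<open>G\<close> one has \<open>|G| \<le> C k(y + w)\<close>, where \<open>k(y + w)\<close> stays bounded and tends to 0 at infinity,
  while \<open>k\<close> blows up at the boundary.

  The condition on the kernel holds for every regular cone, by dominated convergence.\<close>

text \<open>The obstacle is uniformity at infinity. A translate of F bounded only by
  \<open>k(y + w)\<close> to the power 1/p yields, through \<open>k(y + w) \<le> k(y)\<close>, a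
  bounded quotient and no decay. The approximants therefore also need an integral bound with
  exponent 1: the pointwise estimate then carries a full power of the kernel, and k(y + w) /
  k(y)^(1/p) is at most k(y + w)^(1 - 1/p), which tends to 0 as 1 < p. Maximal volume makes the
  constant in the pointwise estimate depend on the dimension alone. The real and imaginary sections
  of the polydisc have volumes proportional to 1 / |det X|, whereas the parallelepiped spanned by
  the basis, shrunk by 1/n, fits into the slice and has volume proportional to |det X|; the
  determinant cancels. Translation precedes truncation because the means of F (1 - \<phi>) then have
  to be small above one fixed point w only, where dominated convergence applies; monotonicity passes
  this on to every y + w.\<close>

subsection \<open>Linear changes of variables\<close>

lemma nn_integral_lborel_translate:
  fixes f :: "'a::euclidean_space \<Rightarrow> ennreal"
  assumes "f \<in> borel_measurable borel"
  shows "(\<integral>\<^sup>+x. f (x + c) \<partial>lborel) = (\<integral>\<^sup>+x. f x \<partial>lborel)"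
proof -
  have "(\<integral>\<^sup>+x. f x \<partial>lborel) = (\<integral>\<^sup>+x. f x \<partial>distr lborel borel ((+) c))"
    by (simp add: lborel_distr_plus)
  also have "\<dots> = (\<integral>\<^sup>+x. f (x + c) \<partial>lborel)"
    using assms by (subst nn_integral_distr) (auto simp: add.commute)
  finally show ?thesis by simp
qed

text \<open>Both sides are multiplied by the integral over \<open>t\<close> of a bump at \<open>x + t e\<close>; after exchanging the
  integrals, the shear becomes a translation.\<close>

lemma nn_integral_transvection:
  fixes f :: "'a::euclidean_space \<Rightarrow> ennreal"
  assumes f[measurable]: "f \<in> borel_measurable borel" and orth: "l \<bullet> e = 0"
  shows "(\<integral>\<^sup>+x. f (x + (l \<bullet> x) *\<^sub>R e) \<partial>lborel) = (\<integral>\<^sup>+x. f x \<partial>lborel)"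
proof (cases "e = 0")
  case False
  define q where "q = e \<bullet> e"
  have q: "q > 0" using False by (simp add: q_def)
  define w :: "real \<Rightarrow> ennreal" where "w = indicator {0..1}"
  have w[measurable]: "w \<in> borel_measurable borel" by (simp add: w_def)
  define Q where "Q = (\<integral>\<^sup>+t. w (t * q) \<partial>lborel)"
  have wint: "(\<integral>\<^sup>+t. w (s + t * q) \<partial>lborel) = Q" for s
  proof -
    have "(\<integral>\<^sup>+t. w (t * q) \<partial>lborel) = (\<integral>\<^sup>+t. w ((t + s / q) * q) \<partial>lborel)"
      by (rule nn_integral_lborel_translate[symmetric]) auto
    moreover have "(t + s / q) * q = s + t * q" for t using q by (simp add: field_simps)
    ultimately show ?thesis by (simp add: Q_def)
  qed
  have "(\<integral>\<^sup>+t. w t \<partial>lborel) = ennreal \<bar>q\<bar> * Q"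
    using nn_integral_real_affine[OF w, of q 0] q by (simp add: Q_def mult.commute)
  moreover have "(\<integral>\<^sup>+t. w t \<partial>lborel) = 1" by (simp add: w_def)
  ultimately have Q: "Q \<noteq> 0" "Q \<noteq> \<infinity>" using q
    by (auto simp: ennreal_mult_top)
  let ?h = "\<lambda>x. x + (l \<bullet> x) *\<^sub>R e"
  have "(\<integral>\<^sup>+x. f (?h x) \<partial>lborel) * Q = (\<integral>\<^sup>+x. f (?h x) * (\<integral>\<^sup>+t. w (?h x \<bullet> e + t * q) \<partial>lborel) \<partial>lborel)"
    by (simp add: wint nn_integral_multc)
  also have "\<dots> = (\<integral>\<^sup>+x. (\<integral>\<^sup>+t. f (?h x) * w (?h x \<bullet> e + t * q) \<partial>lborel) \<partial>lborel)"
    by (simp add: nn_integral_cmult)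
  also have "\<dots> = (\<integral>\<^sup>+t. (\<integral>\<^sup>+x. f (?h x) * w (?h x \<bullet> e + t * q) \<partial>lborel) \<partial>lborel)"
    by (rule lborel_pair.Fubini') simp
  \<comment> \<open>Translating x by -t e moves t from the weight into f; the shear coefficient
    \<open>l \<bullet> x\<close> does not change because l is orthogonal to e.\<close>
  also have "\<dots> = (\<integral>\<^sup>+t. (\<integral>\<^sup>+x. f (?h x - t *\<^sub>R e) * w (?h x \<bullet> e) \<partial>lborel) \<partial>lborel)"
  proof (rule nn_integral_cong)
    fix t
    have "(\<integral>\<^sup>+x. f (?h x) * w (?h x \<bullet> e + t * q) \<partial>lborel)
        = (\<integral>\<^sup>+x. f (?h (x + (- t) *\<^sub>R e)) * w (?h (x + (- t) *\<^sub>R e) \<bullet> e + t * q) \<partial>lborel)"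
      by (rule nn_integral_lborel_translate[symmetric]) simp
    then show "(\<integral>\<^sup>+x. f (?h x) * w (?h x \<bullet> e + t * q) \<partial>lborel)
        = (\<integral>\<^sup>+x. f (?h x - t *\<^sub>R e) * w (?h x \<bullet> e) \<partial>lborel)"
      by (simp add: inner_simps orth q_def algebra_simps)
  qed
  also have "\<dots> = (\<integral>\<^sup>+x. (\<integral>\<^sup>+t. f (?h x - t *\<^sub>R e) * w (?h x \<bullet> e) \<partial>lborel) \<partial>lborel)"
    by (rule lborel_pair.Fubini') simp
  \<comment> \<open>For fixed x, shifting t by \<open>l \<bullet> x\<close> absorbs the shear inside
    f; the weight no longer contains t and is unaffected.\<close>
  also have "\<dots> = (\<integral>\<^sup>+x. (\<integral>\<^sup>+t. f (x - t *\<^sub>R e) * w (?h x \<bullet> e) \<partial>lborel) \<partial>lborel)"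
  proof (rule nn_integral_cong)
    fix x
    have "(\<integral>\<^sup>+t. f (?h x - t *\<^sub>R e) * w (?h x \<bullet> e) \<partial>lborel)
       = (\<integral>\<^sup>+t. f (?h x - (t + l \<bullet> x) *\<^sub>R e) * w (?h x \<bullet> e) \<partial>lborel)"
      by (rule nn_integral_lborel_translate[symmetric]) simp
    then show "(\<integral>\<^sup>+t. f (?h x - t *\<^sub>R e) * w (?h x \<bullet> e) \<partial>lborel)
       = (\<integral>\<^sup>+t. f (x - t *\<^sub>R e) * w (?h x \<bullet> e) \<partial>lborel)"
      by (simp add: algebra_simps)
  qed
  also have "\<dots> = (\<integral>\<^sup>+t. (\<integral>\<^sup>+x. f (x - t *\<^sub>R e) * w (?h x \<bullet> e) \<partial>lborel) \<partial>lborel)"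
    by (rule lborel_pair.Fubini') simp
  \<comment> \<open>The translation by t e, run backwards, returns t to the weight, whose integral
    over t is again Q.\<close>
  also have "\<dots> = (\<integral>\<^sup>+t. (\<integral>\<^sup>+x. f x * w (?h x \<bullet> e + t * q) \<partial>lborel) \<partial>lborel)"
  proof (rule nn_integral_cong)
    fix t
    have "(\<integral>\<^sup>+x. f (x - t *\<^sub>R e) * w (?h x \<bullet> e) \<partial>lborel)
        = (\<integral>\<^sup>+x. f (x + t *\<^sub>R e - t *\<^sub>R e) * w (?h (x + t *\<^sub>R e) \<bullet> e) \<partial>lborel)"
      by (rule nn_integral_lborel_translate[symmetric]) simp
    then show "(\<integral>\<^sup>+x. f (x - t *\<^sub>R e) * w (?h x \<bullet> e) \<partial>lborel)
        = (\<integral>\<^sup>+x. f x * w (?h x \<bullet> e + t * q) \<partial>lborel)"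
      by (simp add: inner_simps orth q_def algebra_simps)
  qed
  also have "\<dots> = (\<integral>\<^sup>+x. (\<integral>\<^sup>+t. f x * w (?h x \<bullet> e + t * q) \<partial>lborel) \<partial>lborel)"
    by (rule lborel_pair.Fubini') simp
  also have "\<dots> = (\<integral>\<^sup>+x. f x \<partial>lborel) * Q"
    by (simp add: nn_integral_cmult wint nn_integral_multc)
  finally show ?thesis
    using Q by (simp add: ennreal_mult_cancel_left mult.commute[of _ Q])
qed simp

lemma prod_Basis_cart: "(\<Prod>b\<in>Basis. f b) = (\<Prod>i\<in>UNIV. f (axis i 1 :: real^'n))"
proof -
  have "(Basis :: (real^'n) set) = range (\<lambda>i. axis i 1)" by (auto simp: Basis_vec_def)
  moreover have "inj (\<lambda>i::'n. axis i (1::real))" by (simp add: inj_on_def axis_eq_axis)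
  ultimately show ?thesis using prod.reindex[of "\<lambda>i::'n. axis i (1::real)" UNIV f] by (metis comp_apply prod.cong)
qed

lemma nn_integral_permute_coords:
  fixes f :: "real^'n \<Rightarrow> ennreal"
  assumes f[measurable]: "f \<in> borel_measurable borel"
  shows "(\<integral>\<^sup>+x. f (\<chi> i. x $ Transposition.transpose m n i) \<partial>lborel) = (\<integral>\<^sup>+x. f x \<partial>lborel)"
proof -
  let ?s = "Transposition.transpose m n"
  let ?h = "\<lambda>x::real^'n. \<chi> i. x $ ?s i"
  have lin: "linear ?h"
    by (rule linearI) (simp_all add: vec_eq_iff)
  have h[measurable]: "?h \<in> borel \<rightarrow>\<^sub>M borel"
    by (rule borel_measurable_continuous_onI) (simp add: lin linear_continuous_on linear_linear)
  have "lborel = distr lborel borel ?h"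
  proof (rule lborel_eqI)
    fix l u :: "real^'n" assume lu: "\<And>b. b \<in> Basis \<Longrightarrow> l \<bullet> b \<le> u \<bullet> b"
    have lu': "l $ i \<le> u $ i" for i using lu[of "axis i 1"] by (simp add: inner_axis)
    have eq: "?h -` box l u = box (?h l) (?h u)"
      by (auto simp: mem_box_cart) (metis transpose_involutory)+
    have "emeasure (distr lborel borel ?h) (box l u) = emeasure lborel (box (?h l) (?h u))"
      by (simp add: emeasure_distr eq)
    also have "\<dots> = ennreal (\<Prod>b\<in>Basis. (?h u - ?h l) \<bullet> b)"
      by (rule emeasure_lborel_box) (use lu' in \<open>auto simp: Basis_vec_def inner_axis\<close>)
    also have "(\<Prod>b\<in>Basis. (?h u - ?h l) \<bullet> b) = (\<Prod>i\<in>UNIV. (u - l) $ ?s i)"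
      by (simp add: prod_Basis_cart inner_axis)
    also have "\<dots> = (\<Prod>i\<in>UNIV. (u - l) $ i)"
      using prod.permute [OF permutes_swap_id[of m UNIV n], of "\<lambda>i. (u - l)$i"] by (simp add: o_def)
    also have "\<dots> = (\<Prod>b\<in>Basis. (u - l) \<bullet> b)"
      by (simp add: prod_Basis_cart inner_axis)
    finally show "emeasure (distr lborel borel ?h) (box l u) = ennreal (\<Prod>b\<in>Basis. (u - l) \<bullet> b)" .
  qed simp
  then have "(\<integral>\<^sup>+x. f x \<partial>lborel) = (\<integral>\<^sup>+x. f x \<partial>distr lborel borel ?h)" by simp
  also have "\<dots> = (\<integral>\<^sup>+x. f (?h x) \<partial>lborel)" by (simp add: nn_integral_distr)
  finally show ?thesis ..
qed

lemma nn_integral_scale_coords: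
  fixes f :: "real^'n \<Rightarrow> ennreal" and d :: "'n \<Rightarrow> real"
  assumes f[measurable]: "f \<in> borel_measurable borel" and d: "\<And>i. d i \<noteq> 0"
  shows "(\<integral>\<^sup>+x. f (\<chi> i. d i * x $ i) \<partial>lborel) = ennreal (1 / (\<Prod>i\<in>UNIV. \<bar>d i\<bar>)) * (\<integral>\<^sup>+x. f x \<partial>lborel)"
proof -
  define c :: "real^'n \<Rightarrow> real" where "c b = (\<chi> i. d i) \<bullet> b" for b
  define p where "p = (\<Prod>i\<in>UNIV. \<bar>d i\<bar>)"
  have p: "p > 0" using d by (auto simp: p_def intro!: prod_pos)
  let ?T = "\<lambda>x::real^'n. 0 + (\<Sum>j\<in>Basis. (c j * (x \<bullet> j)) *\<^sub>R j)"
  have c: "c (axis i 1) = d i" for i by (simp add: c_def inner_axis)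
  have T: "?T x = (\<chi> i. d i * x $ i)" for x
  proof -
    have "?T x \<bullet> b = (\<chi> i. d i * x $ i) \<bullet> b" if b: "b \<in> Basis" for b
    proof -
      obtain i where i: "b = axis i 1" using b by (auto simp: Basis_vec_def)
      have "?T x \<bullet> b = c b * (x \<bullet> b)" using b by (simp add: inner_sum_left inner_Basis if_distrib cong: if_cong)
      then show ?thesis by (simp add: i c inner_axis)
    qed
    then show ?thesis by (rule euclidean_eqI)
  qed
  have "lborel = density (distr lborel borel ?T) (\<lambda>_. (\<Prod>j\<in>Basis. \<bar>c j\<bar>))"
    by (rule lborel_affine_euclidean) (use d in \<open>auto simp: Basis_vec_def c\<close>)
  then have "(\<integral>\<^sup>+x. f x \<partial>lborel) = (\<integral>\<^sup>+x. f x \<partial>density (distr lborel borel ?T) (\<lambda>_. (\<Prod>j\<in>Basis. \<bar>c j\<bar>)))"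
    by simp
  also have "\<dots> = ennreal p * (\<integral>\<^sup>+x. f (?T x) \<partial>lborel)"
    by (simp add: nn_integral_density nn_integral_distr nn_integral_cmult prod_Basis_cart c p_def)
  finally have "(\<integral>\<^sup>+x. f x \<partial>lborel) = ennreal p * (\<integral>\<^sup>+x. f (\<chi> i. d i * x $ i) \<partial>lborel)"
    unfolding T .
  then have "ennreal (1/p) * (\<integral>\<^sup>+x. f x \<partial>lborel) = (ennreal (1/p) * ennreal p) * (\<integral>\<^sup>+x. f (\<chi> i. d i * x $ i) \<partial>lborel)"
    by (simp add: mult.assoc)
  also have "ennreal (1/p) * ennreal p = 1" using p by (simp flip: ennreal_mult)
  finally show ?thesis by (simp add: p_def)
qed

text \<open>That the two scaling factors agree replaces the equality of the determinants of \<open>A\<close> and its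
  transpose.\<close>

lemma nn_integral_linear_transpose:
  fixes A :: "real^'n^'n"
  assumes "invertible A"
  shows "\<exists>c>0. \<forall>f\<in>borel_measurable borel.
     (\<integral>\<^sup>+x. f (A *v x) \<partial>lborel) = ennreal c * (\<integral>\<^sup>+x. f x \<partial>lborel) \<and>
     (\<integral>\<^sup>+x. f (transpose A *v x) \<partial>lborel) = ennreal c * (\<integral>\<^sup>+x. f x \<partial>lborel)"
proof -
  define P where "P A \<longleftrightarrow> (invertible A \<longrightarrow> (\<exists>c>0. \<forall>f\<in>borel_measurable borel.
     (\<integral>\<^sup>+x. f (A *v x) \<partial>lborel) = ennreal c * (\<integral>\<^sup>+x. f x \<partial>lborel) \<and>
     (\<integral>\<^sup>+x. f (transpose A *v x) \<partial>lborel) = ennreal c * (\<integral>\<^sup>+x. f x \<partial>lborel)))" for A :: "real^'n^'n"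
  have mv[measurable]: "(\<lambda>x. B *v x) \<in> borel \<rightarrow>\<^sub>M borel" for B :: "real^'n^'n"
    by (rule borel_measurable_continuous_onI) (simp add: linear_continuous_on linear_linear)
  have mv'[measurable]: "(\<lambda>x. x v* B) \<in> borel \<rightarrow>\<^sub>M borel" for B :: "real^'n^'n"
    using mv[of "transpose B"] by simp
  \<comment> \<open>Both integrals go through the induction together: transposition reverses the
    order of a product, but the scaling factors are numbers and commute.\<close>
  have "P A"
  proof (rule induct_matrix_elementary_alt)
    fix A B assume A: "P A" and B: "P B"
    show "P (A ** B)" unfolding P_def
    proof
      assume inv: "invertible (A ** B)"
      then have "det A \<noteq> 0" "det B \<noteq> 0" by (auto simp: invertible_det_nz det_mul)
      then have "invertible A" "invertible B" by (auto simp: invertible_det_nz)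
      with A B obtain a b where ab: "a > 0" "b > 0"
        and a: "\<And>f. f \<in> borel_measurable borel \<Longrightarrow> (\<integral>\<^sup>+x. f (A *v x) \<partial>lborel) = ennreal a * (\<integral>\<^sup>+x. f x \<partial>lborel) \<and>
          (\<integral>\<^sup>+x. f (transpose A *v x) \<partial>lborel) = ennreal a * (\<integral>\<^sup>+x. f x \<partial>lborel)"
        and b: "\<And>f. f \<in> borel_measurable borel \<Longrightarrow> (\<integral>\<^sup>+x. f (B *v x) \<partial>lborel) = ennreal b * (\<integral>\<^sup>+x. f x \<partial>lborel) \<and>
          (\<integral>\<^sup>+x. f (transpose B *v x) \<partial>lborel) = ennreal b * (\<integral>\<^sup>+x. f x \<partial>lborel)"
        unfolding P_def by blast
      show "\<exists>c>0. \<forall>f\<in>borel_measurable borel.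
         (\<integral>\<^sup>+x. f (A ** B *v x) \<partial>lborel) = ennreal c * (\<integral>\<^sup>+x. f x \<partial>lborel) \<and>
         (\<integral>\<^sup>+x. f (transpose (A ** B) *v x) \<partial>lborel) = ennreal c * (\<integral>\<^sup>+x. f x \<partial>lborel)"
      proof (intro exI[of _ "a * b"] conjI ballI)
        fix f :: "real^'n \<Rightarrow> ennreal" assume f[measurable]: "f \<in> borel_measurable borel"
        have "(\<integral>\<^sup>+x. f (A ** B *v x) \<partial>lborel) = (\<integral>\<^sup>+x. f (A *v (B *v x)) \<partial>lborel)"
          by (simp add: matrix_vector_mul_assoc)
        also have "\<dots> = ennreal b * (\<integral>\<^sup>+x. f (A *v x) \<partial>lborel)"
          by (rule conjunct1[OF b]) simp
        finally show "(\<integral>\<^sup>+x. f (A ** B *v x) \<partial>lborel) = ennreal (a * b) * (\<integral>\<^sup>+x. f x \<partial>lborel)"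
          using a[OF f] ab by (simp add: ennreal_mult mult.assoc mult.left_commute)
        have "(\<integral>\<^sup>+x. f (transpose (A ** B) *v x) \<partial>lborel) = (\<integral>\<^sup>+x. f (transpose B *v (transpose A *v x)) \<partial>lborel)"
          by (simp only: matrix_vector_mul_assoc matrix_transpose_mul)
        also have "\<dots> = ennreal a * (\<integral>\<^sup>+x. f (transpose B *v x) \<partial>lborel)"
          by (rule conjunct2[OF a]) simp
        finally show "(\<integral>\<^sup>+x. f (transpose (A ** B) *v x) \<partial>lborel) = ennreal (a * b) * (\<integral>\<^sup>+x. f x \<partial>lborel)"
          using b[OF f] ab by (simp add: ennreal_mult mult.assoc)
      qed (use ab in simp)
    qed
  next
    fix A :: "real^'n^'n" and i assume "row i A = 0"
    then show "P A" by (simp add: P_def invertible_det_nz det_zero_row)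
  next
    fix A :: "real^'n^'n" assume dg: "\<And>i j. i \<noteq> j \<Longrightarrow> A $ i $ j = 0"
    show "P A" unfolding P_def
    proof
      assume "invertible A"
      then have nz: "A $ i $ i \<noteq> 0" for i
        using det_diagonal[OF dg] by (auto simp: invertible_det_nz)
      have A: "A *v x = (\<chi> i. A $ i $ i * x $ i)" for x
      proof -
        have "(\<Sum>j\<in>UNIV. A $ i $ j * x $ j) = (\<Sum>j\<in>UNIV. if j = i then A $ i $ i * x $ i else 0)" for i
          using dg by (intro sum.cong) auto
        then show ?thesis by (simp add: vec_eq_iff matrix_vector_mult_def)
      qed
      have tr: "transpose A = A"
      proof -
        have "A $ i $ j = A $ j $ i" for i j using dg[of i j] dg[of j i] by (cases "i = j") auto
        then show ?thesis by (simp add: vec_eq_iff transpose_def)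
      qed
      have pos: "1 / (\<Prod>i\<in>UNIV. \<bar>A $ i $ i\<bar>) > 0" using nz by (auto intro!: prod_pos)
      show "\<exists>c>0. \<forall>f\<in>borel_measurable borel.
         (\<integral>\<^sup>+x. f (A *v x) \<partial>lborel) = ennreal c * (\<integral>\<^sup>+x. f x \<partial>lborel) \<and>
         (\<integral>\<^sup>+x. f (transpose A *v x) \<partial>lborel) = ennreal c * (\<integral>\<^sup>+x. f x \<partial>lborel)"
        unfolding tr unfolding A
        by (rule exI[of _ "1 / (\<Prod>i\<in>UNIV. \<bar>A $ i $ i\<bar>)"])
          (use pos nz in \<open>auto simp del: prod_pos intro!: nn_integral_scale_coords\<close>)
    qed
  next
    fix m n :: 'n assume "m \<noteq> n"
    let ?A = "(\<chi> i j. mat 1 $ i $ Transposition.transpose m n j) :: real^'n^'n"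
    have A: "?A *v x = (\<chi> i. x $ Transposition.transpose m n i)" for x
    proof -
      have "(\<Sum>j\<in>UNIV. ?A $ i $ j * x $ j) = (\<Sum>j\<in>UNIV. if j = Transposition.transpose m n i then x $ Transposition.transpose m n i else 0)" for i
        by (intro sum.cong) (auto simp: mat_def)
      then show ?thesis by (simp add: vec_eq_iff matrix_vector_mult_def)
    qed
    have tr: "transpose ?A = ?A"
      by (auto simp: vec_eq_iff transpose_def mat_def)
    show "P ?A" unfolding P_def tr unfolding A
      by (intro impI exI[of _ 1]) (auto simp: nn_integral_permute_coords)
  next
    fix m n :: 'n assume mn: "m \<noteq> n"
    let ?A = "\<lambda>m n. (\<chi> i j. of_bool (i = m \<and> j = n \<or> i = j)) :: real^'n^'n"
    have A: "?A m n *v x = x + (axis n 1 \<bullet> x) *\<^sub>R axis m 1" if "m \<noteq> n" for m n x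
    proof -
      have "(\<Sum>j\<in>UNIV. ?A m n $ i $ j * x $ j) = (\<Sum>j\<in>UNIV. (if j = i then x $ i else 0) + (if j = n then (if i = m then x $ n else 0) else 0))" for i
        using that by (intro sum.cong) auto
      then show ?thesis by (simp add: vec_eq_iff matrix_vector_mult_def sum.distrib inner_axis') (simp add: axis_def)
    qed
    have tr: "transpose (?A m n) = ?A n m"
      by (auto simp: vec_eq_iff transpose_def)
    have o: "axis n 1 \<bullet> (axis m 1 :: real^'n) = 0" "axis m 1 \<bullet> (axis n 1 :: real^'n) = 0"
      using mn by (auto simp: inner_axis_axis)
    \<comment> \<open>Transposition exchanges m and n, so both integrals are over transvections
      along orthogonal unit vectors, with factor 1.\<close>
    show "P (?A m n)" unfolding P_def tr A[OF mn] A[OF mn[symmetric]]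
      by (intro impI exI[of _ 1]) (auto simp: nn_integral_transvection o)
  qed
  then show ?thesis using assms by (simp add: P_def)
qed

section \<open>Shears and rotations of pairs, that is, multiplication by complex numbers of modulus
  1\<close>

lemma nn_integral_shear_pair:
  fixes f :: "'a::euclidean_space \<times> 'a \<Rightarrow> ennreal"
  assumes f[measurable]: "f \<in> borel_measurable borel"
  shows "(\<integral>\<^sup>+z. f (fst z + s *\<^sub>R snd z, snd z) \<partial>lborel) = (\<integral>\<^sup>+z. f z \<partial>lborel)"
    and "(\<integral>\<^sup>+z. f (fst z, snd z + s *\<^sub>R fst z) \<partial>lborel) = (\<integral>\<^sup>+z. f z \<partial>lborel)"
proof -
  have f': "f \<in> borel_measurable (lborel \<Otimes>\<^sub>M lborel)" by (simp add: lborel_prod)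
  have m: "(\<lambda>z::'a\<times>'a. (fst z + s *\<^sub>R snd z, snd z)) \<in> borel \<rightarrow>\<^sub>M borel"
     "(\<lambda>z::'a\<times>'a. (fst z, snd z + s *\<^sub>R fst z)) \<in> borel \<rightarrow>\<^sub>M borel"
    by (intro borel_measurable_continuous_onI continuous_intros)+
  have g[measurable]: "(\<lambda>z. f (fst z + s *\<^sub>R snd z, snd z)) \<in> borel_measurable (borel \<Otimes>\<^sub>M borel)"
     "(\<lambda>z. f (fst z, snd z + s *\<^sub>R fst z)) \<in> borel_measurable (borel \<Otimes>\<^sub>M borel)"
    using measurable_compose[OF m(1) f] measurable_compose[OF m(2) f] by (simp_all add: borel_prod)
  have "(\<integral>\<^sup>+z. f (fst z + s *\<^sub>R snd z, snd z) \<partial>lborel) = (\<integral>\<^sup>+b. (\<integral>\<^sup>+a. f (a + s *\<^sub>R b, b) \<partial>lborel) \<partial>lborel)"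
    using g by (subst lborel_prod[symmetric], subst lborel_pair.nn_integral_snd[symmetric]) (auto cong: measurable_cong_sets)
  also have "\<dots> = (\<integral>\<^sup>+b. (\<integral>\<^sup>+a. f (a, b) \<partial>lborel) \<partial>lborel)"
    by (intro nn_integral_cong nn_integral_lborel_translate[where f="\<lambda>a. f (a, _)"]) simp
  also have "\<dots> = (\<integral>\<^sup>+z. f z \<partial>lborel)"
    using f' by (subst lborel_prod[symmetric], subst lborel_pair.nn_integral_snd[symmetric]) (auto cong: measurable_cong_sets)
  finally show "(\<integral>\<^sup>+z. f (fst z + s *\<^sub>R snd z, snd z) \<partial>lborel) = (\<integral>\<^sup>+z. f z \<partial>lborel)" .
  have "(\<integral>\<^sup>+z. f (fst z, snd z + s *\<^sub>R fst z) \<partial>lborel) = (\<integral>\<^sup>+a. (\<integral>\<^sup>+b. f (a, b + s *\<^sub>R a) \<partial>lborel) \<partial>lborel)"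
    using g by (subst lborel_prod[symmetric], subst lborel.nn_integral_fst[symmetric]) (auto cong: measurable_cong_sets)
  also have "\<dots> = (\<integral>\<^sup>+a. (\<integral>\<^sup>+b. f (a, b) \<partial>lborel) \<partial>lborel)"
    by (intro nn_integral_cong nn_integral_lborel_translate[where f="\<lambda>b. f (_, b)"]) simp
  also have "\<dots> = (\<integral>\<^sup>+z. f z \<partial>lborel)"
    using f' by (subst lborel_prod[symmetric], subst lborel.nn_integral_fst[symmetric]) (auto cong: measurable_cong_sets)
  finally show "(\<integral>\<^sup>+z. f (fst z, snd z + s *\<^sub>R fst z) \<partial>lborel) = (\<integral>\<^sup>+z. f z \<partial>lborel)" .
qed

text \<open>A rotation by an angle other than \<open>\<pi>\<close> is a product of three shears; halving the angle removes
  the exception.\<close>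

lemma nn_integral_rotate_pair:
  fixes f :: "'a::euclidean_space \<times> 'a \<Rightarrow> ennreal"
  assumes f: "f \<in> borel_measurable borel" and \<theta>: "\<theta> \<in> {0..2*pi}"
  shows "(\<integral>\<^sup>+z. f (cos \<theta> *\<^sub>R fst z - sin \<theta> *\<^sub>R snd z, cos \<theta> *\<^sub>R snd z + sin \<theta> *\<^sub>R fst z) \<partial>lborel) = (\<integral>\<^sup>+z. f z \<partial>lborel)"
proof -
  \<comment> \<open>With a pair read as fst + i snd, \<open>R t\<close> is multiplication by
    \<open>cis t\<close>.\<close>
  define R :: "real \<Rightarrow> 'a \<times> 'a \<Rightarrow> 'a \<times> 'a" where
    "R t z = (cos t *\<^sub>R fst z - sin t *\<^sub>R snd z, cos t *\<^sub>R snd z + sin t *\<^sub>R fst z)" for t z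
  have R[measurable]: "R t \<in> borel \<rightarrow>\<^sub>M borel" for t
    unfolding R_def by (intro borel_measurable_continuous_onI continuous_intros)
  have RR: "R s (R t z) = R (s + t) z" for s t z
    by (simp add: R_def cos_add sin_add algebra_simps)
  have main: "(\<integral>\<^sup>+z. f (R t z) \<partial>lborel) = (\<integral>\<^sup>+z. f z \<partial>lborel)"
    if f[measurable]: "f \<in> borel_measurable borel" and c: "cos (t/2) \<noteq> 0" for f t
  proof -
    \<comment> \<open>\<open>R t\<close> is the composition S T S of shears with parameters
      -tan(t/2), sin t, -tan(t/2); facts 1 and 2 are the half-angle formulas behind this.\<close>
    define s where "s = - tan (t/2)"
    define S :: "'a \<times> 'a \<Rightarrow> 'a \<times> 'a" where "S z = (fst z + s *\<^sub>R snd z, snd z)" for z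
    define T :: "'a \<times> 'a \<Rightarrow> 'a \<times> 'a" where "T z = (fst z, snd z + sin t *\<^sub>R fst z)" for z
    have [measurable]: "S \<in> borel \<rightarrow>\<^sub>M borel" "T \<in> borel \<rightarrow>\<^sub>M borel"
      unfolding S_def T_def by (intro borel_measurable_continuous_onI continuous_intros)+
    have t: "t = 2 * (t/2)" by simp
    have sn: "sin t = 2 * sin (t/2) * cos (t/2)" by (subst t, subst sin_double) simp
    have cs: "cos t = 1 - 2 * sin (t/2) ^ 2" by (subst t, subst cos_double_sin) simp
    have 1: "1 + s * sin t = cos t"
      using c by (simp add: s_def tan_def sn cs power2_eq_square)
    have 2: "s + s * cos t = - sin t"
    proof -
      have "1 + cos t = 2 * cos (t/2) ^ 2" by (subst (1) t, subst cos_double_cos) simp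
      then have "s * (1 + cos t) = - sin t" using c by (simp add: s_def tan_def sn power2_eq_square)
      then show ?thesis by (simp add: algebra_simps)
    qed
    have "S (T (S z)) = R t z" for z
    proof -
      have "S (T (S z)) = ((1 + s * sin t) *\<^sub>R fst z + (s + s * (1 + s * sin t)) *\<^sub>R snd z,
        (1 + s * sin t) *\<^sub>R snd z + sin t *\<^sub>R fst z)"
        by (simp add: S_def T_def algebra_simps) (metis scaleR_2 scaleR_scaleR mult.commute)
      then show ?thesis unfolding 1 2 by (simp add: R_def)
    qed
    then have "(\<integral>\<^sup>+z. f (R t z) \<partial>lborel) = (\<integral>\<^sup>+z. f (S (T (S z))) \<partial>lborel)" by simp
    also have "\<dots> = (\<integral>\<^sup>+z. f (S (T z)) \<partial>lborel)"
      using nn_integral_shear_pair(1)[of "\<lambda>z. f (S (T z))" s] by (simp add: S_def[of "_ :: 'a \<times> 'a", symmetric])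
    also have "\<dots> = (\<integral>\<^sup>+z. f (S z) \<partial>lborel)"
      using nn_integral_shear_pair(2)[of "\<lambda>z. f (S z)" "sin t"] by (simp add: T_def[symmetric])
    also have "\<dots> = (\<integral>\<^sup>+z. f z \<partial>lborel)"
      using nn_integral_shear_pair(1)[of f s] by (simp add: S_def[symmetric])
    finally show ?thesis .
  qed
  show ?thesis
  proof (cases "\<theta> = 2*pi")
    case False
    \<comment> \<open>\<theta>/4 lies in [0, pi/2), so the formula by shears applies to the half
      angle, twice. At 2 pi the rotation is the identity.\<close>
    have "cos (\<theta>/2/2) > 0" using \<theta> pi_gt_zero False by (intro cos_gt_zero_pi) auto
    then have c: "cos (\<theta>/2/2) \<noteq> 0" by simp
    note [measurable] = f
    have "(\<integral>\<^sup>+z. f (R \<theta> z) \<partial>lborel) = (\<integral>\<^sup>+z. f (R (\<theta>/2) (R (\<theta>/2) z)) \<partial>lborel)"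
      by (simp add: RR)
    also have "\<dots> = (\<integral>\<^sup>+z. f (R (\<theta>/2) z) \<partial>lborel)" by (rule main[OF _ c]) simp
    also have "\<dots> = (\<integral>\<^sup>+z. f z \<partial>lborel)" by (rule main[OF f c])
    finally show ?thesis by (simp add: R_def)
  qed simp
qed

subsection \<open>Mean values of holomorphic functions of one variable\<close>

text \<open>One probability space for both kinds of mean: t goes to \<open>cis (2 * pi * t)\<close>
  on the circle, and to \<open>- cot (pi * t)\<close> on the line, where it induces the Poisson
  kernel of the half plane at i.\<close>

abbreviation unit_measure :: "real measure" where
  "unit_measure \<equiv> restrict_space lborel {0..1}"

lemma finite_measure_unit: "finite_measure unit_measure" "measure unit_measure {0..1} = 1"
  by (auto intro!: finite_measureI simp: emeasure_restrict_space measure_restrict_space)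

interpretation unit: finite_measure unit_measure by (rule finite_measure_unit)

text \<open>The supporting line at m of the convex function s^p. It comes from Young's inequality
  for s and m^(p-1), so no derivative at 0 has to be discussed.\<close>

lemma powr_ge_tangent:
  fixes s m p :: real
  assumes "s \<ge> 0" "m \<ge> 0" "p \<ge> 1"
  shows "m powr p + p * m powr (p - 1) * (s - m) \<le> s powr p"
proof (cases "p = 1 \<or> m = 0")
  \<comment> \<open>For \<open>m = 0\<close> the linear term vanishes even when p = 1, because
    \<open>0 powr 0 = 0\<close>.\<close>
  case True then show ?thesis using assms by auto
next
  case False
  then have p: "p > 1" and m: "m > 0" using assms by auto
  define q where "q = p / (p - 1)"
  have q: "q > 1" "1/p + 1/q = 1" using p by (auto simp: q_def field_simps)
  have "s * m powr (p - 1) \<le> s powr p / p + (m powr (p - 1)) powr q / q"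
    using assms p q by (intro Youngs_inequality) auto
  moreover have "(m powr (p - 1)) powr q = m powr p"
    using p by (simp add: powr_powr q_def)
  moreover have "m powr (p - 1) * m = m powr p"
    using m by (simp add: powr_diff)
  moreover have "1 / q = 1 - 1/p" using q by simp
  ultimately have "s * m powr (p - 1) \<le> s powr p / p + m powr p * (1 - 1/p)"
    by (metis times_divide_eq_right mult.right_neutral)
  then have "p * (s * m powr (p - 1)) \<le> s powr p + m powr p * (p - 1)"
    using p by (simp add: field_simps)
  then show ?thesis using \<open>m powr (p - 1) * m = m powr p\<close> by (simp add: algebra_simps)
qed

text \<open>Jensen's inequality: the supporting line at m, the norm of the integral, is integrated
  against a measure of total mass 1. The bound B provides integrability.\<close>

lemma powr_norm_integral_le:
  fixes f :: "real \<Rightarrow> complex"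
  assumes f[measurable]: "f \<in> borel_measurable unit_measure"
    and B: "\<And>t. t \<in> {0..1} \<Longrightarrow> cmod (f t) \<le> B" and p: "p \<ge> 1"
  shows "ennreal (cmod (integral\<^sup>L unit_measure f) powr p) \<le> (\<integral>\<^sup>+t. ennreal (cmod (f t) powr p) \<partial>unit_measure)"
proof -
  have If: "integrable unit_measure f"
    by (rule unit.integrable_const_bound[of _ B]) (use B in \<open>auto simp: AE_restrict_space_iff\<close>)
  have Ip: "integrable unit_measure (\<lambda>t. cmod (f t) powr p)"
    by (rule unit.integrable_const_bound[of _ "B powr p"])
      (use B p in \<open>auto simp: AE_restrict_space_iff intro!: powr_mono2\<close>)
  define m where "m = cmod (integral\<^sup>L unit_measure f)"
  have m: "m \<le> (LINT t|unit_measure. cmod (f t))" unfolding m_def by (rule integral_norm_bound)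
  have "m powr p \<le> m powr p + p * m powr (p - 1) * ((LINT t|unit_measure. cmod (f t)) - m)"
    using m p by simp
  also have "\<dots> = (LINT t|unit_measure. m powr p + p * m powr (p - 1) * (cmod (f t) - m))"
    using If by (simp add: finite_measure_unit(2))
  also have "\<dots> \<le> (LINT t|unit_measure. cmod (f t) powr p)"
    by (intro integral_mono Ip powr_ge_tangent) (use If p in \<open>auto simp: m_def\<close>)
  finally have "ennreal (m powr p) \<le> ennreal (LINT t|unit_measure. cmod (f t) powr p)"
    by (rule ennreal_leI)
  also have "\<dots> = (\<integral>\<^sup>+t. ennreal (cmod (f t) powr p) \<partial>unit_measure)"
    by (rule nn_integral_eq_integral[symmetric]) (use Ip in auto)
  finally show ?thesis by (simp add: m_def)
qed

lemma continuous_imp_measurable_unit: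
  fixes f :: "real \<Rightarrow> 'a::{second_countable_topology, real_normed_vector}"
  assumes "continuous_on {0..1} f"
  shows "f \<in> borel_measurable unit_measure"
  using borel_measurable_continuous_on_restrict[OF assms]
  by (simp add: measurable_def sets_restrict_space space_restrict_space)

lemma mean_value_circle:
  assumes "g holomorphic_on ball 0 1" "continuous_on (cball 0 1) g"
  shows "integral\<^sup>L unit_measure (\<lambda>t. g (cis (2 * pi * t))) = g 0"
proof -
  have "((\<lambda>u. g u / (u - 0)) has_contour_integral (2 * of_real pi * \<i> * g 0)) (circlepath 0 1)"
    by (rule Cauchy_integral_circlepath) (use assms in auto)
  then have "((\<lambda>t. g (circlepath 0 1 t) / circlepath 0 1 t * (2 * of_real pi * \<i> * exp (2 * of_real pi * \<i> * of_real t)))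
      has_integral (2 * of_real pi * \<i> * g 0)) {0..1}"
    unfolding has_contour_integral
    by (rule has_integral_eq[rotated]) (simp add: vector_derivative_circlepath01 vector_derivative_circlepath)
  then have "((\<lambda>t. (1 / (2 * of_real pi * \<i>)) * (g (circlepath 0 1 t) / circlepath 0 1 t * (2 * of_real pi * \<i> * exp (2 * of_real pi * \<i> * of_real t))))
      has_integral ((1 / (2 * of_real pi * \<i>)) * (2 * of_real pi * \<i> * g 0))) {0..1}"
    by (rule has_integral_mult_right)
  moreover have e: "circlepath 0 1 t = cis (2 * pi * t)" for t
    by (simp add: circlepath cis_conv_exp mult_ac)
  ultimately have *: "((\<lambda>t. g (cis (2 * pi * t))) has_integral g 0) {0..1}"
    by (simp add: cis_conv_exp mult_ac)
  have "continuous_on {0..1} (\<lambda>t. g (cis (2 * pi * t)))"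
    by (rule continuous_on_compose2[OF assms(2)]) (auto intro!: continuous_intros)
  then have "set_integrable lborel {0..1} (\<lambda>t. g (cis (2 * pi * t)))"
    by (rule borel_integrable_atLeastAtMost')
  then have "(LINT t:{0..1}|lborel. g (cis (2 * pi * t))) = g 0"
    using * by (metis set_borel_integral_eq_integral(2) integral_unique)
  then show ?thesis by (simp add: integral_restrict_space set_lebesgue_integral_def)
qed

lemma powr_norm_le_circle_mean:
  assumes "g holomorphic_on S" "open S" "cball 0 1 \<subseteq> S" and p: "p \<ge> 1"
  shows "ennreal (cmod (g 0) powr p) \<le> (\<integral>\<^sup>+t. ennreal (cmod (g (cis (2 * pi * t))) powr p) \<partial>unit_measure)"
proof -
  have c: "continuous_on (cball 0 1) g"
    using assms by (meson continuous_on_subset holomorphic_on_imp_continuous_on)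
  have "compact (g ` cball 0 1)" using c by (intro compact_continuous_image) auto
  then obtain B where B: "\<And>z. z \<in> cball 0 1 \<Longrightarrow> cmod (g z) \<le> B"
    by (meson bounded_iff compact_imp_bounded image_eqI)
  have "integral\<^sup>L unit_measure (\<lambda>t. g (cis (2 * pi * t))) = g 0"
    by (rule mean_value_circle[OF _ c]) (use assms in \<open>meson ball_subset_cball holomorphic_on_subset subset_trans\<close>)
  moreover have "continuous_on {0..1} (\<lambda>t. g (cis (2 * pi * t)))"
    by (rule continuous_on_compose2[OF c]) (auto intro!: continuous_intros)
  ultimately show ?thesis
    using powr_norm_integral_le[of "\<lambda>t. g (cis (2 * pi * t))" B p] B p
    by (simp add: continuous_imp_measurable_unit)
qed

text \<open>The Cayley transform takes the unit circle to the real line. Where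
  \<open>sin x = 0\<close>, both sides are 0 by the convention on division by zero.\<close>

lemma cayley_cis:
  "\<i> * (1 + cis (2 * x)) / (1 - cis (2 * x)) = of_real (- cot x)"
proof -
  have c: "cis (2 * x) = cis x * cis x" by (simp add: cis_mult)
  have "1 = cis x * cis (- x)" by (simp add: cis_mult)
  then have 1: "1 + cis (2 * x) = cis x * (cis (-x) + cis x)" "1 - cis (2 * x) = cis x * (cis (-x) - cis x)"
    unfolding c by (simp_all only: distrib_left right_diff_distrib)
  have 2: "cis (-x) + cis x = 2 * of_real (cos x)" "cis (-x) - cis x = - 2 * \<i> * of_real (sin x)"
    by (simp_all add: complex_eq_iff)
  show ?thesis unfolding 1 2 by (cases "sin x = 0") (auto simp: cot_def field_simps)
qed

text \<open>The Poisson formula for the upper half plane, written on the circle by means of the Cayley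
  transform, so that no kernel appears.\<close>

lemma powr_norm_le_halfplane_mean:
  assumes hol: "f holomorphic_on S" "open S" and S: "\<And>z. Im z \<ge> 0 \<Longrightarrow> z \<in> S"
    and B: "\<And>z. Im z \<ge> 0 \<Longrightarrow> cmod (f z) \<le> B" and p: "p \<ge> 1"
  shows "ennreal (cmod (f \<i>) powr p) \<le> (\<integral>\<^sup>+t. ennreal (cmod (f (of_real (- cot (pi * t)))) powr p) \<partial>unit_measure)"
proof -
  define c where "c w = \<i> * (1 + w) / (1 - w)" for w :: complex
  have Imc: "Im (c w) \<ge> 0" if "cmod w \<le> 1" for w
  proof (cases "w = 1")
    case False
    have "Im (c w) = (1 - (cmod w)^2) / (cmod (1 - w))^2"
      unfolding c_def cmod_power2 by (simp add: Im_divide) (simp add: power2_eq_square algebra_simps)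
    moreover have "(cmod w)^2 \<le> 1" using that by (simp add: power_le_one)
    ultimately show ?thesis by simp
  qed (simp add: c_def)
  have contf: "continuous_on {z. Im z \<ge> 0} f"
    using S by (intro continuous_on_subset[OF holomorphic_on_imp_continuous_on[OF hol(1)]]) auto
  have chol: "c holomorphic_on - {1}" unfolding c_def by (intro holomorphic_intros) auto
  \<comment> \<open>The pole 1 of the Cayley transform corresponds to infinity in the half plane,
    where f may have no limit. The mean value property is therefore used on circles of radius
    \<open>r k\<close> < 1, and the bound on f permits the passage to the unit circle.\<close>
  define r where "r k = 1 - inverse (real (Suc k))" for k
  have r: "0 \<le> r k" "r k < 1" for k by (auto simp: r_def field_simps)
  have rlim: "r \<longlonglongrightarrow> 1"
  proof -
    have "(\<lambda>k. 1 - inverse (real (Suc k))) \<longlonglongrightarrow> 1 - 0"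
      by (intro tendsto_diff tendsto_const LIMSEQ_inverse_real_of_nat)
    then show ?thesis unfolding r_def by simp
  qed
  have rc: "cmod (of_real (r k) * w) < 1" if "cmod w \<le> 1" for k w
  proof -
    have "cmod (of_real (r k) * w) = r k * cmod w" using r by (simp add: norm_mult)
    also have "\<dots> \<le> r k * 1" using that r by (intro mult_left_mono) auto
    finally show ?thesis using r(2)[of k] by simp
  qed
  have Imr: "0 \<le> Im (c (of_real (r k) * cis x))" for k x
    using rc[of "cis x" k] by (intro Imc) (simp del: norm_mult)
  have eq: "integral\<^sup>L unit_measure (\<lambda>t. f (c (of_real (r k) * cis (2 * pi * t)))) = f \<i>" for k
  proof -
    have h: "(\<lambda>w. f (c (of_real (r k) * w))) holomorphic_on {w. cmod (of_real (r k) * w) < 1}"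
    proof -
      have "(f \<circ> (c \<circ> (\<lambda>w. of_real (r k) * w))) holomorphic_on {w. cmod (of_real (r k) * w) < 1}"
      proof (rule holomorphic_on_compose_gen[OF _ hol(1)])
        show "(c \<circ> (\<lambda>w. of_real (r k) * w)) holomorphic_on {w. cmod (of_real (r k) * w) < 1}"
          by (rule holomorphic_on_compose_gen[OF _ chol]) (auto intro!: holomorphic_intros)
      qed (use S Imc in auto)
      then show ?thesis by (simp add: o_def)
    qed
    have "integral\<^sup>L unit_measure (\<lambda>t. f (c (of_real (r k) * cis (2 * pi * t)))) = f (c (of_real (r k) * 0))"
      by (rule mean_value_circle)
        (use rc in \<open>auto intro!: holomorphic_on_subset[OF h] continuous_on_subset[OF holomorphic_on_imp_continuous_on[OF h]]\<close>)
    then show ?thesis by (simp add: c_def)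
  qed
  have meas[measurable]: "(\<lambda>t. f (of_real (- cot (pi * t)))) \<in> borel_measurable unit_measure"
  proof -
    have "(\<lambda>x. f (of_real x)) \<in> borel_measurable borel"
      by (intro borel_measurable_continuous_onI continuous_on_compose2[OF contf]) (auto intro!: continuous_intros)
    moreover have "(\<lambda>t. - cot (pi * t)) \<in> borel_measurable unit_measure"
      unfolding cot_def by (rule measurable_restrict_space1) measurable
    ultimately show ?thesis by (rule measurable_compose[rotated])
  qed
  have "(\<lambda>k. integral\<^sup>L unit_measure (\<lambda>t. f (c (of_real (r k) * cis (2 * pi * t)))))
    \<longlonglongrightarrow> integral\<^sup>L unit_measure (\<lambda>t. f (of_real (- cot (pi * t))))"
  proof (rule integral_dominated_convergence[where w="\<lambda>_. B"])
    show "(\<lambda>t. f (c (of_real (r k) * cis (2 * pi * t)))) \<in> borel_measurable unit_measure" for k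
    proof (rule continuous_imp_measurable_unit)
      have ne: "of_real (r k) * cis (2 * pi * t) \<noteq> 1" for t
        using rc[of "cis (2*pi*t)" k] by (metis norm_cis norm_one order_refl less_irrefl)
      then show "continuous_on {0..1} (\<lambda>t. f (c (of_real (r k) * cis (2 * pi * t))))"
        by (intro continuous_on_compose2[OF contf] continuous_on_compose2[OF holomorphic_on_imp_continuous_on[OF chol]])
          (use Imr ne in \<open>auto intro!: continuous_intros\<close>)
    qed
    show "AE t in unit_measure. (\<lambda>k. f (c (of_real (r k) * cis (2 * pi * t)))) \<longlonglongrightarrow> f (of_real (- cot (pi * t)))"
    proof -
      \<comment> \<open>Both endpoints parametrize the pole; everywhere else the integrand
        converges.\<close>
      have "AE t in lborel. t \<notin> {0, 1::real}"
        by (intro AE_not_in finite_imp_null_set_lborel) auto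
      then have "AE t in unit_measure. t \<notin> {0, 1::real}"
        by (simp add: AE_restrict_space_iff) (auto elim: eventually_mono)
      moreover have "AE t in unit_measure. t \<in> {0..1}" by (simp add: AE_restrict_space_iff)
      ultimately show ?thesis
      proof eventually_elim
        case (elim t)
        then have t: "0 < t" "t < 1" by (cases "t=0"; cases "t=1"; force)+
        have "sin (pi * t) > 0" using t by (intro sin_gt_zero) auto
        then have ne: "cis (2 * pi * t) \<noteq> 1"
          proof -
          have "Re (cis (2 * (pi * t))) = 1 - 2 * sin (pi * t) ^ 2" by (simp add: cos_double_sin)
          with \<open>sin (pi * t) > 0\<close> show ?thesis by (auto simp: complex_eq_iff mult.assoc)
        qed
        have "(\<lambda>k. of_real (r k) * cis (2 * pi * t)) \<longlonglongrightarrow> of_real 1 * cis (2 * pi * t)"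
          by (intro tendsto_intros rlim)
        then have "(\<lambda>k. c (of_real (r k) * cis (2 * pi * t))) \<longlonglongrightarrow> c (cis (2 * pi * t))"
          unfolding c_def using ne by (intro tendsto_intros) auto
        moreover have "c (cis (2 * pi * t)) = of_real (- cot (pi * t))"
          using cayley_cis[of "pi * t"] by (simp add: c_def mult.assoc)
        ultimately have "(\<lambda>k. c (of_real (r k) * cis (2 * pi * t))) \<longlonglongrightarrow> of_real (- cot (pi * t))" by simp
        then show ?case
          by (rule continuous_on_tendsto_compose[OF contf]) (use Imr in auto)
      qed
    qed
    show "AE t in unit_measure. norm (f (c (of_real (r k) * cis (2 * pi * t)))) \<le> B" for k
      using B Imr by (intro AE_I2) auto
  qed (use meas in auto)
  then have "f \<i> = integral\<^sup>L unit_measure (\<lambda>t. f (of_real (- cot (pi * t))))"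
    unfolding eq by (simp add: LIMSEQ_const_iff)
  then show ?thesis
    using powr_norm_integral_le[OF meas B p] by simp
qed

subsection \<open>Holomorphic functions on tubes\<close>

lemma open_tube:
  fixes \<Gamma> :: "(real^'n) set"
  assumes "open \<Gamma>" shows "open (tube \<Gamma>)"
proof -
  have "tube \<Gamma> = (\<lambda>z. \<chi> j. Im (z $ j)) -` \<Gamma>"
  proof safe
    fix z :: "complex^'n" assume "(\<chi> j. Im (z $ j)) \<in> \<Gamma>"
    moreover have "z = cvec (\<chi> j. Re (z $ j)) (\<chi> j. Im (z $ j))"
      by (simp add: cvec_def vec_eq_iff)
    ultimately show "z \<in> tube \<Gamma>" unfolding tube_def by blast
  qed (auto simp: tube_def cvec_def)
  moreover have "continuous_on UNIV (\<lambda>z::complex^'n. \<chi> j. Im (z $ j))"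
    by (intro continuous_intros)
  ultimately show ?thesis using assms by (simp add: open_vimage)
qed

lemma cvec_in_tube [simp]: "cvec x y \<in> tube \<Gamma> \<longleftrightarrow> y \<in> \<Gamma>"
proof -
  have "y' = y" if "cvec x y = cvec x' y'" for x' y'
    using that by (auto simp: cvec_def vec_eq_iff)
  then show ?thesis by (auto simp: tube_def)
qed

lemma open_Collect_mem:
  assumes "open S" "continuous_on UNIV f" shows "open {x. f x \<in> S}"
  using open_vimage[OF assms] by (simp add: vimage_def)

text \<open>This is F on the complex line \<open>cvec x y + u *s cvec a b\<close>, written out in
  real and imaginary parts. Discs in a polydisc use a general direction a + ib; half planes over the
  cone use b = 0.\<close>

lemma holomorphic_vec_on_slice:
  fixes F :: "complex^'n \<Rightarrow> complex"
  assumes hol: "holomorphic_vec_on F (tube \<Gamma>)" and op: "open \<Gamma>"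
  shows "(\<lambda>u. F (cvec (x + Re u *\<^sub>R a - Im u *\<^sub>R b) (y + Re u *\<^sub>R b + Im u *\<^sub>R a)))
    holomorphic_on {u. y + Re u *\<^sub>R b + Im u *\<^sub>R a \<in> \<Gamma>}"
proof -
  define w where "w = cvec a b"
  have eq: "cvec (x + Re u *\<^sub>R a - Im u *\<^sub>R b) (y + Re u *\<^sub>R b + Im u *\<^sub>R a) = cvec x y + u *s w" for u
    by (simp add: cvec_def w_def vec_eq_iff complex_eq_iff algebra_simps)
  have bl: "bounded_linear (\<lambda>u::complex. u *s w)"
    by (intro linear_conv_bounded_linear[THEN iffD1] linearI) (auto simp: vec_eq_iff algebra_simps)
  have *: "\<exists>f'. ((\<lambda>u. F (cvec x y + u *s w)) has_field_derivative f') (at u)"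
    if "y + Re u *\<^sub>R b + Im u *\<^sub>R a \<in> \<Gamma>" for u
  proof -
    have z: "cvec x y + u *s w \<in> tube \<Gamma>" using that unfolding eq[symmetric] by simp
    with hol obtain D where D: "(F has_derivative D) (at (cvec x y + u *s w) within tube \<Gamma>)"
       and lin: "\<And>c v. D (c *s v) = c * D v" unfolding holomorphic_vec_on_def by blast
    have D': "(F has_derivative D) (at (cvec x y + u *s w))"
      using D unfolding at_within_open[OF z open_tube[OF op]] .
    have "((\<lambda>u. cvec x y + u *s w) has_derivative (\<lambda>h. h *s w)) (at u)"
      using has_derivative_add[OF has_derivative_const[of "cvec x y"] bounded_linear_imp_has_derivative[OF bl]] by simp
    from has_derivative_compose[OF this D'] have
      "((\<lambda>u. F (cvec x y + u *s w)) has_derivative (\<lambda>h. D (h *s w))) (at u)" .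
    then have "((\<lambda>u. F (cvec x y + u *s w)) has_derivative (*) (D w)) (at u)"
      by (rule has_derivative_eq_rhs) (auto simp: lin)
    then show ?thesis by (auto simp: has_field_derivative_def)
  qed
  show ?thesis unfolding eq holomorphic_on_def field_differentiable_def
    using * by (blast intro: has_field_derivative_at_within)
qed

lemma continuous_on_cvec [continuous_intros]:
  fixes f g :: "'a::topological_space \<Rightarrow> real^'n"
  assumes "continuous_on S f" "continuous_on S g"
  shows "continuous_on S (\<lambda>z. cvec (f z) (g z))"
  unfolding cvec_def Complex_eq by (intro continuous_intros assms)

lemma holomorphic_vec_on_imp_continuous_on:
  assumes "holomorphic_vec_on F S" shows "continuous_on S F"
  using assms unfolding holomorphic_vec_on_def
  by (meson continuous_on_eq_continuous_within has_derivative_continuous)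

text \<open>A pair (a, b) stands for a + ib, and \<open>bal\<close> says that V is balanced: stable
  under complex scalars of modulus at most 1. So V is filled by discs through its centre. The circle
  mean on each of them bounds the value at the centre, and integrating over V makes the rotations
  disappear, since they preserve both V and Lebesgue measure.\<close>

lemma powr_norm_le_balanced_mean:
  fixes F :: "complex^'n \<Rightarrow> complex" and V :: "((real^'n) \<times> (real^'n)) set"
  assumes hol: "holomorphic_vec_on F (tube \<Gamma>)" and op: "open \<Gamma>" and V[measurable]: "V \<in> sets borel"
    and bal: "\<And>a b s t. (a, b) \<in> V \<Longrightarrow> s^2 + t^2 \<le> 1 \<Longrightarrow> (s *\<^sub>R a - t *\<^sub>R b, s *\<^sub>R b + t *\<^sub>R a) \<in> V"
    and sub: "\<And>a b. (a, b) \<in> V \<Longrightarrow> y + b \<in> \<Gamma>" and p: "p \<ge> 1"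
  shows "ennreal (cmod (F (cvec x y)) powr p) * emeasure lborel V
     \<le> (\<integral>\<^sup>+z. ennreal (cmod (F (cvec (x + fst z) (y + snd z))) powr p) * indicator V z \<partial>lborel)"
proof -
  define H where "H z = ennreal (cmod (F (cvec (x + fst z) (y + snd z))) powr p) * indicator V z" for z
  define W :: "((real^'n) \<times> (real^'n)) set" where "W = {z. y + snd z \<in> \<Gamma>}"
  define R :: "real \<Rightarrow> (real^'n) \<times> (real^'n) \<Rightarrow> (real^'n) \<times> (real^'n)" where
    "R t z = (cos t *\<^sub>R fst z - sin t *\<^sub>R snd z, cos t *\<^sub>R snd z + sin t *\<^sub>R fst z)" for t z
  have W: "open W" unfolding W_def
    by (intro open_Collect_mem op continuous_intros)
  have H[measurable]: "H \<in> borel_measurable borel"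
  proof -
    have cont: "continuous_on W (\<lambda>z. F (cvec (x + fst z) (y + snd z)))"
      by (rule continuous_on_compose2[OF holomorphic_vec_on_imp_continuous_on[OF hol]])
        (auto simp: W_def intro!: continuous_intros)
    \<comment> \<open>F is continuous on the tube only, so measurability is shown for the extension
      by 0; it agrees with the integrand because V lies in W.\<close>
    define G where "G z = indicator W z *\<^sub>R F (cvec (x + fst z) (y + snd z))" for z
    have [measurable]: "G \<in> borel_measurable borel"
      unfolding G_def using cont W by (intro borel_measurable_continuous_on_indicator) auto
    have "H = (\<lambda>z. ennreal (cmod (G z) powr p) * indicator V z)"
      using sub by (auto simp: H_def G_def fun_eq_iff W_def split: split_indicator)
    then show ?thesis by simp
  qed
  have RV: "indicator V (R t z) = (indicator V z :: ennreal)" for t z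
  proof -
    have 1: "R t z \<in> V" if "z \<in> V" for t z
      using bal[of "fst z" "snd z" "cos t" "sin t"] that by (simp add: R_def)
    have "R (-t) (R t z) = z"
      by (simp add: R_def algebra_simps flip: scaleR_add_left power2_eq_square) 
    then show ?thesis using 1[of z t] 1[of "R t z" "-t"] by (auto split: split_indicator)
  qed
  have pt: "ennreal (cmod (F (cvec x y)) powr p) * indicator V z \<le> (\<integral>\<^sup>+t. H (R (2 * pi * t) z) \<partial>unit_measure)" for z
  proof (cases "z \<in> V")
    case True
    obtain a b where z: "z = (a, b)" by (cases z)
    define g where "g = (\<lambda>u. F (cvec (x + Re u *\<^sub>R a - Im u *\<^sub>R b) (y + Re u *\<^sub>R b + Im u *\<^sub>R a)))"
    define S where "S = {u. y + Re u *\<^sub>R b + Im u *\<^sub>R a \<in> \<Gamma>}"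
    have gS: "g holomorphic_on S" unfolding g_def S_def by (rule holomorphic_vec_on_slice[OF hol op])
    have "open S" unfolding S_def
      by (intro open_Collect_mem op continuous_intros)
    moreover have "cball 0 1 \<subseteq> S"
    proof
      fix u :: complex assume "u \<in> cball 0 1"
      then have "(Re u)^2 + (Im u)^2 \<le> 1" by (simp add: cmod_def)
      from sub[OF bal[OF True[unfolded z] this]] show "u \<in> S" by (simp add: S_def add.assoc)
    qed
    ultimately have "ennreal (cmod (g 0) powr p) \<le> (\<integral>\<^sup>+t. ennreal (cmod (g (cis (2 * pi * t))) powr p) \<partial>unit_measure)"
      by (intro powr_norm_le_circle_mean[OF gS] p)
    also have "\<dots> = (\<integral>\<^sup>+t. H (R (2 * pi * t) z) \<partial>unit_measure)"
      unfolding H_def RV using True by (intro nn_integral_cong) (simp add: g_def R_def z algebra_simps)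
    finally show ?thesis using True by (simp add: g_def)
  qed simp
  have Rm: "(\<lambda>(z, t). H (R (2 * pi * t) z)) \<in> borel_measurable (lborel \<Otimes>\<^sub>M unit_measure)"
  proof -
    have "(\<lambda>w. R (2 * pi * snd w) (fst w)) \<in> borel \<rightarrow>\<^sub>M borel"
      unfolding R_def by (intro borel_measurable_continuous_onI continuous_intros)
    then have "(\<lambda>w. H (R (2 * pi * snd w) (fst w))) \<in> borel_measurable borel"
      by (rule measurable_compose[OF _ H])
    then have Gm: "(\<lambda>w. H (R (2 * pi * snd w) (fst w))) \<in> borel_measurable (borel \<Otimes>\<^sub>M borel)"
      by (simp add: borel_prod)
    have I: "id \<in> measurable ((lborel :: ((real^'n) \<times> (real^'n)) measure) \<Otimes>\<^sub>M unit_measure) (borel \<Otimes>\<^sub>M borel)"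
    proof -
      have [measurable]: "(\<lambda>x. x) \<in> measurable unit_measure borel"
        by (rule measurable_restrict_space1) simp
      have "(\<lambda>w. (fst w, snd w)) \<in> measurable ((lborel :: ((real^'n) \<times> (real^'n)) measure) \<Otimes>\<^sub>M unit_measure) (borel \<Otimes>\<^sub>M borel)"
        by (intro measurable_Pair measurable_compose[OF measurable_fst] measurable_compose[OF measurable_snd]) auto
      then show ?thesis by (simp add: id_def)
    qed
    show ?thesis using measurable_compose[OF I Gm] by (simp add: case_prod_beta)
  qed
  interpret pair_sigma_finite "lborel :: ((real^'n) \<times> (real^'n)) measure" unit_measure ..
  have "ennreal (cmod (F (cvec x y)) powr p) * emeasure lborel V
      = (\<integral>\<^sup>+z. ennreal (cmod (F (cvec x y)) powr p) * indicator V z \<partial>lborel)"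
    by (simp add: nn_integral_cmult_indicator)
  also have "\<dots> \<le> (\<integral>\<^sup>+z. (\<integral>\<^sup>+t. H (R (2 * pi * t) z) \<partial>unit_measure) \<partial>lborel)"
    by (intro nn_integral_mono pt)
  also have "\<dots> = (\<integral>\<^sup>+t. (\<integral>\<^sup>+z. H (R (2 * pi * t) z) \<partial>lborel) \<partial>unit_measure)"
    by (rule Fubini'[symmetric]) (rule Rm)
  also have "\<dots> = (\<integral>\<^sup>+t. (\<integral>\<^sup>+z. H z \<partial>lborel) \<partial>unit_measure)"
  proof (rule nn_integral_cong)
    fix t assume "t \<in> space unit_measure"
    then have "2 * pi * t \<in> {0..2*pi}" by (simp add: space_restrict_space)
    then show "(\<integral>\<^sup>+z. H (R (2 * pi * t) z) \<partial>lborel) = (\<integral>\<^sup>+z. H z \<partial>lborel)"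
      unfolding R_def by (rule nn_integral_rotate_pair[OF H])
  qed
  also have "\<dots> = (\<integral>\<^sup>+z. H z \<partial>lborel)"
    by (simp add: emeasure_restrict_space)
  finally show ?thesis by (simp add: H_def)
qed

subsection \<open>Dual cones and the kernel on the diagonal\<close>

lemma closed_dual_cone: "closed (dual_cone \<Gamma>)"
proof -
  have "dual_cone \<Gamma> = (\<Inter>x\<in>\<Gamma>. {t. x \<bullet> t \<ge> 0})" by (auto simp: dual_cone_def)
  then show ?thesis by (auto intro: closed_halfspace_ge)
qed

lemma dual_cone_add: "s \<in> dual_cone \<Gamma> \<Longrightarrow> t \<in> dual_cone \<Gamma> \<Longrightarrow> s + t \<in> dual_cone \<Gamma>"
  by (auto simp: dual_cone_def inner_add_right)

lemma dual_cone_scale: "t \<in> dual_cone \<Gamma> \<Longrightarrow> c \<ge> 0 \<Longrightarrow> c *\<^sub>R t \<in> dual_cone \<Gamma>"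
  by (auto simp: dual_cone_def)

lemma dual_cone_sum:
  assumes "\<And>i. i \<in> I \<Longrightarrow> c i \<ge> 0" "\<And>i. i \<in> I \<Longrightarrow> t i \<in> dual_cone \<Gamma>"
  shows "(\<Sum>i\<in>I. c i *\<^sub>R t i) \<in> dual_cone \<Gamma>"
  using assms by (auto simp: dual_cone_def inner_sum_right intro!: sum_nonneg)

lemma convex_dual_cone: "convex (dual_cone \<Gamma>)"
  by (auto simp: convex_def intro!: dual_cone_add dual_cone_scale)

lemma dual_cone_borel [measurable]: "dual_cone \<Gamma> \<in> sets borel"
  by (simp add: borel_closed closed_dual_cone)

lemma open_cone_scale: "open_cone \<Gamma> \<Longrightarrow> x \<in> \<Gamma> \<Longrightarrow> c > 0 \<Longrightarrow> c *\<^sub>R x \<in> \<Gamma>"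
  unfolding open_cone_def
  by (metis add_0 half_gt_zero_iff scaleR_half_double scaleR_left_distrib field_sum_of_halves)

lemma open_cone_add: "open_cone \<Gamma> \<Longrightarrow> x \<in> \<Gamma> \<Longrightarrow> y \<in> \<Gamma> \<Longrightarrow> x + y \<in> \<Gamma>"
  unfolding open_cone_def by (metis scaleR_one zero_less_one)

lemma convex_open_cone: "open_cone \<Gamma> \<Longrightarrow> convex \<Gamma>"
proof (rule convexI)
  fix x y u v assume *: "open_cone \<Gamma>" "x \<in> \<Gamma>" "y \<in> \<Gamma>" "0 \<le> (u::real)" "0 \<le> v" "u + v = 1"
  then show "u *\<^sub>R x + v *\<^sub>R y \<in> \<Gamma>"
    by (cases "u = 0"; cases "v = 0") (auto simp: open_cone_def)
qed

text \<open>If the ball of radius r about y lies in \<Gamma>, testing t against y - r t / |t| gives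
  the bound. It makes the part of the dual cone with \<open>y \<bullet> t \<le> 1\<close> bounded
  and the kernel integral finite.\<close>

lemma inner_dual_ge:
  fixes \<Gamma> :: "(real^'n) set"
  assumes "open \<Gamma>" "y \<in> \<Gamma>"
  shows "\<exists>r>0. \<forall>t\<in>dual_cone \<Gamma>. y \<bullet> t \<ge> r * norm t"
proof -
  obtain e where e: "e > 0" "cball y e \<subseteq> \<Gamma>" using assms by (meson open_contains_cball)
  show ?thesis
  proof (intro exI conjI ballI)
    fix t assume t: "t \<in> dual_cone \<Gamma>"
    show "e * norm t \<le> y \<bullet> t"
    proof (cases "t = 0")
      case False
      have "y - (e / norm t) *\<^sub>R t \<in> \<Gamma>" using e False by (intro subsetD[OF e(2)]) (simp add: dist_norm)
      then have "(y - (e / norm t) *\<^sub>R t) \<bullet> t \<ge> 0" using t by (auto simp: dual_cone_def)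
      then show ?thesis using False by (simp add: inner_diff_left dot_square_norm power2_eq_square)
    qed simp
  qed (rule e)
qed

text \<open>The same test with the cone and its dual exchanged; it makes the exponent in the kernel
  grow with |y|.\<close>

lemma interior_dual_inner_ge:
  fixes \<Gamma> :: "(real^'n) set"
  assumes "t \<in> interior (dual_cone \<Gamma>)"
  shows "\<exists>r>0. \<forall>y\<in>\<Gamma>. y \<bullet> t \<ge> r * norm y"
proof -
  obtain e where e: "e > 0" "cball t e \<subseteq> dual_cone \<Gamma>" using assms by (meson mem_interior_cball)
  show ?thesis
  proof (intro exI conjI ballI)
    fix y assume y: "y \<in> \<Gamma>"
    show "e * norm y \<le> y \<bullet> t"
    proof (cases "y = 0")
      case False
      have "t - (e / norm y) *\<^sub>R y \<in> dual_cone \<Gamma>" using e False by (intro subsetD[OF e(2)]) (simp add: dist_norm)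
      then have "y \<bullet> (t - (e / norm y) *\<^sub>R y) \<ge> 0" using y by (auto simp: dual_cone_def)
      then show ?thesis using False by (simp add: inner_diff_right dot_square_norm power2_eq_square)
    qed simp
  qed (rule e)
qed

text \<open>A separating hyperplane comes with an unknown level b. Dilating points of \<Gamma> by
  large factors shows that its normal is nonnegative on \<Gamma>, and by small factors that
  \<open>b \<le> 0\<close>.\<close>

lemma open_cone_separation:
  fixes \<Gamma> :: "(real^'n) set"
  assumes \<Gamma>: "open_cone \<Gamma>" and w: "w \<notin> \<Gamma>"
  obtains t where "t \<in> dual_cone \<Gamma>" "t \<noteq> 0" "w \<bullet> t \<le> 0"
proof -
  have "\<exists>a b. a \<noteq> 0 \<and> (\<forall>x\<in>{w}. a \<bullet> x \<le> b) \<and> (\<forall>x\<in>\<Gamma>. a \<bullet> x \<ge> b)"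
    by (rule separating_hyperplane_sets) (use \<Gamma> w convex_open_cone in \<open>auto simp: open_cone_def\<close>)
  then obtain a b where a: "a \<noteq> 0" "a \<bullet> w \<le> b" "\<And>x. x \<in> \<Gamma> \<Longrightarrow> a \<bullet> x \<ge> b" by auto
  have sc: "s * (a \<bullet> x) \<ge> b" if "x \<in> \<Gamma>" "s > 0" for x s
    using a(3)[OF open_cone_scale[OF \<Gamma> that]] by simp
  have "a \<bullet> x \<ge> 0" if x: "x \<in> \<Gamma>" for x
  proof (rule ccontr)
    assume "\<not> ?thesis"
    then have n: "a \<bullet> x < 0" by simp
    define s where "s = (\<bar>b\<bar> + 1) / - (a \<bullet> x)"
    have "s > 0" unfolding s_def using n by (intro divide_pos_pos) auto
    moreover have "s * (a \<bullet> x) = - (\<bar>b\<bar> + 1)" using n by (simp add: s_def)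
    ultimately show False using sc[OF x, of s] by linarith
  qed
  moreover have "b \<le> 0"
  proof -
    obtain x where x: "x \<in> \<Gamma>" using \<Gamma> by (auto simp: open_cone_def)
    have "((\<lambda>s. s * (a \<bullet> x)) \<longlongrightarrow> 0 * (a \<bullet> x)) (at_right 0)" by (intro tendsto_intros)
    moreover have "eventually (\<lambda>s. b \<le> s * (a \<bullet> x)) (at_right 0)"
      using sc[OF x] by (simp add: eventually_at_right_less eventually_at_filter)
    ultimately show ?thesis using tendsto_lowerbound by fastforce
  qed
  ultimately show ?thesis using that[of a] a by (force simp: dual_cone_def inner_commute)
qed

section \<open>The kernel on the diagonal: integrability, positivity, monotonicity\<close>

definition diag_kernel :: "(real^'n) set \<Rightarrow> real^'n \<Rightarrow> real" where
  "diag_kernel \<Gamma> y = (LINT t:dual_cone \<Gamma>|lborel. exp (- (4 * pi * (y \<bullet> t))))"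

lemma cauchy_szego_diag: "cauchy_szego \<Gamma> (cvec x y) (cvec x y) = of_real (diag_kernel \<Gamma> y)"
proof -
  have "exp (2 * of_real pi * \<i> * cdot (cvec x y) t) * cnj (exp (2 * of_real pi * \<i> * cdot (cvec x y) t))
     = of_real (exp (- (4 * pi * (y \<bullet> t))))" for t
  proof -
    have "Im (cdot (cvec x y) t) = y \<bullet> t"
      by (simp add: cdot_def cvec_def inner_vec_def)
    then have "cmod (exp (2 * of_real pi * \<i> * cdot (cvec x y) t)) = exp (- (2 * pi * (y \<bullet> t)))"
      by simp
    then have "(cmod (exp (2 * of_real pi * \<i> * cdot (cvec x y) t)))^2 = exp (- (4 * pi * (y \<bullet> t)))"
      by (simp add: power2_eq_square flip: exp_add)
    then show ?thesis by (simp only: complex_norm_square[symmetric])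
  qed
  then show ?thesis
    unfolding cauchy_szego_def diag_kernel_def by (simp only: set_integral_complex_of_real)
qed

lemma nn_integral_inverse_1_plus_square: "(\<integral>\<^sup>+x. ennreal (1 / (1 + x^2)) \<partial>lborel) < \<infinity>"
proof -
  let ?f = "\<lambda>x::real. 1 / (1 + x^2)"
  have [measurable]: "?f \<in> borel_measurable borel" by measurable
  have half: "(\<integral>\<^sup>+x. ennreal (?f x) * indicator {0..} x \<partial>lborel) = ennreal (pi/2 - arctan 0)"
  proof (rule nn_integral_FTC_atLeast)
    show "(arctan \<longlongrightarrow> pi/2) at_top" by (rule tendsto_arctan_at_top)
    show "(arctan has_real_derivative ?f x) (at x)" for x
      using DERIV_arctan[of x] by (simp add: inverse_eq_divide)
  qed auto
  have "(\<integral>\<^sup>+x. ennreal (?f x) * indicator {..0} x \<partial>lborel)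
      = (\<integral>\<^sup>+x. ennreal (?f (0 + (-1) * x)) * indicator {..0} (0 + (-1) * x) \<partial>lborel)"
    by (subst nn_integral_real_affine[where c="-1" and t=0]) auto
  also have "\<dots> = (\<integral>\<^sup>+x. ennreal (?f x) * indicator {0..} x \<partial>lborel)"
    by (intro nn_integral_cong) (auto split: split_indicator)
  finally have half': "(\<integral>\<^sup>+x. ennreal (?f x) * indicator {..0} x \<partial>lborel) = ennreal (pi/2 - arctan 0)"
    using half by simp
  have "(\<integral>\<^sup>+x. ennreal (?f x) \<partial>lborel) \<le>
     (\<integral>\<^sup>+x. (ennreal (?f x) * indicator {0..} x + ennreal (?f x) * indicator {..0} x) \<partial>lborel)"
    by (intro nn_integral_mono) (auto split: split_indicator)
  also have "\<dots> = ennreal (pi/2 - arctan 0) + ennreal (pi/2 - arctan 0)"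
    by (subst nn_integral_add) (auto simp: half half')
  also have "\<dots> < \<infinity>" by simp
  finally show ?thesis .
qed

text \<open>The integral splits into one-dimensional ones. These products serve twice, as majorants
  of exponentials and as majorants of the cutoff functions.\<close>

lemma nn_integral_prod_inverse_1_plus_square:
  fixes c :: real
  assumes "c > 0"
  shows "(\<integral>\<^sup>+x. ennreal (\<Prod>i\<in>UNIV. 1 / (1 + (c * (x::real^'n) $ i)^2)) \<partial>lborel) < \<infinity>"
proof -
  have 1: "(\<integral>\<^sup>+x. ennreal (1 / (1 + (c * x)^2)) \<partial>lborel) < \<infinity>"
  proof -
    have [measurable]: "(\<lambda>x::real. 1 / (1 + x^2)) \<in> borel_measurable borel" by measurable
    have "(\<integral>\<^sup>+x. ennreal (1 / (1 + x^2)) \<partial>lborel) = ennreal \<bar>c\<bar> * (\<integral>\<^sup>+x. ennreal (1 / (1 + (0 + c * x)^2)) \<partial>lborel)"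
      using assms by (intro nn_integral_real_affine) auto
    with nn_integral_inverse_1_plus_square have "ennreal c * (\<integral>\<^sup>+x. ennreal (1 / (1 + (c * x)^2)) \<partial>lborel) < \<infinity>"
      using assms by simp
    then show ?thesis using assms by (auto simp: ennreal_mult_less_top)
  qed
  have "(\<integral>\<^sup>+x. ennreal (\<Prod>i\<in>UNIV. 1 / (1 + (c * (x::real^'n) $ i)^2)) \<partial>lborel)
      = (\<integral>\<^sup>+x. (\<Prod>b\<in>Basis. ennreal (1 / (1 + (c * ((x::real^'n) \<bullet> b))^2))) \<partial>lborel)"
    by (subst prod_ennreal[symmetric]) (auto simp: prod_Basis_cart inner_axis)
  also have "\<dots> = (\<Prod>b\<in>(Basis::(real^'n) set). \<integral>\<^sup>+x. ennreal (1 / (1 + (c * x)^2)) \<partial>lborel)"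
    by (rule nn_integral_lborel_prod) auto
  also have "\<dots> < \<infinity>" using 1 by (simp add: power_less_top_ennreal)
  finally show ?thesis .
qed

text \<open>The exponential is compared with a product of factors 1 / (1 + t_i^2), whose reciprocal
  grows only polynomially.\<close>

lemma nn_integral_exp_norm:
  fixes c :: real
  assumes c: "c > 0"
  shows "(\<integral>\<^sup>+t. ennreal (exp (- (c * norm (t::real^'n)))) \<partial>lborel) < \<infinity>"
proof -
  define N where "N = 2 * CARD('n)"
  \<comment> \<open>With d \<le> 1 one has d (1 + s) \<le> 1 + d s \<le> exp (d s); with d N \<le> c
    the product of N such bounds stays below exp (c s), up to the constant d^(-N).\<close>
  define d where "d = min 1 (c / N)"
  have N: "N > 0" by (simp add: N_def)
  have d: "d > 0" "d \<le> 1" "d * N \<le> c" using c N by (auto simp: d_def min_def field_simps)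
  have le: "exp (- (c * norm t)) \<le> (1/d)^N * (\<Prod>i\<in>UNIV. 1 / (1 + (1 * t $ i)^2))" for t :: "real^'n"
  proof -
    define s where "s = norm t"
    have s: "s \<ge> 0" by (simp add: s_def)
    have "(\<Prod>i\<in>UNIV. (1 + (t $ i)^2)) \<le> (\<Prod>i\<in>(UNIV::'n set). (1 + s)^2)"
    proof (intro prod_mono conjI)
      fix i
      have "\<bar>t $ i\<bar> \<le> s" unfolding s_def by (rule component_le_norm_cart)
      then have "(t $ i)^2 \<le> s^2" by (simp add: abs_le_square_iff[symmetric])
      then show "1 + (t $ i)^2 \<le> (1 + s)^2" using s by (simp add: power2_eq_square algebra_simps)
    qed simp
    also have "\<dots> = (1 + s)^N" by (simp add: N_def power_mult)
    also have "\<dots> \<le> ((1/d) * exp (d * s))^N"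
    proof (intro power_mono)
      have "d * (1 + s) \<le> 1 + d * s" using d by (simp add: algebra_simps)
      also have "\<dots> \<le> exp (d * s)" by (rule exp_ge_add_one_self)
      finally show "1 + s \<le> 1 / d * exp (d * s)" using d by (simp add: field_simps)
    qed (use s in simp)
    also have "\<dots> = (1/d)^N * exp (d * N * s)" by (simp only: power_mult_distrib) (simp add: exp_of_nat_mult[symmetric] mult_ac)
    also have "\<dots> \<le> (1/d)^N * exp (c * s)" using d s by (intro mult_left_mono) (auto intro: mult_right_mono)
    finally have *: "(\<Prod>i\<in>UNIV. (1 + (t $ i)^2)) \<le> (1/d)^N * exp (c * s)" .
    have pos: "(\<Prod>i\<in>UNIV. (1 + (t $ i)^2)) > 0" by (intro prod_pos) (auto intro: add_pos_nonneg)
    have "exp (- (c * s)) * (\<Prod>i\<in>UNIV. (1 + (t $ i)^2)) \<le> exp (- (c * s)) * ((1/d)^N * exp (c * s))"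
      using * by (intro mult_left_mono) auto
    also have "\<dots> = (1/d)^N" by (simp add: exp_minus)
    finally have "exp (- (c * s)) \<le> (1/d)^N / (\<Prod>i\<in>UNIV. (1 + (t $ i)^2))" using pos by (simp add: pos_le_divide_eq)
    then show ?thesis by (simp add: s_def prod_dividef)
  qed
  have "(\<integral>\<^sup>+t. ennreal (exp (- (c * norm (t::real^'n)))) \<partial>lborel)
     \<le> (\<integral>\<^sup>+t. ennreal ((1/d)^N) * ennreal (\<Prod>i\<in>UNIV. 1 / (1 + (1 * (t::real^'n) $ i)^2)) \<partial>lborel)"
    by (intro nn_integral_mono) (use d le in \<open>auto simp flip: ennreal_mult' intro!: ennreal_leI\<close>)
  also have "\<dots> = ennreal ((1/d)^N) * (\<integral>\<^sup>+t. ennreal (\<Prod>i\<in>UNIV. 1 / (1 + (1 * (t::real^'n) $ i)^2)) \<partial>lborel)"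
    by (rule nn_integral_cmult) simp
  also have "\<dots> < \<infinity>"
    using nn_integral_prod_inverse_1_plus_square[of 1, where 'n='n] by (simp add: ennreal_mult_less_top)
  finally show ?thesis .
qed

lemma integrable_diag_kernel:
  fixes \<Gamma> :: "(real^'n) set"
  assumes "open \<Gamma>" "y \<in> \<Gamma>"
  shows "set_integrable lborel (dual_cone \<Gamma>) (\<lambda>t. exp (- (4 * pi * (y \<bullet> t))))"
proof -
  obtain r where r: "r > 0" "\<And>t. t \<in> dual_cone \<Gamma> \<Longrightarrow> y \<bullet> t \<ge> r * norm t"
    using inner_dual_ge[OF assms] by blast
  have "(\<integral>\<^sup>+t. ennreal (norm (indicator (dual_cone \<Gamma>) t *\<^sub>R exp (- (4 * pi * (y \<bullet> t))))) \<partial>lborel)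
     \<le> (\<integral>\<^sup>+t. ennreal (exp (- ((4 * pi * r) * norm (t::real^'n)))) \<partial>lborel)"
    by (intro nn_integral_mono) (use r in \<open>auto simp: mult.assoc split: split_indicator intro!: ennreal_leI\<close>)
  also have "\<dots> < \<infinity>" using r by (intro nn_integral_exp_norm) auto
  finally show ?thesis unfolding set_integrable_def by (intro integrableI_bounded) auto
qed

lemma nn_integral_diag_kernel:
  assumes "open \<Gamma>" "y \<in> \<Gamma>"
  shows "(\<integral>\<^sup>+t. ennreal (exp (- (4 * pi * (y \<bullet> t)))) * indicator (dual_cone \<Gamma>) t \<partial>lborel) = ennreal (diag_kernel \<Gamma> y)"
  unfolding diag_kernel_def set_lebesgue_integral_def
  by (subst nn_integral_eq_integral[symmetric])
    (use integrable_diag_kernel[OF assms] in \<open>auto simp: set_integrable_def ennreal_mult'' split: split_indicator intro!: nn_integral_cong\<close>)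

lemma diag_kernel_nonneg: "diag_kernel \<Gamma> y \<ge> 0"
  unfolding diag_kernel_def set_lebesgue_integral_def by (intro integral_nonneg_AE) auto

text \<open>The integrand is positive on the interior of the dual cone, and a nonempty open set is
  not a null set.\<close>

lemma diag_kernel_pos:
  assumes "regular_cone \<Gamma>" "y \<in> \<Gamma>"
  shows "diag_kernel \<Gamma> y > 0"
proof -
  have op: "open \<Gamma>" and "interior (dual_cone \<Gamma>) \<noteq> {}" using assms by (auto simp: regular_cone_def open_cone_def)
  have "diag_kernel \<Gamma> y \<noteq> 0"
  proof
    assume "diag_kernel \<Gamma> y = 0"
    then have "(\<integral>\<^sup>+t. ennreal (exp (- (4 * pi * (y \<bullet> t)))) * indicator (dual_cone \<Gamma>) t \<partial>lborel) = 0"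
      using nn_integral_diag_kernel[OF op assms(2)] by simp
    then have "AE t in lborel. ennreal (exp (- (4 * pi * (y \<bullet> t)))) * indicator (dual_cone \<Gamma>) t = 0"
      by (subst (asm) nn_integral_0_iff_AE) auto
    then have "AE t in lborel. t \<notin> interior (dual_cone \<Gamma>)"
      by eventually_elim (use interior_subset in \<open>auto split: split_indicator_asm\<close>)
    then have "interior (dual_cone \<Gamma>) \<in> null_sets lborel"
      by (subst AE_iff_null_sets) auto
    then have "negligible (interior (dual_cone \<Gamma>))"
      by (simp add: negligible_iff_null_sets null_sets_completionI)
    then show False using \<open>interior (dual_cone \<Gamma>) \<noteq> {}\<close> open_not_negligible by blast
  qed
  then show ?thesis using diag_kernel_nonneg[of \<Gamma> y] by simp
qed

lemma diag_kernel_antimono: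
  assumes "open_cone \<Gamma>" "y \<in> \<Gamma>" "v \<in> \<Gamma>"
  shows "diag_kernel \<Gamma> (y + v) \<le> diag_kernel \<Gamma> y"
proof -
  have op: "open \<Gamma>" using assms by (simp add: open_cone_def)
  have "y + v \<in> \<Gamma>" by (rule open_cone_add[OF assms])
  then show ?thesis unfolding diag_kernel_def
    by (intro set_integral_mono integrable_diag_kernel op assms) (use assms(3) in \<open>auto simp: inner_add_left dual_cone_def\<close>)
qed

subsection \<open>The pointwise bound\<close>

text \<open>A set with interior points lies in no hyperplane, so it contains a basis. This makes the
  maximal determinant nonzero.\<close>

lemma exists_invertible_rows_in:
  fixes D :: "(real^'n) set"
  assumes "interior D \<noteq> {}"
  shows "\<exists>X::real^'n^'n. (\<forall>i. X $ i \<in> D) \<and> det X \<noteq> 0"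
proof -
  obtain B where B: "B \<subseteq> D" "independent B" "D \<subseteq> span B" "card B = dim D"
    using basis_exists by blast
  have "dim D = DIM(real^'n)"
    using assms empty_interior_lowdim[of D] dim_subset_UNIV[of D] by fastforce
  then have card: "card B = CARD('n)" using B by simp
  have "finite B" using B independent_imp_finite by blast
  then obtain f where f: "bij_betw f (UNIV::'n set) B"
    using card by (metis finite_class.finite_UNIV finite_same_card_bij)
  define X :: "real^'n^'n" where "X = (\<chi> i. f i)"
  have rows: "rows X = B"
    using f by (auto simp: rows_def row_def X_def vec_lambda_eta bij_betw_def)
  have "span B = UNIV"
    using B card by (metis \<open>dim D = DIM(real^'n)\<close> dim_eq_full dim_span_eq_card_independent dim_span)
  then have "\<exists>Y. Y ** X = mat 1"
    unfolding rows[symmetric] by (simp add: matrix_left_invertible_span_rows)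
  then have "invertible X" using invertible_left_inverse by blast
  then show ?thesis using f B(1)
    by (intro exI[of _ X]) (auto simp: invertible_det_nz X_def bij_betw_def)
qed

text \<open>A basis of maximal volume: by Cramer's rule, all coordinates with respect to it of points of
  \<open>D\<close> lie in \<open>[-1, 1]\<close>.\<close>

lemma maximal_volume_basis:
  fixes D :: "(real^'n) set"
  assumes "compact D" "interior D \<noteq> {}"
  obtains X :: "real^'n^'n" where "\<And>i. X $ i \<in> D" "invertible X"
    "\<And>t. t \<in> D \<Longrightarrow> \<exists>c. t = (\<Sum>i\<in>UNIV. c $ i *\<^sub>R X $ i) \<and> (\<forall>i. \<bar>c $ i\<bar> \<le> 1)"
proof -
  define K where "K = {X::real^'n^'n. \<forall>i. X $ i \<in> D}"
  have "compact K"
  proof -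
    obtain b where b: "\<And>t. t \<in> D \<Longrightarrow> norm t \<le> b" using assms(1) by (meson bounded_iff compact_imp_bounded)
    have "norm X \<le> (\<Sum>i\<in>(UNIV::'n set). b)" if "X \<in> K" for X
    proof -
      have "norm X \<le> (\<Sum>i\<in>UNIV. norm (X $ i))" by (simp add: norm_vec_def L2_set_le_sum)
      also have "\<dots> \<le> (\<Sum>i\<in>(UNIV::'n set). b)" using that b by (intro sum_mono) (auto simp: K_def)
      finally show ?thesis .
    qed
    then have "bounded K" by (meson bounded_iff)
    moreover have "closed K"
    proof -
      have "K = (\<Inter>i. (\<lambda>X. X $ i) -` D)" by (auto simp: K_def)
      moreover have "closed ((\<lambda>X::real^'n^'n. X $ i) -` D)" for i
        by (intro closed_vimage compact_imp_closed assms continuous_intros)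
      ultimately show ?thesis by auto
    qed
    ultimately show ?thesis by (simp add: compact_eq_bounded_closed)
  qed
  moreover obtain X0 where X0: "X0 \<in> K" "det X0 \<noteq> 0"
    using exists_invertible_rows_in[OF assms(2)] by (auto simp: K_def)
  moreover have "continuous_on K (\<lambda>X. \<bar>det X\<bar>)"
    unfolding det_def by (intro continuous_intros)
  ultimately obtain X where X: "X \<in> K" "\<And>Y. Y \<in> K \<Longrightarrow> \<bar>det Y\<bar> \<le> \<bar>det X\<bar>"
    by (metis continuous_attains_sup empty_iff)
  have dX: "det X \<noteq> 0" using X(2)[OF X0(1)] X0(2) by auto
  then have inv: "invertible X" by (simp add: invertible_det_nz)
  show ?thesis
  proof (rule that[OF _ inv])
    show "X $ i \<in> D" for i using X by (simp add: K_def)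
    fix t assume t: "t \<in> D"
    have "invertible (transpose X)" using dX by (simp add: invertible_det_nz)
    then obtain Y where Y: "transpose X ** Y = mat 1" unfolding invertible_def by blast
    define c where "c = Y *v t"
    have "transpose X *v c = t" unfolding c_def by (simp only: matrix_vector_mul_assoc Y matrix_vector_mul_lid)
    moreover have "transpose X *v c = (\<Sum>i\<in>UNIV. c $ i *\<^sub>R X $ i)"
      by (simp add: vec_eq_iff matrix_vector_mult_def transpose_def mult.commute del: transpose_matrix_vector)
    ultimately have tc: "t = (\<Sum>i\<in>UNIV. c $ i *\<^sub>R X $ i)" by simp
    have "\<bar>c $ k\<bar> \<le> 1" for k
    proof -
      \<comment> \<open>Replacing row k by t keeps all rows in D and multiplies the determinant by
        \<open>c $ k\<close>, so maximality bounds this coordinate.\<close>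
      define Z :: "real^'n^'n" where "Z = (\<chi> i. if i = k then t else X $ i)"
      have "Z \<in> K" using X t by (simp add: K_def Z_def)
      then have "\<bar>det Z\<bar> \<le> \<bar>det X\<bar>" by (rule X)
      moreover have "det Z = c $ k * det X"
      proof -
        have "Z = (\<chi> i. if i = k then \<Sum>i\<in>UNIV. c $ i *s row i X else row i X)"
          by (simp add: Z_def vec_eq_iff row_def tc)
        then show ?thesis using cramer_lemma_transpose[of k c X] by simp
      qed
      ultimately show ?thesis using dX by (simp add: abs_mult)
    qed
    with tc show "\<exists>c. t = (\<Sum>i\<in>UNIV. c $ i *\<^sub>R X $ i) \<and> (\<forall>i. \<bar>c $ i\<bar> \<le> 1)" by blast
  qed
qed

text \<open>If y + v were outside \<Gamma>, a separating functional could be normalized to u in the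
  slice with \<open>y \<bullet> u = 1\<close> and \<open>v \<bullet> u \<le> -1\<close>. But u has
  coordinates of modulus at most 1 in the maximal basis, so n pairings smaller than 1/n force
  \<open>\<bar>v \<bullet> u\<bar> < 1\<close>.\<close>

lemma dual_slice_basis:
  fixes \<Gamma> :: "(real^'n) set"
  assumes \<Gamma>: "regular_cone \<Gamma>" and y: "y \<in> \<Gamma>"
  obtains X :: "real^'n^'n" where "\<And>i. X $ i \<in> dual_cone \<Gamma>" "\<And>i. y \<bullet> X $ i \<le> 1" "invertible X"
    "\<And>v. \<forall>i. \<bar>v \<bullet> X $ i\<bar> < 1 / CARD('n) \<Longrightarrow> y + v \<in> \<Gamma>"
proof -
  have oc: "open_cone \<Gamma>" and op: "open \<Gamma>" and ne: "interior (dual_cone \<Gamma>) \<noteq> {}"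
    using \<Gamma> by (auto simp: regular_cone_def open_cone_def)
  define D where "D = dual_cone \<Gamma> \<inter> {t. y \<bullet> t \<le> 1}"
  obtain r where r: "r > 0" "\<And>t. t \<in> dual_cone \<Gamma> \<Longrightarrow> y \<bullet> t \<ge> r * norm t"
    using inner_dual_ge[OF op y] by blast
  have cD: "compact D"
  proof -
    have "norm t \<le> 1 / r" if "t \<in> D" for t
      using r(2)[of t] that r(1) by (auto simp: D_def field_simps)
    then have "bounded D" by (meson bounded_iff)
    moreover have "closed D" unfolding D_def by (intro closed_Int closed_dual_cone closed_halfspace_le)
    ultimately show ?thesis by (simp add: compact_eq_bounded_closed)
  qed
  have iD: "interior D \<noteq> {}"
  proof -
    obtain t where t: "t \<in> interior (dual_cone \<Gamma>)" using ne by auto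
    obtain e where e: "e > 0" "ball t e \<subseteq> dual_cone \<Gamma>" using t by (meson mem_interior)
    \<comment> \<open>Scaling by s keeps t interior to the dual cone and brings it below the level
      1.\<close>
    define s where "s = 1 / (\<bar>y \<bullet> t\<bar> + 1)"
    have s: "s > 0" by (simp add: s_def add_nonneg_pos)
    have "ball (s *\<^sub>R t) (s * e) \<subseteq> dual_cone \<Gamma>"
    proof
      fix u assume "u \<in> ball (s *\<^sub>R t) (s * e)"
      then have "norm (s *\<^sub>R t - u) < s * e" by (simp add: dist_norm)
      moreover have "s *\<^sub>R t - u = s *\<^sub>R (t - (1/s) *\<^sub>R u)" using s by (simp add: scaleR_diff_right)
      ultimately have "(1/s) *\<^sub>R u \<in> ball t e" using s by (simp add: dist_norm)
      then have "(1/s) *\<^sub>R u \<in> dual_cone \<Gamma>" using e by blast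
      then have "s *\<^sub>R ((1/s) *\<^sub>R u) \<in> dual_cone \<Gamma>" by (rule dual_cone_scale) (use s in simp)
      then show "u \<in> dual_cone \<Gamma>" using s by simp
    qed
    moreover have "s *\<^sub>R t \<in> ball (s *\<^sub>R t) (s * e)" using s e by simp
    ultimately have "s *\<^sub>R t \<in> interior (dual_cone \<Gamma>)" using s e by (meson mem_interior mult_pos_pos)
    moreover have "s *\<^sub>R t \<in> {t. y \<bullet> t < 1}"
    proof -
      have "y \<bullet> t < \<bar>y \<bullet> t\<bar> + 1" by linarith
      then show ?thesis by (simp add: s_def pos_divide_less_eq add_nonneg_pos)
    qed
    moreover have "interior (dual_cone \<Gamma>) \<inter> {t. y \<bullet> t < 1} \<subseteq> interior D"
      using interior_subset by (intro interior_maximal) (fastforce simp: D_def intro!: open_halfspace_lt)+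
    ultimately show ?thesis by blast
  qed
  obtain X :: "real^'n^'n" where X: "\<And>i. X $ i \<in> D" "invertible X"
    "\<And>t. t \<in> D \<Longrightarrow> \<exists>c. t = (\<Sum>i\<in>UNIV. c $ i *\<^sub>R X $ i) \<and> (\<forall>i. \<bar>c $ i\<bar> \<le> 1)"
    by (rule maximal_volume_basis[OF cD iD], rule that)
  show ?thesis
  proof (rule that[of X])
    fix v assume v: "\<forall>i. \<bar>v \<bullet> X $ i\<bar> < 1 / CARD('n)"
    show "y + v \<in> \<Gamma>"
    proof (rule ccontr)
      assume "y + v \<notin> \<Gamma>"
      then obtain t where t: "t \<in> dual_cone \<Gamma>" "t \<noteq> 0" "(y + v) \<bullet> t \<le> 0"
        using open_cone_separation[OF oc] by blast
      have "r * norm t > 0" using r t by simp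
      then have pos: "y \<bullet> t > 0" using r(2)[OF t(1)] by linarith
      define u where "u = (1 / (y \<bullet> t)) *\<^sub>R t"
      have u: "u \<in> D" "y \<bullet> u = 1" using t pos by (auto simp: u_def D_def intro: dual_cone_scale)
      have "(y + v) \<bullet> u \<le> 0" unfolding u_def using t(3) pos by (simp add: divide_nonpos_pos)
      then have vu: "v \<bullet> u \<le> -1" using u by (simp add: inner_add_left)
      obtain c where c: "u = (\<Sum>i\<in>UNIV. c $ i *\<^sub>R X $ i)" "\<And>i. \<bar>c $ i\<bar> \<le> 1" using X(3)[OF u(1)] by blast
      have "\<bar>v \<bullet> u\<bar> \<le> (\<Sum>i\<in>UNIV. \<bar>c $ i * (v \<bullet> X $ i)\<bar>)"
        unfolding c(1) by (simp add: inner_sum_right)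
      also have "\<dots> \<le> (\<Sum>i\<in>UNIV. \<bar>v \<bullet> X $ i\<bar>)"
      proof (intro sum_mono)
        fix i show "\<bar>c $ i * (v \<bullet> X $ i)\<bar> \<le> \<bar>v \<bullet> X $ i\<bar>"
          unfolding abs_mult using mult_right_mono[OF c(2)[of i], of "\<bar>v \<bullet> X $ i\<bar>"] by simp
      qed
      also have "\<dots> < (\<Sum>i\<in>(UNIV::'n set). 1 / CARD('n))" using v by (intro sum_strict_mono) auto
      also have "\<dots> = 1" by simp
      finally show False using vu by linarith
    qed
  qed (use X in \<open>auto simp: D_def\<close>)
qed

lemma matrix_vector_mult_inner: "(X *v v) $ i = v \<bullet> (X $ i)"
  for X :: "real^'n^'n"
  by (simp add: matrix_vector_mult_def inner_vec_def mult.commute)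

lemma emeasure_lborel_box_cart:
  fixes a b :: "real^'n"
  assumes "\<And>i. a $ i \<le> b $ i"
  shows "emeasure lborel (box a b) = ennreal (\<Prod>i\<in>UNIV. b $ i - a $ i)"
    "emeasure lborel (cbox a b) = ennreal (\<Prod>i\<in>UNIV. b $ i - a $ i)"
proof -
  have ab: "a \<bullet> b' \<le> b \<bullet> b'" if "b' \<in> Basis" for b'
    using that assms by (auto simp: Basis_vec_def inner_axis)
  show "emeasure lborel (box a b) = ennreal (\<Prod>i\<in>UNIV. b $ i - a $ i)"
    "emeasure lborel (cbox a b) = ennreal (\<Prod>i\<in>UNIV. b $ i - a $ i)"
    using emeasure_lborel_box[OF ab] emeasure_lborel_cbox[OF ab] by (simp_all add: prod_Basis_cart inner_axis)
qed

text \<open>Here c equals 1 / |det X|. The polydisc V contains a product of two parallelepipeds of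
  volume c \<rho>^n each, and its imaginary parts lie in one of volume c (2 \<rho>)^n, so the mean
  inequality gives |F|^p c \<rho>^n \<le> 2^n M. The set S, of volume \<rho>^n / c, shows \<rho>^n
  \<le> c exp (4 pi) k(y). Combining the two eliminates c, and \<rho> = 1/n explains the factor
  n^(2n).\<close>

lemma pointwise_bound:
  fixes F :: "complex^'n \<Rightarrow> complex"
  assumes \<Gamma>: "regular_cone \<Gamma>" and hol: "holomorphic_vec_on F (tube \<Gamma>)" and p: "p \<ge> 1"
    and M: "M \<ge> 0" "\<And>y. y \<in> \<Gamma> \<Longrightarrow> (\<integral>\<^sup>+x. ennreal (cmod (F (cvec x y)) powr p) \<partial>lborel) \<le> ennreal M"
    and y: "y \<in> \<Gamma>"
  shows "cmod (F (cvec x y)) powr p \<le> (exp (4 * pi) * 2 ^ CARD('n) * real CARD('n) ^ (2 * CARD('n))) * M * diag_kernel \<Gamma> y"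
proof -
  have op: "open \<Gamma>" using \<Gamma> by (auto simp: regular_cone_def open_cone_def)
  obtain X :: "real^'n^'n" where X: "\<And>i. X $ i \<in> dual_cone \<Gamma>" "\<And>i. y \<bullet> X $ i \<le> 1" "invertible X"
    "\<And>v. \<forall>i. \<bar>v \<bullet> X $ i\<bar> < 1 / CARD('n) \<Longrightarrow> y + v \<in> \<Gamma>"
    by (rule dual_slice_basis[OF \<Gamma> y], rule that)
  obtain c where c: "c > 0" and
    cX: "\<And>f. f \<in> borel_measurable borel \<Longrightarrow> (\<integral>\<^sup>+x. f (X *v x) \<partial>lborel) = ennreal c * (\<integral>\<^sup>+x. f x \<partial>lborel)" and
    cT: "\<And>f. f \<in> borel_measurable borel \<Longrightarrow> (\<integral>\<^sup>+x. f (transpose X *v x) \<partial>lborel) = ennreal c * (\<integral>\<^sup>+x. f x \<partial>lborel)"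
    using nn_integral_linear_transpose[OF X(3)] by blast
  define n where "n = CARD('n)"
  define \<rho> where "\<rho> = 1 / real n"
  have n: "n > 0" by (simp add: n_def)
  have \<rho>: "\<rho> > 0" using n by (simp add: \<rho>_def)
  define E where "E s = {v. \<forall>i. \<bar>v \<bullet> X $ i\<bar> < s}" for s
  have Eopen: "open (E s)" for s
  proof -
    have "E s = (\<Inter>i\<in>UNIV. {v. \<bar>v \<bullet> X $ i\<bar> < s})" by (auto simp: E_def)
    also have "open \<dots>" by (intro open_INT ballI open_Collect_less continuous_intros) auto
    finally show ?thesis .
  qed
  have Emeas[measurable]: "E s \<in> sets borel" for s by (simp add: Eopen)
  have E: "emeasure lborel (E s) = ennreal (c * (2 * s)^n)" if "s > 0" for s
  proof -
    have mem: "v \<in> E s \<longleftrightarrow> X *v v \<in> box (\<chi> i. - s) (\<chi> i. s)" for v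
      by (auto simp: E_def mem_box_cart matrix_vector_mult_inner abs_less_iff) (metis minus_less_iff)+
    have "emeasure lborel (E s) = (\<integral>\<^sup>+v. indicator (E s) v \<partial>lborel)" by simp
    also have "\<dots> = (\<integral>\<^sup>+v. indicator (box (\<chi> i. - s) (\<chi> i. s)) (X *v v) \<partial>lborel)"
      by (intro nn_integral_cong) (auto simp: mem split: split_indicator)
    also have "\<dots> = ennreal c * emeasure lborel (box (\<chi> i. - s) (\<chi> i::'n. s))"
      by (subst cX) auto
    also have "\<dots> = ennreal c * ennreal ((2 * s)^n)"
      using that by (subst emeasure_lborel_box_cart) (auto simp: n_def)
    finally show ?thesis using c that by (simp add: ennreal_mult)
  qed
  \<comment> \<open>The parallelepiped of all sums of u_i X_i with 0 \<le> u_i \<le> \<rho>. As n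
    \<rho> = 1, it stays in the slice \<open>y \<bullet> t \<le> 1\<close> of the dual cone.\<close>
  define S where "S = (\<lambda>x. transpose X *v x) ` cbox 0 (\<chi> i. \<rho>)"
  have "compact S" unfolding S_def
    by (intro compact_continuous_image linear_continuous_on) (auto simp: linear_linear)
  then have Smeas[measurable]: "S \<in> sets borel" by (simp add: borel_compact)
  have injX: "inj ((*v) (transpose X))"
    using X(3) by (simp add: inj_matrix_vector_mult invertible_det_nz)
  have S: "ennreal (\<rho>^n) = ennreal c * emeasure lborel S"
  proof -
    have "ennreal (\<rho>^n) = emeasure lborel (cbox 0 (\<chi> i::'n. \<rho>))"
      using \<rho> by (subst emeasure_lborel_box_cart) (auto simp: n_def)
    also have "\<dots> = (\<integral>\<^sup>+x. indicator (cbox 0 (\<chi> i::'n. \<rho>)) x \<partial>lborel)" by simp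
    also have "\<dots> = (\<integral>\<^sup>+x. indicator S (transpose X *v x) \<partial>lborel)"
    proof (rule nn_integral_cong)
      fix x
      have "transpose X *v x \<in> S \<longleftrightarrow> x \<in> cbox 0 (\<chi> i. \<rho>)"
        unfolding S_def by (rule inj_image_mem_iff[OF injX])
      then show "indicator (cbox 0 (\<chi> i. \<rho>)) x = (indicator S (transpose X *v x) :: ennreal)"
        by (auto split: split_indicator)
    qed
    also have "\<dots> = ennreal c * emeasure lborel S" by (subst cT) auto
    finally show ?thesis .
  qed
  have Skernel: "emeasure lborel S \<le> ennreal (exp (4 * pi) * diag_kernel \<Gamma> y)"
  proof -
    have in_dual: "t \<in> dual_cone \<Gamma> \<and> y \<bullet> t \<le> 1" if tS: "t \<in> S" for t
    proof -
      obtain u where uc: "u \<in> cbox 0 (\<chi> i. \<rho>)" and u1: "t = transpose X *v u"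
        using tS unfolding S_def by blast
      have u2: "0 \<le> u $ i \<and> u $ i \<le> \<rho>" for i using uc by (auto simp: mem_box_cart)
      note u = u1 u2
      have t: "t = (\<Sum>i\<in>UNIV. u $ i *\<^sub>R X $ i)"
        unfolding u(1) by (simp add: vec_eq_iff matrix_vector_mult_def transpose_def mult.commute del: transpose_matrix_vector)
      have "y \<bullet> t = (\<Sum>i\<in>UNIV. u $ i * (y \<bullet> X $ i))" by (simp add: t inner_sum_right)
      also have "\<dots> \<le> (\<Sum>i\<in>(UNIV::'n set). \<rho>)"
      proof (intro sum_mono)
        fix i
        have "u $ i * (y \<bullet> X $ i) \<le> u $ i * 1" using X(2) u(2) by (intro mult_left_mono) auto
        then show "u $ i * (y \<bullet> X $ i) \<le> \<rho>" using u(2)[of i] by linarith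
      qed
      also have "\<dots> = 1" using n by (simp add: \<rho>_def n_def)
      finally show ?thesis using X(1) u(2) by (auto simp: t intro!: dual_cone_sum)
    qed
    have "emeasure lborel S = (\<integral>\<^sup>+t. indicator S t \<partial>lborel)" by simp
    \<comment> \<open>On S the exponential in the kernel is at least exp (-4 pi).\<close>
    also have "\<dots> \<le> (\<integral>\<^sup>+t. ennreal (exp (4 * pi)) * (ennreal (exp (- (4 * pi * (y \<bullet> t)))) * indicator (dual_cone \<Gamma>) t) \<partial>lborel)"
    proof (rule nn_integral_mono)
      fix t
      have "1 \<le> exp (4 * pi) * exp (- (4 * pi * (y \<bullet> t)))" if "t \<in> S"
      proof -
        have "4 * pi * (y \<bullet> t) \<le> 4 * pi * 1" using in_dual[OF that] by (intro mult_left_mono) auto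
        then show ?thesis by (simp flip: exp_add)
      qed
      then show "indicator S t \<le> ennreal (exp (4 * pi)) * (ennreal (exp (- (4 * pi * (y \<bullet> t)))) * indicator (dual_cone \<Gamma>) t)"
        using in_dual by (auto split: split_indicator simp flip: ennreal_mult')
    qed
    also have "\<dots> = ennreal (exp (4 * pi)) * ennreal (diag_kernel \<Gamma> y)"
      by (subst nn_integral_cmult) (auto simp: nn_integral_diag_kernel[OF op y])
    finally show ?thesis by (simp add: ennreal_mult')
  qed
  have ck: "\<rho>^n \<le> c * (exp (4 * pi) * diag_kernel \<Gamma> y)"
  proof -
    have "ennreal (\<rho>^n) \<le> ennreal c * ennreal (exp (4 * pi) * diag_kernel \<Gamma> y)"
      unfolding S by (intro mult_left_mono Skernel) auto
    then have "ennreal (\<rho>^n) \<le> ennreal (c * (exp (4 * pi) * diag_kernel \<Gamma> y))"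
      using c by (simp add: ennreal_mult' diag_kernel_nonneg)
    then show ?thesis
      by (subst (asm) ennreal_le_iff) (use c in \<open>auto simp: diag_kernel_nonneg\<close>)
  qed
  \<comment> \<open>In complex notation |(a + ib) \<bullet> X_i| < \<rho> for all i: a polydisc in
    skew coordinates, hence balanced.\<close>
  define V where "V = {z::(real^'n)\<times>(real^'n). \<forall>i. (fst z \<bullet> X $ i)^2 + (snd z \<bullet> X $ i)^2 < \<rho>^2}"
  have "V = (\<Inter>i\<in>UNIV. {z. (fst z \<bullet> X $ i)^2 + (snd z \<bullet> X $ i)^2 < \<rho>^2})" by (auto simp: V_def)
  also have "open \<dots>" by (intro open_INT ballI open_Collect_less continuous_intros) auto
  finally have Vmeas[measurable]: "V \<in> sets borel" by simp
  have V1: "E (\<rho>/2) \<times> E (\<rho>/2) \<subseteq> V"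
  proof (clarsimp simp: V_def)
    fix a b i assume "a \<in> E (\<rho>/2)" "b \<in> E (\<rho>/2)"
    then have "\<bar>a \<bullet> X $ i\<bar> < \<rho>/2" "\<bar>b \<bullet> X $ i\<bar> < \<rho>/2" by (auto simp: E_def)
    then have "\<bar>a \<bullet> X $ i\<bar>^2 \<le> (\<rho>/2)^2" "\<bar>b \<bullet> X $ i\<bar>^2 \<le> (\<rho>/2)^2" by (intro power_mono; simp)+
    moreover have "(\<rho>/2)^2 + (\<rho>/2)^2 < \<rho>^2" using \<rho> by (simp add: power2_eq_square)
    ultimately show "(a \<bullet> X $ i)^2 + (b \<bullet> X $ i)^2 < \<rho>^2" by simp
  qed
  have V2: "b \<in> E \<rho>" if "(a, b) \<in> V" for a b
  proof -
    have "\<bar>b \<bullet> X $ i\<bar> < \<rho>" for i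
    proof -
      have "(a \<bullet> X $ i)^2 + (b \<bullet> X $ i)^2 < \<rho>^2" using that by (simp add: V_def)
      then have "(b \<bullet> X $ i)^2 < \<rho>^2" using zero_le_power2[of "a \<bullet> X $ i"] by linarith
      then show ?thesis using \<rho> by (metis abs_of_pos abs_le_square_iff not_le)
    qed
    then show ?thesis by (simp add: E_def)
  qed
  have Vy: "y + b \<in> \<Gamma>" if "(a, b) \<in> V" for a b
    using V2[OF that] by (intro X(4)) (simp add: E_def \<rho>_def n_def)
  have bal: "(s *\<^sub>R a - t *\<^sub>R b, s *\<^sub>R b + t *\<^sub>R a) \<in> V" if "(a, b) \<in> V" "s^2 + t^2 \<le> 1" for a b s t
  proof -
    have "((s *\<^sub>R a - t *\<^sub>R b) \<bullet> X $ i)^2 + ((s *\<^sub>R b + t *\<^sub>R a) \<bullet> X $ i)^2 < \<rho>^2" for i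
    proof -
      have "((s *\<^sub>R a - t *\<^sub>R b) \<bullet> X $ i)^2 + ((s *\<^sub>R b + t *\<^sub>R a) \<bullet> X $ i)^2
          = (s^2 + t^2) * ((a \<bullet> X $ i)^2 + (b \<bullet> X $ i)^2)"
        by (simp add: inner_simps power2_eq_square algebra_simps)
      also have "\<dots> \<le> 1 * ((a \<bullet> X $ i)^2 + (b \<bullet> X $ i)^2)" using that by (intro mult_right_mono) auto
      also have "\<dots> < \<rho>^2" using that by (simp add: V_def)
      finally show ?thesis .
    qed
    then show ?thesis by (simp add: V_def)
  qed
  let ?f = "\<lambda>z. ennreal (cmod (F (cvec (x + fst z) (y + snd z))) powr p)"
  define H where "H z = indicator {z. y + snd z \<in> \<Gamma>} z *\<^sub>R F (cvec (x + fst z) (y + snd z))" for z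
  have [measurable]: "H \<in> borel_measurable borel"
  proof -
    have "open {z::(real^'n)\<times>(real^'n). y + snd z \<in> \<Gamma>}"
      by (intro open_Collect_mem op continuous_intros)
    moreover have "continuous_on {z. y + snd z \<in> \<Gamma>} (\<lambda>z. F (cvec (x + fst z) (y + snd z)))"
      by (rule continuous_on_compose2[OF holomorphic_vec_on_imp_continuous_on[OF hol]])
        (auto intro!: continuous_intros)
    ultimately show ?thesis unfolding H_def by (intro borel_measurable_continuous_on_indicator) auto
  qed
  have Hm: "(\<lambda>z. ennreal (cmod (H z) powr p) * indicator (E \<rho>) (snd z)) \<in> borel_measurable (lborel \<Otimes>\<^sub>M lborel)"
  proof -
    have [measurable]: "snd \<in> measurable (borel :: ((real^'n)\<times>(real^'n)) measure) (borel :: (real^'n) measure)"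
      by (intro borel_measurable_continuous_onI continuous_intros)
    show ?thesis unfolding lborel_prod by measurable
  qed
  have EV: "ennreal ((c * \<rho>^n)^2) \<le> emeasure lborel V"
  proof -
    have "ennreal ((c * \<rho>^n)^2) = emeasure lborel (E (\<rho>/2)) * emeasure lborel (E (\<rho>/2))"
      using c \<rho> by (simp add: E power2_eq_square flip: ennreal_mult)
    also have "\<dots> = emeasure (lborel \<Otimes>\<^sub>M lborel) (E (\<rho>/2) \<times> E (\<rho>/2))"
      by (rule lborel.emeasure_pair_measure_Times[symmetric]) auto
    also have "\<dots> \<le> emeasure lborel V"
      unfolding lborel_prod by (intro emeasure_mono V1) auto
    finally show ?thesis .
  qed
  have "ennreal (cmod (F (cvec x y)) powr p) * ennreal ((c * \<rho>^n)^2)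
      \<le> ennreal (cmod (F (cvec x y)) powr p) * emeasure lborel V"
    by (intro mult_left_mono EV) auto
  also have "\<dots> \<le> (\<integral>\<^sup>+z. ?f z * indicator V z \<partial>lborel)"
    by (rule powr_norm_le_balanced_mean[OF hol op Vmeas bal Vy p])
  also have "\<dots> \<le> (\<integral>\<^sup>+z. ennreal (cmod (H z) powr p) * indicator (E \<rho>) (snd z) \<partial>lborel)"
    using V2 Vy by (intro nn_integral_mono) (force simp: H_def split: split_indicator)
  also have "\<dots> = (\<integral>\<^sup>+b. (\<integral>\<^sup>+a. ennreal (cmod (H (a, b)) powr p) * indicator (E \<rho>) b \<partial>lborel) \<partial>lborel)"
    using Hm by (subst lborel_prod[symmetric], subst lborel_pair.nn_integral_snd[symmetric]) auto
  \<comment> \<open>For each imaginary part the whole horizontal slice is integrated, which costs at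
    most M and is the same for all x.\<close>
  also have "\<dots> \<le> (\<integral>\<^sup>+b. ennreal M * indicator (E \<rho>) b \<partial>lborel)"
  proof (rule nn_integral_mono)
    fix b
    show "(\<integral>\<^sup>+a. ennreal (cmod (H (a, b)) powr p) * indicator (E \<rho>) b \<partial>lborel) \<le> ennreal M * indicator (E \<rho>) b"
    proof (cases "b \<in> E \<rho>")
      case True
      then have yb: "y + b \<in> \<Gamma>" by (intro X(4)) (simp add: E_def \<rho>_def n_def)
      have cF: "continuous_on UNIV (\<lambda>a. F (cvec a (y + b)))"
        by (rule continuous_on_compose2[OF holomorphic_vec_on_imp_continuous_on[OF hol]])
          (use yb in \<open>auto intro!: continuous_intros\<close>)
      then have [measurable]: "(\<lambda>a. F (cvec a (y + b))) \<in> borel_measurable borel"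
        by (rule borel_measurable_continuous_onI)
      have "(\<integral>\<^sup>+a. ennreal (cmod (H (a, b)) powr p) * indicator (E \<rho>) b \<partial>lborel)
          = (\<integral>\<^sup>+a. ennreal (cmod (F (cvec (a + x) (y + b))) powr p) \<partial>lborel)"
        using True yb by (simp add: H_def add.commute)
      also have "\<dots> = (\<integral>\<^sup>+a. ennreal (cmod (F (cvec a (y + b))) powr p) \<partial>lborel)"
        by (rule nn_integral_lborel_translate[where f="\<lambda>a. ennreal (cmod (F (cvec a (y + b))) powr p)"]) measurable
      also have "\<dots> \<le> ennreal M" by (rule M(2)[OF yb])
      finally show ?thesis using True by simp
    qed simp
  qed
  also have "\<dots> = ennreal M * ennreal (c * (2 * \<rho>)^n)"
    using \<rho> by (simp add: nn_integral_cmult_indicator E)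
  finally have "ennreal (cmod (F (cvec x y)) powr p * (c * \<rho>^n)^2) \<le> ennreal (M * (c * (2 * \<rho>)^n))"
    using M(1) c \<rho> by (simp add: ennreal_mult)
  then have "cmod (F (cvec x y)) powr p * (c * \<rho>^n)^2 \<le> M * (c * (2 * \<rho>)^n)"
    by (subst (asm) ennreal_le_iff) (use M(1) c \<rho> in auto)
  \<comment> \<open>One of the two factors c \<rho>^n cancels against the volume of the imaginary
    parts; this is the gain of integrating whole slices.\<close>
  then have "(c * \<rho>^n) * (cmod (F (cvec x y)) powr p * (c * \<rho>^n)) \<le> (c * \<rho>^n) * (M * 2^n)"
    by (simp add: power2_eq_square power_mult_distrib mult_ac)
  then have 1: "cmod (F (cvec x y)) powr p * (c * \<rho>^n) \<le> M * 2^n"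
    using c \<rho> by simp
  have "cmod (F (cvec x y)) powr p * (\<rho>^n * \<rho>^n)
     \<le> cmod (F (cvec x y)) powr p * (c * (exp (4 * pi) * diag_kernel \<Gamma> y) * \<rho>^n)"
    using ck \<rho> by (intro mult_left_mono mult_right_mono) auto
  also have "\<dots> = (cmod (F (cvec x y)) powr p * (c * \<rho>^n)) * (exp (4 * pi) * diag_kernel \<Gamma> y)" by simp
  also have "\<dots> \<le> (M * 2^n) * (exp (4 * pi) * diag_kernel \<Gamma> y)"
    using 1 by (intro mult_right_mono) (auto simp: diag_kernel_nonneg)
  finally have "cmod (F (cvec x y)) powr p / real n ^ (2 * n) \<le> (M * 2^n) * (exp (4 * pi) * diag_kernel \<Gamma> y)"
    by (simp add: \<rho>_def power_divide mult_2 power_add)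
  then show ?thesis
    using n by (simp add: field_simps n_def[symmetric])
qed

subsection \<open>Monotonicity of the integral means\<close>

lemma holomorphic_vec_on_const: "holomorphic_vec_on (\<lambda>_. c) S"
  unfolding holomorphic_vec_on_def by (intro ballI exI[of _ "\<lambda>_. 0"]) (auto intro: has_derivative_const)

lemma holomorphic_vec_on_add:
  assumes "holomorphic_vec_on F S" "holomorphic_vec_on G S"
  shows "holomorphic_vec_on (\<lambda>z. F z + G z) S"
  unfolding holomorphic_vec_on_def
proof
  fix z assume "z \<in> S"
  with assms obtain D E where d: "(F has_derivative D) (at z within S)" "\<And>c v. D (c *s v) = c * D v"
    "(G has_derivative E) (at z within S)" "\<And>c v. E (c *s v) = c * E v"
    unfolding holomorphic_vec_on_def by meson
  then show "\<exists>D. ((\<lambda>z. F z + G z) has_derivative D) (at z within S) \<and> (\<forall>c v. D (c *s v) = c * D v)"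
    by (intro exI[of _ "\<lambda>h. D h + E h"]) (auto intro: has_derivative_add simp: algebra_simps)
qed

lemma holomorphic_vec_on_mult:
  assumes "holomorphic_vec_on F S" "holomorphic_vec_on G S"
  shows "holomorphic_vec_on (\<lambda>z. F z * G z) S"
  unfolding holomorphic_vec_on_def
proof
  fix z assume "z \<in> S"
  with assms obtain D E where d: "(F has_derivative D) (at z within S)" "\<And>c v. D (c *s v) = c * D v"
    "(G has_derivative E) (at z within S)" "\<And>c v. E (c *s v) = c * E v"
    unfolding holomorphic_vec_on_def by meson
  have "((\<lambda>z. F z * G z) has_derivative (\<lambda>h. F z * E h + D h * G z)) (at z within S)"
    by (rule has_derivative_mult[OF d(1,3)])
  moreover have "F z * E (c *s v) + D (c *s v) * G z = c * (F z * E v + D v * G z)" for c v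
    by (simp add: d(2,4) algebra_simps)
  ultimately show "\<exists>D. ((\<lambda>z. F z * G z) has_derivative D) (at z within S) \<and> (\<forall>c v. D (c *s v) = c * D v)"
    by blast
qed

lemma holomorphic_vec_on_diff:
  assumes "holomorphic_vec_on F S" "holomorphic_vec_on G S"
  shows "holomorphic_vec_on (\<lambda>z. F z - G z) S"
  using holomorphic_vec_on_add[OF assms(1) holomorphic_vec_on_mult[OF holomorphic_vec_on_const[of "-1"] assms(2)]]
  by simp

lemma holomorphic_vec_on_inverse:
  assumes "holomorphic_vec_on F S" "\<And>z. z \<in> S \<Longrightarrow> F z \<noteq> 0"
  shows "holomorphic_vec_on (\<lambda>z. inverse (F z)) S"
  unfolding holomorphic_vec_on_def
proof
  fix z assume z: "z \<in> S"
  with assms(1) obtain D where d: "(F has_derivative D) (at z within S)" "\<And>c v. D (c *s v) = c * D v"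
    unfolding holomorphic_vec_on_def by meson
  have "((\<lambda>z. inverse (F z)) has_derivative (\<lambda>h. - (inverse (F z) * D h * inverse (F z)))) (at z within S)"
    by (rule Deriv.has_derivative_inverse[OF assms(2)[OF z] d(1)])
  then show "\<exists>D. ((\<lambda>z. inverse (F z)) has_derivative D) (at z within S) \<and> (\<forall>c v. D (c *s v) = c * D v)"
    by (rule exI[of _ "\<lambda>h. - (inverse (F z) * D h * inverse (F z))", OF conjI]) (simp add: d(2))
qed

lemma holomorphic_vec_on_prod:
  assumes "\<And>i. i \<in> I \<Longrightarrow> holomorphic_vec_on (F i) S"
  shows "holomorphic_vec_on (\<lambda>z. \<Prod>i\<in>I. F i z) S"
  using assms
  by (induction I rule: infinite_finite_induct) (simp_all add: holomorphic_vec_on_const holomorphic_vec_on_mult)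

lemma holomorphic_vec_on_cdot: "holomorphic_vec_on (\<lambda>z. cdot z t) S"
proof -
  have "linear (\<lambda>z. cdot z t)"
    by (rule linearI) (auto simp: cdot_def algebra_simps sum.distrib scaleR_sum_right)
  then have "bounded_linear (\<lambda>z. cdot z t)" by (simp add: linear_conv_bounded_linear)
  then show ?thesis unfolding holomorphic_vec_on_def
    by (intro ballI exI[of _ "\<lambda>z. cdot z t"])
      (auto intro: bounded_linear_imp_has_derivative simp: cdot_def sum_distrib_left mult.assoc)
qed

lemma holomorphic_vec_on_shift:
  assumes hol: "holomorphic_vec_on F (tube \<Gamma>)" and \<Gamma>: "open_cone \<Gamma>" and v: "v \<in> \<Gamma>"
  shows "holomorphic_vec_on (\<lambda>z. F (z + cvec 0 v)) (tube \<Gamma>)"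
  unfolding holomorphic_vec_on_def
proof
  fix z assume z: "z \<in> tube \<Gamma>"
  have op: "open (tube \<Gamma>)" using \<Gamma> by (simp add: open_tube open_cone_def)
  have c: "cvec x y + cvec 0 v = cvec x (y + v)" for x y
    by (simp add: cvec_def vec_eq_iff complex_eq_iff)
  have z': "z + cvec 0 v \<in> tube \<Gamma>"
  proof -
    obtain x y where "z = cvec x y" "y \<in> \<Gamma>" using z by (auto simp: tube_def)
    then show ?thesis using open_cone_add[OF \<Gamma> _ v] by (simp add: c)
  qed
  then obtain D where D: "(F has_derivative D) (at (z + cvec 0 v) within tube \<Gamma>)" "\<And>c v. D (c *s v) = c * D v"
    using hol unfolding holomorphic_vec_on_def by meson
  have D': "(F has_derivative D) (at (z + cvec 0 v))"
    using D(1) unfolding at_within_open[OF z' op] .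
  have "((\<lambda>z. z + cvec 0 v) has_derivative (\<lambda>h. h)) (at z within tube \<Gamma>)"
    by (auto intro!: derivative_eq_intros)
  from has_derivative_compose[OF this D'] D(2)
  show "\<exists>D. ((\<lambda>z. F (z + cvec 0 v)) has_derivative D) (at z within tube \<Gamma>) \<and> (\<forall>c v. D (c *s v) = c * D v)"
    by blast
qed

lemma cvec_add_imag: "cvec x y + cvec 0 v = cvec x (y + v)"
  by (simp add: cvec_def vec_eq_iff complex_eq_iff)

section \<open>Integrals over horizontal slices of the tube\<close>

definition slice_integral :: "real \<Rightarrow> (complex^'n \<Rightarrow> complex) \<Rightarrow> real^'n \<Rightarrow> ennreal" where
  "slice_integral p F y = (\<integral>\<^sup>+x. ennreal (cmod (F (cvec x y)) powr p) \<partial>lborel)"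

lemma slice_measurable:
  assumes "holomorphic_vec_on F (tube \<Gamma>)" "y \<in> \<Gamma>"
  shows "(\<lambda>x. F (cvec x y)) \<in> borel_measurable borel"
proof -
  have "continuous_on UNIV (\<lambda>x. F (cvec x y))"
    by (rule continuous_on_compose2[OF holomorphic_vec_on_imp_continuous_on[OF assms(1)]])
      (use assms(2) in \<open>auto intro!: continuous_intros\<close>)
  then show ?thesis by (rule borel_measurable_continuous_onI)
qed

text \<open>On the half plane of points x + iy + u v with Im u \<ge> 0, the boundary lies in the
  slice over y, and u = i is the point x + i(y + v). The Poisson mean needs F to be bounded there:
  the pointwise bound supplies this, as the kernel does not increase along v. Integrating over x
  then turns the mean of real translates into the integral over y.\<close>

lemma slice_integral_antimono:
  fixes F :: "complex^'n \<Rightarrow> complex"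
  assumes \<Gamma>: "regular_cone \<Gamma>" and hol: "holomorphic_vec_on F (tube \<Gamma>)" and p: "p \<ge> 1"
    and M: "M \<ge> 0" "\<And>y. y \<in> \<Gamma> \<Longrightarrow> slice_integral p F y \<le> ennreal M"
    and y: "y \<in> \<Gamma>" and v: "v \<in> \<Gamma>"
  shows "slice_integral p F (y + v) \<le> slice_integral p F y"
proof -
  have oc: "open_cone \<Gamma>" and op: "open \<Gamma>" using \<Gamma> by (auto simp: regular_cone_def open_cone_def)
  define A where "A = exp (4 * pi) * 2 ^ CARD('n) * real CARD('n) ^ (2 * CARD('n))"
  have A: "A \<ge> 0" by (simp add: A_def)
  define B where "B = (A * M * diag_kernel \<Gamma> y) powr (1 / p)"
  have yt: "y + t *\<^sub>R v \<in> \<Gamma>" "diag_kernel \<Gamma> (y + t *\<^sub>R v) \<le> diag_kernel \<Gamma> y" if "t \<ge> 0" for t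
    using that y v open_cone_scale[OF oc v, of t] open_cone_add[OF oc y] diag_kernel_antimono[OF oc y]
    by (cases "t = 0"; auto)+
  have B: "cmod (F (cvec x (y + t *\<^sub>R v))) \<le> B" if "t \<ge> 0" for t x
  proof -
    have "cmod (F (cvec x (y + t *\<^sub>R v))) powr p \<le> A * M * diag_kernel \<Gamma> (y + t *\<^sub>R v)"
      unfolding A_def
      by (rule pointwise_bound[OF \<Gamma> hol p M(1) M(2)[unfolded slice_integral_def] yt(1)[OF that]])
    also have "\<dots> \<le> A * M * diag_kernel \<Gamma> y"
      using yt(2)[OF that] A M by (intro mult_left_mono) auto
    finally have "(cmod (F (cvec x (y + t *\<^sub>R v))) powr p) powr (1/p) \<le> B"
      unfolding B_def using p by (intro powr_mono2) auto
    then show ?thesis using p by (simp add: powr_powr)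
  qed
  have pt: "ennreal (cmod (F (cvec x (y + v))) powr p)
     \<le> (\<integral>\<^sup>+t. ennreal (cmod (F (cvec (x + (- cot (pi * t)) *\<^sub>R v) y)) powr p) \<partial>unit_measure)" for x
  proof -
    define f where "f = (\<lambda>u. F (cvec (x + Re u *\<^sub>R v - Im u *\<^sub>R 0) (y + Re u *\<^sub>R 0 + Im u *\<^sub>R v)))"
    define S where "S = {u. y + Re u *\<^sub>R 0 + Im u *\<^sub>R v \<in> \<Gamma>}"
    have "f holomorphic_on S" unfolding f_def S_def by (rule holomorphic_vec_on_slice[OF hol op])
    moreover have "open S" unfolding S_def by (intro open_Collect_mem op continuous_intros)
    ultimately have "ennreal (cmod (f \<i>) powr p) \<le> (\<integral>\<^sup>+t. ennreal (cmod (f (of_real (- cot (pi * t)))) powr p) \<partial>unit_measure)"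
      by (rule powr_norm_le_halfplane_mean[where B=B]) (use yt B p in \<open>auto simp: S_def f_def\<close>)
    then show ?thesis by (simp add: f_def)
  qed
  note [measurable] = slice_measurable[OF hol y]
  have cm: "(\<lambda>t. cot (pi * t)) \<in> borel_measurable unit_measure"
    unfolding cot_def by (rule measurable_restrict_space1) measurable
  have meas: "(\<lambda>(x, t). ennreal (cmod (F (cvec (x + (- cot (pi * t)) *\<^sub>R v) y)) powr p))
     \<in> borel_measurable (lborel \<Otimes>\<^sub>M unit_measure)"
  proof -
    have [measurable]: "(\<lambda>w. cot (pi * snd w)) \<in> borel_measurable ((lborel :: (real^'n) measure) \<Otimes>\<^sub>M unit_measure)"
      using cm by (rule measurable_compose[OF measurable_snd])
    show ?thesis unfolding case_prod_beta by measurable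
  qed
  interpret pair_sigma_finite "lborel :: (real^'n) measure" unit_measure ..
  have "slice_integral p F (y + v) \<le> (\<integral>\<^sup>+x. (\<integral>\<^sup>+t. ennreal (cmod (F (cvec (x + (- cot (pi * t)) *\<^sub>R v) y)) powr p) \<partial>unit_measure) \<partial>lborel)"
    unfolding slice_integral_def by (intro nn_integral_mono pt)
  also have "\<dots> = (\<integral>\<^sup>+t. (\<integral>\<^sup>+x. ennreal (cmod (F (cvec (x + (- cot (pi * t)) *\<^sub>R v) y)) powr p) \<partial>lborel) \<partial>unit_measure)"
    by (rule Fubini'[symmetric]) (rule meas)
  also have "\<dots> = (\<integral>\<^sup>+t. slice_integral p F y \<partial>unit_measure)"
    unfolding slice_integral_def
    by (intro nn_integral_cong nn_integral_lborel_translate[where f="\<lambda>x. ennreal (cmod (F (cvec x y)) powr p)"]) measurable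
  also have "\<dots> = slice_integral p F y" by (simp add: emeasure_restrict_space)
  finally show ?thesis .
qed

subsection \<open>Approximation by translates\<close>

text \<open>Strict convexity, from the mean value theorem on both halves and the strictly increasing
  derivative. At the endpoint s = 0 continuity suffices.\<close>

lemma powr_midpoint_less:
  fixes s t p :: real
  assumes "0 \<le> s" "s < t" "p > 1"
  shows "((s + t) / 2) powr p < (s powr p + t powr p) / 2"
proof -
  define m where "m = (s + t) / 2"
  have m: "s < m" "m < t" "m > 0" using assms by (auto simp: m_def)
  have mvt: "\<exists>x>a. x < b \<and> b powr p - a powr p = (b - a) * (p * x powr (p - 1))" if "0 \<le> a" "a < b" for a b
  proof -
    have "\<exists>l z. a < z \<and> z < b \<and> ((\<lambda>x. x powr p) has_real_derivative l) (at z) \<and> b powr p - a powr p = (b - a) * l"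
    proof (rule MVT[OF \<open>a < b\<close>])
      show "continuous_on {a..b} (\<lambda>x. x powr p)"
        using that assms by (intro continuous_on_powr' continuous_intros) auto
      show "(\<lambda>x. x powr p) differentiable (at x)" if "a < x" "x < b" for x
        using has_real_derivative_powr[of x p] that \<open>0 \<le> a\<close> by (auto simp: real_differentiable_def)
    qed
    then obtain l z where z: "a < z" "z < b" "((\<lambda>x. x powr p) has_real_derivative l) (at z)" "b powr p - a powr p = (b - a) * l"
      by blast
    moreover have "((\<lambda>x. x powr p) has_real_derivative p * z powr (p - 1)) (at z)"
      using z that by (intro has_real_derivative_powr) auto
    ultimately show ?thesis using DERIV_unique by blast
  qed
  obtain x1 where x1: "m < x1" "t powr p - m powr p = (t - m) * (p * x1 powr (p - 1))"
    using mvt[of m t] m by auto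
  obtain x2 where x2: "s < x2" "x2 < m" "m powr p - s powr p = (m - s) * (p * x2 powr (p - 1))"
    using mvt[of s m] m assms by auto
  have "x2 powr (p - 1) < x1 powr (p - 1)" using x1 x2 assms by (intro powr_less_mono2) auto
  then have "(m - s) * (p * x2 powr (p - 1)) < (m - s) * (p * x1 powr (p - 1))"
    using m assms by auto
  moreover have "t - m = m - s" by (simp add: m_def field_simps)
  ultimately have "m powr p - s powr p < t powr p - m powr p" using x1(2) x2(3) by simp
  then show ?thesis by (simp add: m_def[symmetric])
qed

text \<open>Different moduli are handled by strict convexity of s^p, equal moduli by the
  parallelogram law.\<close>

lemma powr_norm_midpoint_less:
  fixes a b :: complex
  assumes "a \<noteq> b" "p > 1"
  shows "cmod ((a + b) / 2) powr p < (cmod a powr p + cmod b powr p) / 2"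
proof (cases "cmod a = cmod b")
  case False
  have "cmod ((a + b) / 2) powr p \<le> ((cmod a + cmod b) / 2) powr p"
    using assms norm_triangle_ineq[of a b] by (intro powr_mono2) (auto simp: norm_divide)
  also have "\<dots> < (cmod a powr p + cmod b powr p) / 2"
    using powr_midpoint_less[of "cmod a" "cmod b" p] powr_midpoint_less[of "cmod b" "cmod a" p] False assms
    by (cases "cmod a < cmod b") (auto simp: add.commute)
  finally show ?thesis .
next
  case True
  have "(cmod (a + b))^2 + (cmod (a - b))^2 = 2 * (cmod a)^2 + 2 * (cmod b)^2"
    unfolding cmod_power2 by (simp add: power2_eq_square algebra_simps)
  moreover have "(cmod (a - b))^2 > 0" using assms by simp
  moreover have "(2 * cmod a)^2 = 2 * (cmod a)^2 + 2 * (cmod b)^2" using True by (simp add: power_mult_distrib)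
  ultimately have "(cmod (a + b))^2 < (2 * cmod a)^2" by linarith
  then have "cmod (a + b) < 2 * cmod a" by (rule power_less_imp_less_base) simp
  then have "cmod ((a + b) / 2) powr p < cmod a powr p"
    using assms by (intro powr_less_mono2) (auto simp: norm_divide)
  then show ?thesis using True by simp
qed

lemma powr_norm_midpoint_le:
  fixes a b :: complex
  assumes "p > 1"
  shows "cmod ((a + b) / 2) powr p \<le> (cmod a powr p + cmod b powr p) / 2"
proof (cases "a = b")
  case True
  then have "(a + b) / 2 = a" by simp
  then show ?thesis using True by simp
qed (use powr_norm_midpoint_less[OF _ assms, of a b] in simp)

text \<open>Uniform convexity of \<open>L\<^sup>p\<close> in pointwise form: by homogeneity it suffices to compare both sides
  on a compact set, where strict convexity bounds the defect from below.\<close>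

lemma powr_norm_uniform_convexity:
  fixes p e :: real
  assumes p: "p > 1" and e: "e > 0"
  shows "\<exists>C\<ge>0. \<forall>a b. cmod (a - b) powr p + C * cmod ((a + b) / 2) powr p
     \<le> (e + C / 2) * (cmod a powr p + cmod b powr p)"
proof -
  \<comment> \<open>Normalized pairs whose difference is not small. K is compact and avoids a = b,
    so the convexity defect \<open>h\<close> has a positive minimum c on it.\<close>
  define K where "K = {z::complex\<times>complex. cmod (fst z) powr p + cmod (snd z) powr p = 1 \<and> cmod (fst z - snd z) powr p \<ge> e}"
  define h where "h z = 1/2 - cmod ((fst z + snd z) / 2) powr p" for z :: "complex\<times>complex"
  have cpow: "continuous_on UNIV (\<lambda>z. cmod (f z) powr p)" if "continuous_on UNIV f" for f :: "complex\<times>complex \<Rightarrow> complex"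
    using that p by (intro continuous_on_powr' continuous_intros) auto
  have norm1: "cmod (fst z) \<le> 1 \<and> cmod (snd z) \<le> 1" if "cmod (fst z) powr p + cmod (snd z) powr p = 1" for z :: "complex\<times>complex"
  proof -
    have "x \<le> 1" if "x powr p \<le> 1" "x \<ge> 0" for x :: real
    proof (rule ccontr)
      assume "\<not> x \<le> 1"
      then have "1 powr p < x powr p" using p by (intro powr_less_mono2) auto
      then show False using that by simp
    qed
    moreover have "cmod (fst z) powr p \<ge> 0" "cmod (snd z) powr p \<ge> 0" by simp_all
    ultimately show ?thesis using that by (metis add_increasing add_increasing2 le_numeral_extra(4) norm_ge_zero order_refl)
  qed
  have "compact K"
  proof -
    have "norm z \<le> 2" if "z \<in> K" for z
      using norm1[of z] that norm_Pair_le[of "fst z" "snd z"] by (force simp: K_def)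
    then have "bounded K" by (meson bounded_iff)
    moreover have "closed K"
      unfolding K_def by (intro closed_Collect_conj closed_Collect_eq closed_Collect_le continuous_intros cpow)
    ultimately show ?thesis by (simp add: compact_eq_bounded_closed)
  qed
  have hpos: "h z > 0" if "z \<in> K" for z
  proof -
    have "fst z \<noteq> snd z" using that e p by (auto simp: K_def)
    from powr_norm_midpoint_less[OF this p] show ?thesis using that by (simp add: h_def K_def)
  qed
  obtain c where c: "c > 0" "\<And>z. z \<in> K \<Longrightarrow> h z \<ge> c"
  proof (cases "K = {}")
    case False
    have "continuous_on K h" unfolding h_def
      by (intro continuous_intros continuous_on_subset[OF cpow]) (auto intro!: continuous_intros)
    from continuous_attains_inf[OF \<open>compact K\<close> False this] obtain z where "z \<in> K" "\<And>w. w \<in> K \<Longrightarrow> h z \<le> h w"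
      by blast
    then show thesis using that[of "h z"] hpos by blast
  qed (use that[of 1] in auto)
  \<comment> \<open>On K, |a - b|^p \<le> 2^p = C c \<le> C h(a, b). Off K, the difference is
    absorbed by e and midpoint convexity does the rest.\<close>
  define C where "C = 2 powr p / c"
  have C: "C \<ge> 0" using c by (simp add: C_def)
  have main: "cmod (a - b) powr p + C * cmod ((a + b) / 2) powr p \<le> (e + C / 2)"
    if ab: "cmod a powr p + cmod b powr p = 1" for a b
  proof (cases "(a, b) \<in> K")
    case True
    have "cmod (a - b) \<le> cmod a + cmod b" by (rule norm_triangle_ineq4)
    then have "cmod (a - b) powr p \<le> 2 powr p"
      using norm1[of "(a, b)"] ab p by (intro powr_mono2) auto
    also have "2 powr p = C * c" using c by (simp add: C_def)
    also have "\<dots> \<le> C * h (a, b)" using c(2)[OF True] C by (rule mult_left_mono)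
    finally show ?thesis using e by (simp add: h_def algebra_simps)
  next
    case False
    then have "cmod (a - b) powr p < e" using ab by (simp add: K_def)
    moreover have "C * cmod ((a + b) / 2) powr p \<le> C * (1/2)"
      using powr_norm_midpoint_le[OF p, of a b] ab C by (intro mult_left_mono) auto
    ultimately show ?thesis by simp
  qed
  show ?thesis
  proof (intro exI[of _ C] conjI allI C)
    fix a b
    define q where "q = cmod a powr p + cmod b powr p"
    show "cmod (a - b) powr p + C * cmod ((a + b) / 2) powr p \<le> (e + C / 2) * (cmod a powr p + cmod b powr p)"
    proof (cases "q = 0")
      case True
      then have "cmod a powr p = 0" "cmod b powr p = 0"
        unfolding q_def by (smt (verit) powr_ge_zero)+
      then show ?thesis by simp
    next
      case False
      then have q: "q > 0" unfolding q_def by (smt (verit) powr_ge_zero)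
      \<comment> \<open>Both sides are homogeneous of degree p, so dividing a and b by s reduces to
        q = 1.\<close>
      define s where "s = q powr (1/p)"
      have s: "s > 0" "s powr p = q" using q p by (auto simp: s_def powr_powr)
      have sc: "cmod (w / of_real s) powr p = cmod w powr p / q" for w
        using s by (simp add: norm_divide powr_divide)
      have "cmod (a / of_real s) powr p + cmod (b / of_real s) powr p = 1"
        using q unfolding sc by (simp add: q_def flip: add_divide_distrib)
      moreover have "a / of_real s - b / of_real s = (a - b) / of_real s"
        "(a / of_real s + b / of_real s) / 2 = ((a + b) / 2) / of_real s"
        by (simp_all add: diff_divide_distrib add_divide_distrib mult.commute)
      ultimately have "cmod ((a - b) / of_real s) powr p + C * cmod (((a + b) / 2) / of_real s) powr p \<le> e + C / 2"
        using main[of "a / of_real s" "b / of_real s"] by (simp only:)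
      then have "(cmod (a - b) powr p + C * cmod ((a + b) / 2) powr p) / q \<le> e + C / 2"
        unfolding sc by (simp add: add_divide_distrib)
      then show ?thesis using q by (simp add: pos_divide_le_eq q_def)
    qed
  qed
qed

lemma small_step_in_cone:
  fixes \<Gamma> :: "(real^'n) set"
  assumes "open \<Gamma>" "y \<in> \<Gamma>"
  shows "eventually (\<lambda>s. y - s *\<^sub>R v \<in> \<Gamma>) (at_right 0)"
proof -
  have "((\<lambda>s. y - s *\<^sub>R v) \<longlongrightarrow> y - 0 *\<^sub>R v) (at_right 0)" by (intro tendsto_intros)
  then show ?thesis using topological_tendstoD assms by fastforce
qed

text \<open>The integral means increase towards the boundary, to \<open>m\<close> say. If \<open>F\<close> and a translate have
  midpoint of mean close to \<open>m\<close> at one point \<open>y\<^sub>0\<close>, then also below \<open>y\<^sub>0\<close>, so the difference is small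
  there by uniform convexity, and everywhere by monotonicity. No boundary values are needed.\<close>

lemma translate_approx:
  fixes F :: "complex^'n \<Rightarrow> complex"
  assumes \<Gamma>: "regular_cone \<Gamma>" and hol: "holomorphic_vec_on F (tube \<Gamma>)" and p: "p > 1"
    and M: "M \<ge> 0" "\<And>y. y \<in> \<Gamma> \<Longrightarrow> slice_integral p F y \<le> ennreal M" and \<epsilon>: "\<epsilon> > 0"
  shows "\<exists>w\<in>\<Gamma>. \<forall>y\<in>\<Gamma>. slice_integral p (\<lambda>z. F z - F (z + cvec 0 w)) y \<le> ennreal \<epsilon>"
proof -
  have oc: "open_cone \<Gamma>" and op: "open \<Gamma>" and ne: "\<Gamma> \<noteq> {}" using \<Gamma> by (auto simp: regular_cone_def open_cone_def)
  obtain v where v: "v \<in> \<Gamma>" using ne by blast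
  define m' where "m' = (SUP y\<in>\<Gamma>. slice_integral p F y)"
  have "m' \<le> ennreal M" unfolding m'_def using M by (intro SUP_least) auto
  then obtain m where m: "m' = ennreal m" "m \<ge> 0" by (cases m') (auto simp: top_unique)
  have lm: "slice_integral p F y \<le> ennreal m" if "y \<in> \<Gamma>" for y
    unfolding m(1)[symmetric] m'_def using that by (rule SUP_upper)
  \<comment> \<open>The final error is at most 2 e m + C \<eta>, and each summand receives half of
    \<epsilon>. Since C depends on e, \<eta> is chosen after it.\<close>
  define e where "e = \<epsilon> / (4 * (m + 1))"
  have e: "e > 0" "2 * e * m \<le> \<epsilon> / 2" using \<epsilon> m by (auto simp: e_def field_simps)
  obtain C where C: "C \<ge> 0" "\<And>a b. cmod (a - b) powr p + C * cmod ((a + b) / 2) powr p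
     \<le> (e + C / 2) * (cmod a powr p + cmod b powr p)"
    using powr_norm_uniform_convexity[OF p e(1)] by blast
  define \<eta> where "\<eta> = \<epsilon> / (2 * (C + 1))"
  have \<eta>: "\<eta> > 0" "C * \<eta> \<le> \<epsilon> / 2" using \<epsilon> C by (auto simp: \<eta>_def field_simps)
  \<comment> \<open>For m < \<eta> the level m - \<eta> is negative and its \<open>ennreal\<close>
    is 0, where strict inequality can fail (for F = 0); the disjunction covers this case.\<close>
  obtain y0 where y0: "y0 \<in> \<Gamma>" "slice_integral p F y0 > ennreal (m - \<eta>) \<or> m < \<eta>"
  proof (cases "m < \<eta>")
    case False
    then have "ennreal (m - \<eta>) < m'" using \<eta> by (simp add: m ennreal_less_iff)
    then show thesis using that unfolding m'_def less_SUP_iff by blast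
  qed (use v that in blast)
  define \<sigma> where "\<sigma> k = inverse (real (Suc k))" for k
  have \<sigma>: "\<sigma> k > 0" for k by (simp add: \<sigma>_def)
  have sv: "\<sigma> k *\<^sub>R v \<in> \<Gamma>" for k by (rule open_cone_scale[OF oc v \<sigma>])
  define H where "H w z = (F z + F (z + cvec 0 w)) / 2" for w z
  define D where "D w z = F z - F (z + cvec 0 w)" for w z
  have holw: "holomorphic_vec_on (\<lambda>z. F (z + cvec 0 w)) (tube \<Gamma>)" if "w \<in> \<Gamma>" for w
    by (rule holomorphic_vec_on_shift[OF hol oc that])
  have holH: "holomorphic_vec_on (H w) (tube \<Gamma>)" if "w \<in> \<Gamma>" for w
    using holomorphic_vec_on_mult[OF holomorphic_vec_on_add[OF hol holw[OF that]] holomorphic_vec_on_const[of "1/2"]]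
    by (simp add: H_def[abs_def])
  have holD: "holomorphic_vec_on (D w) (tube \<Gamma>)" if "w \<in> \<Gamma>" for w
    unfolding D_def by (rule holomorphic_vec_on_diff[OF hol holw[OF that]])
  \<comment> \<open>Uniform convexity integrated over a slice. The right side exceeds C m by 2 e m
    only, so a midpoint with mean close to m leaves little room for the difference.\<close>
  have key: "slice_integral p (D w) y + ennreal C * slice_integral p (H w) y \<le> ennreal ((2 * e + C) * m)"
    if w: "w \<in> \<Gamma>" and y: "y \<in> \<Gamma>" for w y
  proof -
    note [measurable] = slice_measurable[OF hol y] slice_measurable[OF holw[OF w] y]
      slice_measurable[OF holH[OF w] y] slice_measurable[OF holD[OF w] y]
    have "slice_integral p (D w) y + ennreal C * slice_integral p (H w) y
       = (\<integral>\<^sup>+x. ennreal (cmod (D w (cvec x y)) powr p) + ennreal C * ennreal (cmod (H w (cvec x y)) powr p) \<partial>lborel)"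
      unfolding slice_integral_def by (subst nn_integral_add) (auto simp: nn_integral_cmult)
    also have "\<dots> \<le> (\<integral>\<^sup>+x. ennreal (e + C / 2) * (ennreal (cmod (F (cvec x y)) powr p) + ennreal (cmod (F (cvec x y + cvec 0 w)) powr p)) \<partial>lborel)"
    proof (rule nn_integral_mono)
      fix x
      show "ennreal (cmod (D w (cvec x y)) powr p) + ennreal C * ennreal (cmod (H w (cvec x y)) powr p)
        \<le> ennreal (e + C / 2) * (ennreal (cmod (F (cvec x y)) powr p) + ennreal (cmod (F (cvec x y + cvec 0 w)) powr p))"
        using C(2)[of "F (cvec x y)" "F (cvec x y + cvec 0 w)"] C(1) e(1)
        by (simp add: D_def H_def ennreal_mult[symmetric] ennreal_plus[symmetric] del: ennreal_plus)
    qed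
    also have "\<dots> = ennreal (e + C / 2) * (slice_integral p F y + slice_integral p F (y + w))"
      unfolding slice_integral_def cvec_add_imag[symmetric] by (simp add: nn_integral_cmult nn_integral_add)
    also have "\<dots> \<le> ennreal (e + C / 2) * (ennreal m + ennreal m)"
      using lm[OF y] lm[OF open_cone_add[OF oc y w]] by (intro mult_left_mono add_mono) auto
    also have "\<dots> = ennreal ((e + C / 2) * (m + m))"
      using C(1) e(1) m(2) by (simp add: ennreal_mult[symmetric] ennreal_plus[symmetric] del: ennreal_plus)
    also have "(e + C / 2) * (m + m) = (2 * e + C) * m" by (simp add: algebra_simps)
    finally show ?thesis .
  qed
  have Hbd: "slice_integral p (H w) y \<le> ennreal m" if w: "w \<in> \<Gamma>" and y: "y \<in> \<Gamma>" for w y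
  proof -
    define hf :: real where "hf = 1/2"
    have hf: "hf \<ge> 0" by (simp_all add: hf_def)
    have hf': "hf * (m + m) = m" by (simp add: hf_def)
    note [measurable] = slice_measurable[OF hol y] slice_measurable[OF holw[OF w] y]
    have "slice_integral p (H w) y \<le> (\<integral>\<^sup>+x. ennreal hf * (ennreal (cmod (F (cvec x y)) powr p) + ennreal (cmod (F (cvec x y + cvec 0 w)) powr p)) \<partial>lborel)"
      unfolding slice_integral_def
    proof (rule nn_integral_mono)
      fix x
      have "cmod (H w (cvec x y)) powr p \<le> hf * (cmod (F (cvec x y)) powr p + cmod (F (cvec x y + cvec 0 w)) powr p)"
        using powr_norm_midpoint_le[OF p, of "F (cvec x y)" "F (cvec x y + cvec 0 w)"]
        by (simp add: H_def hf_def)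
      then show "ennreal (cmod (H w (cvec x y)) powr p)
        \<le> ennreal hf * (ennreal (cmod (F (cvec x y)) powr p) + ennreal (cmod (F (cvec x y + cvec 0 w)) powr p))"
        using hf by (simp add: ennreal_mult[symmetric] ennreal_plus[symmetric] del: ennreal_plus)
    qed
    also have "\<dots> = ennreal hf * (slice_integral p F y + slice_integral p F (y + w))"
      unfolding slice_integral_def cvec_add_imag[symmetric] by (simp add: nn_integral_cmult nn_integral_add)
    also have "\<dots> \<le> ennreal hf * (ennreal m + ennreal m)"
      using lm[OF y] lm[OF open_cone_add[OF oc y w]] by (intro mult_left_mono add_mono) auto
    also have "\<dots> = ennreal m"
      using m(2) hf hf' by (simp add: ennreal_mult[symmetric] ennreal_plus[symmetric] del: ennreal_plus)
    finally show ?thesis .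
  qed
  have Dbd: "slice_integral p (D w) y \<le> ennreal ((2 * e + C) * m)" if "w \<in> \<Gamma>" "y \<in> \<Gamma>" for w y
    by (rule order_trans[OF _ key[OF that]]) (simp add: add_increasing2)
  have lim: "(\<lambda>k. cmod (H (\<sigma> k *\<^sub>R v) (cvec x y0)) powr p) \<longlonglongrightarrow> cmod (F (cvec x y0)) powr p" for x
  proof -
    have "\<sigma> \<longlonglongrightarrow> 0" unfolding \<sigma>_def by (rule LIMSEQ_inverse_real_of_nat)
    then have "(\<lambda>k. cvec x (y0 + \<sigma> k *\<^sub>R v)) \<longlonglongrightarrow> cvec x (y0 + 0 *\<^sub>R v)"
      unfolding cvec_def Complex_eq by (intro tendsto_intros)
    then have "(\<lambda>k. F (cvec x (y0 + \<sigma> k *\<^sub>R v))) \<longlonglongrightarrow> F (cvec x (y0 + 0 *\<^sub>R v))"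
      by (rule continuous_on_tendsto_compose[OF holomorphic_vec_on_imp_continuous_on[OF hol]])
        (use y0 sv open_cone_add[OF oc] in auto)
    then have "(\<lambda>k. cmod (H (\<sigma> k *\<^sub>R v) (cvec x y0)) powr p) \<longlonglongrightarrow> cmod ((F (cvec x y0) + F (cvec x y0)) / 2) powr p"
      unfolding H_def cvec_add_imag using p by (intro tendsto_intros) auto
    then show ?thesis by simp
  qed
  \<comment> \<open>Fatou's lemma: over y0 the midpoints converge pointwise to F, so the lower limit
    of their means is at least the mean of F.\<close>
  obtain k where k: "slice_integral p (H (\<sigma> k *\<^sub>R v)) y0 > ennreal (m - \<eta>) \<or> m < \<eta>"
  proof (cases "m < \<eta>")
    case False
    have "slice_integral p F y0 = (\<integral>\<^sup>+x. liminf (\<lambda>k. ennreal (cmod (H (\<sigma> k *\<^sub>R v) (cvec x y0)) powr p)) \<partial>lborel)"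
      unfolding slice_integral_def
      by (intro nn_integral_cong lim_imp_Liminf[symmetric] tendsto_ennrealI lim) simp
    also have "\<dots> \<le> liminf (\<lambda>k. slice_integral p (H (\<sigma> k *\<^sub>R v)) y0)"
      unfolding slice_integral_def
    proof (rule nn_integral_liminf)
      fix k
      note [measurable] = slice_measurable[OF holH[OF sv] y0(1)]
      show "(\<lambda>x. ennreal (cmod (H (\<sigma> k *\<^sub>R v) (cvec x y0)) powr p)) \<in> borel_measurable lborel"
        by measurable
    qed
    finally have "ennreal (m - \<eta>) < liminf (\<lambda>k. slice_integral p (H (\<sigma> k *\<^sub>R v)) y0)" using y0(2) False by auto
    then have "eventually (\<lambda>k. ennreal (m - \<eta>) < slice_integral p (H (\<sigma> k *\<^sub>R v)) y0) sequentially"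
      by (rule less_LiminfD)
    then show thesis using that by (auto simp: eventually_sequentially)
  qed (use that in blast)
  define w where "w = \<sigma> k *\<^sub>R v"
  have w: "w \<in> \<Gamma>" by (simp add: w_def sv)
  have "slice_integral p (D w) y \<le> ennreal \<epsilon>" if y: "y \<in> \<Gamma>" for y
  proof -
    \<comment> \<open>One point y1 = s v is placed below both y0 and y. Monotonicity carries the
      lower bound on the midpoint mean from y0 down to y1, and the bound on the difference from y1
      up to y.\<close>
    have "eventually (\<lambda>s. y0 - s *\<^sub>R v \<in> \<Gamma> \<and> y - s *\<^sub>R v \<in> \<Gamma> \<and> s > 0) (at_right (0::real))"
      by (intro eventually_conj small_step_in_cone op y0(1) y eventually_at_right_less)
    then obtain s where s: "y0 - s *\<^sub>R v \<in> \<Gamma>" "y - s *\<^sub>R v \<in> \<Gamma>" "s > 0"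
      using eventually_happens[of _ "at_right (0::real)"] by (auto simp: trivial_limit_at_right_real)
    define y1 where "y1 = s *\<^sub>R v"
    have y1: "y1 \<in> \<Gamma>" unfolding y1_def by (rule open_cone_scale[OF oc v s(3)])
    have "slice_integral p (H w) (y1 + (y0 - y1)) \<le> slice_integral p (H w) y1"
      by (rule slice_integral_antimono[OF \<Gamma> holH[OF w] _ m(2) Hbd[OF w] y1]) (use p s in \<open>auto simp: y1_def\<close>)
    then have "slice_integral p (H w) y1 \<ge> ennreal (m - \<eta>) \<or> m < \<eta>" using k by (auto simp: w_def)
    then have Hge: "slice_integral p (H w) y1 \<ge> ennreal (m - \<eta>)"
      using ennreal_neg[of "m - \<eta>"] by auto
    have "slice_integral p (D w) (y1 + (y - y1)) \<le> slice_integral p (D w) y1"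
      by (rule slice_integral_antimono[OF \<Gamma> holD[OF w] _ _ Dbd[OF w] y1]) (use p s e C m in \<open>auto simp: y1_def\<close>)
    then have "slice_integral p (D w) y + ennreal C * ennreal (m - \<eta>) \<le> slice_integral p (D w) y1 + ennreal C * slice_integral p (H w) y1"
      using Hge by (intro add_mono mult_left_mono) auto
    also have "\<dots> \<le> ennreal ((2 * e + C) * m)" by (rule key[OF w y1])
    finally have fin: "slice_integral p (D w) y + ennreal (C * (m - \<eta>)) \<le> ennreal ((2 * e + C) * m)"
      using C(1) by (simp add: ennreal_mult')
    then have "slice_integral p (D w) y \<noteq> top" by (auto simp: top_unique)
    then obtain d where d: "slice_integral p (D w) y = ennreal d" "d \<ge> 0" by (cases "slice_integral p (D w) y") auto
    have "d + C * (m - \<eta>) \<le> (2 * e + C) * m"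
    proof (cases "m \<ge> \<eta>")
      case True
      then have "ennreal (d + C * (m - \<eta>)) \<le> ennreal ((2 * e + C) * m)"
        using fin d C by simp
      then show ?thesis by (subst (asm) ennreal_le_iff) (use e C m in auto)
    next
      case False
      have "ennreal d \<le> ennreal ((2 * e + C) * m)" using Dbd[OF w y] d by simp
      then have "d \<le> (2 * e + C) * m" by (subst (asm) ennreal_le_iff) (use e C m in auto)
      moreover have "C * (m - \<eta>) \<le> 0" using False C by (intro mult_nonneg_nonpos) auto
      ultimately show ?thesis by linarith
    qed
    then have "d \<le> 2 * e * m + C * \<eta>" by (simp add: algebra_simps)
    also have "\<dots> \<le> \<epsilon>" using e(2) \<eta>(2) by simp
    finally show ?thesis using d by (simp add: ennreal_leI)
  qed
  then show ?thesis using w by (auto simp: D_def[abs_def])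
qed

subsection \<open>Truncation\<close>

text \<open>The points \<open>t \<plusminus> r e\<^sub>j\<close> lie in the dual cone, and one of the numbers \<open>x \<bullet> (t \<plusminus> r e\<^sub>j)\<close> has modulus
  at least \<open>r |x\<^sub>j|\<close>.\<close>

definition cutoff :: "real^'n \<Rightarrow> real \<Rightarrow> real \<Rightarrow> complex^'n \<Rightarrow> complex" where
  "cutoff t r d z = (\<Prod>j\<in>UNIV. (inverse (1 - \<i> * of_real d * cdot z (t + r *\<^sub>R axis j 1)) *
     inverse (1 - \<i> * of_real d * cdot z (t - r *\<^sub>R axis j 1)))\<^sup>2)"

lemma cdot_cvec: "cdot (cvec x y) t = Complex (x \<bullet> t) (y \<bullet> t)"
  by (simp add: cdot_def cvec_def complex_eq_iff inner_vec_def)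

text \<open>The factor equals (1 + d b) - i d a. Nonnegative b, which is what pairing with the dual
  cone provides, keeps it in the half plane Re \<ge> 1, away from 0.\<close>

lemma norm_cutoff_factor:
  assumes "d \<ge> 0" "b \<ge> 0"
  shows "(cmod (1 - \<i> * of_real d * Complex a b))\<^sup>2 \<ge> 1 + (d * a)\<^sup>2"
proof -
  have "(cmod (1 - \<i> * of_real d * Complex a b))\<^sup>2 = (1 + d * b)\<^sup>2 + (d * a)\<^sup>2"
    by (simp add: cmod_power2)
  moreover have "1\<^sup>2 \<le> (1 + d * b)\<^sup>2" using assms by (intro power_mono) auto
  ultimately show ?thesis by simp
qed

lemma cutoff_factor_nonzero:
  assumes "d \<ge> 0" "b \<ge> 0"
  shows "1 - \<i> * of_real d * Complex a b \<noteq> 0"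
proof
  assume "1 - \<i> * of_real d * Complex a b = 0"
  with norm_cutoff_factor[OF assms, of a] have "1 + (d * a)\<^sup>2 \<le> 0" by simp
  then show False using zero_le_power2[of "d * a"] by linarith
qed

context
  fixes \<Gamma> :: "(real^'n) set" and t :: "real^'n" and r :: real
  assumes ball: "cball t r \<subseteq> dual_cone \<Gamma>" and r: "r > 0"
begin

lemma cutoff_dual: "t + r *\<^sub>R axis j 1 \<in> dual_cone \<Gamma>" "t - r *\<^sub>R axis j 1 \<in> dual_cone \<Gamma>"
  using r by (auto intro!: subsetD[OF ball] simp: dist_norm)

lemma holomorphic_cutoff:
  assumes d: "d \<ge> 0"
  shows "holomorphic_vec_on (cutoff t r d) (tube \<Gamma>)"
proof -
  have 1: "holomorphic_vec_on (\<lambda>z. inverse (1 - \<i> * of_real d * cdot z s)) (tube \<Gamma>)" if s: "s \<in> dual_cone \<Gamma>" for s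
  proof (rule holomorphic_vec_on_inverse)
    show "holomorphic_vec_on (\<lambda>z. 1 - \<i> * of_real d * cdot z s) (tube \<Gamma>)"
      by (intro holomorphic_vec_on_diff holomorphic_vec_on_mult holomorphic_vec_on_const holomorphic_vec_on_cdot)
    fix z assume "z \<in> tube \<Gamma>"
    then obtain x y where "z = cvec x y" "y \<in> \<Gamma>" by (auto simp: tube_def)
    then show "1 - \<i> * of_real d * cdot z s \<noteq> 0"
      using cutoff_factor_nonzero[OF d, of "y \<bullet> s" "x \<bullet> s"] s by (auto simp: cdot_cvec dual_cone_def)
  qed
  show ?thesis unfolding cutoff_def power2_eq_square
    by (intro holomorphic_vec_on_prod holomorphic_vec_on_mult 1 cutoff_dual)
qed

text \<open>Because of the square in \<open>cutoff\<close>, factor j has modulus 1 / (|u|^2 |w|^2),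
  where |u|^2 |w|^2 is at least (1 + (d a)^2)(1 + (d b)^2), hence at least 1 + d^2 (a^2 + b^2). As a
  - b = 2 r x_j, the sum a^2 + b^2 is at least (r x_j)^2.\<close>

lemma norm_cutoff_le:
  assumes d: "d \<ge> 0" and y: "y \<in> \<Gamma>"
  shows "cmod (cutoff t r d (cvec x y)) \<le> (\<Prod>i\<in>UNIV. 1 / (1 + ((d * r) * x $ i)\<^sup>2))"
  unfolding cutoff_def prod_norm[symmetric]
proof (intro prod_mono conjI)
  fix j
  define a b where "a = x \<bullet> (t + r *\<^sub>R axis j 1)" and "b = x \<bullet> (t - r *\<^sub>R axis j 1)"
  define u w where "u = 1 - \<i> * of_real d * cdot (cvec x y) (t + r *\<^sub>R axis j 1)"
    and "w = 1 - \<i> * of_real d * cdot (cvec x y) (t - r *\<^sub>R axis j 1)"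
  have u: "(cmod u)\<^sup>2 \<ge> 1 + (d * a)\<^sup>2"
    unfolding u_def cdot_cvec a_def by (rule norm_cutoff_factor[OF d]) (use y cutoff_dual in \<open>auto simp: dual_cone_def\<close>)
  have w: "(cmod w)\<^sup>2 \<ge> 1 + (d * b)\<^sup>2"
    unfolding w_def cdot_cvec b_def by (rule norm_cutoff_factor[OF d]) (use y cutoff_dual in \<open>auto simp: dual_cone_def\<close>)
  have ab: "a - b = 2 * (r * x $ j)" by (simp add: a_def b_def inner_simps inner_axis algebra_simps)
  have "(d * (r * x $ j))\<^sup>2 \<le> (d * a)\<^sup>2 + (d * b)\<^sup>2"
  proof -
    have "(2 * (r * x $ j))\<^sup>2 \<le> 2 * (a\<^sup>2 + b\<^sup>2)"
      unfolding ab[symmetric] using zero_le_power2[of "a + b"] by (simp add: power2_eq_square algebra_simps)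
    then have "4 * (r * x $ j)\<^sup>2 \<le> 2 * (a\<^sup>2 + b\<^sup>2)" unfolding power_mult_distrib[of 2] by simp
    then have "(r * x $ j)\<^sup>2 + (r * x $ j)\<^sup>2 \<le> a\<^sup>2 + b\<^sup>2" by simp
    then have "(r * x $ j)\<^sup>2 \<le> a\<^sup>2 + b\<^sup>2" by (rule order_trans[rotated]) simp
    then have "d\<^sup>2 * (r * x $ j)\<^sup>2 \<le> d\<^sup>2 * (a\<^sup>2 + b\<^sup>2)" by (intro mult_left_mono) auto
    then show ?thesis by (simp add: power_mult_distrib algebra_simps)
  qed
  also have "\<dots> \<le> (d * a)\<^sup>2 + (d * b)\<^sup>2 + (d * a)\<^sup>2 * (d * b)\<^sup>2" by simp
  finally have "1 + ((d * r) * x $ j)\<^sup>2 \<le> 1 + ((d * a)\<^sup>2 + (d * b)\<^sup>2 + (d * a)\<^sup>2 * (d * b)\<^sup>2)"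
    by (simp only: mult.assoc add_le_cancel_left)
  also have "\<dots> = (1 + (d * a)\<^sup>2) * (1 + (d * b)\<^sup>2)" by (simp add: algebra_simps)
  also have "\<dots> \<le> (cmod u)\<^sup>2 * (cmod w)\<^sup>2" by (intro mult_mono u w) auto
  finally have "1 / ((cmod u)\<^sup>2 * (cmod w)\<^sup>2) \<le> 1 / (1 + ((d * r) * x $ j)\<^sup>2)"
    by (intro divide_left_mono) (auto intro!: mult_pos_pos add_pos_nonneg less_le_trans[OF _ u] less_le_trans[OF _ w])
  moreover have "cmod ((inverse u * inverse w)\<^sup>2) = 1 / ((cmod u)\<^sup>2 * (cmod w)\<^sup>2)"
    by (simp add: norm_power norm_mult norm_inverse power_mult_distrib power_inverse divide_inverse)
  ultimately show "cmod ((inverse u * inverse w)\<^sup>2) \<le> 1 / (1 + ((d * r) * x $ j)\<^sup>2)" by simp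
qed simp

end

lemma prod_inverse_le_1: "(\<Prod>i\<in>A. 1 / (1 + (f i)\<^sup>2)) \<le> (1::real)"
proof (intro prod_le_1 conjI)
  fix x
  have "1 + (f x)\<^sup>2 > 0" by (simp add: add_pos_nonneg)
  then show "0 \<le> 1 / (1 + (f x)\<^sup>2)" "1 / (1 + (f x)\<^sup>2) \<le> 1" by auto
qed

lemma tendsto_cutoff:
  "((\<lambda>d. cutoff t r d z) \<longlongrightarrow> 1) (at_right 0)"
proof -
  have "((\<lambda>d. cutoff t r d z) \<longlongrightarrow> (\<Prod>j\<in>(UNIV::'a set). (inverse (1 - \<i> * of_real 0 * cdot z (t + r *\<^sub>R axis j 1)) *
     inverse (1 - \<i> * of_real 0 * cdot z (t - r *\<^sub>R axis j 1)))\<^sup>2)) (at_right 0)"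
    unfolding cutoff_def by (intro tendsto_intros) auto
  then show ?thesis by simp
qed

lemma powr_norm_add_le:
  fixes a b :: complex
  assumes "p > 1"
  shows "cmod (a + b) powr p \<le> 2 powr p * (cmod a powr p + cmod b powr p)"
proof -
  have "cmod (a + b) powr p = 2 powr p * cmod ((a + b) / 2) powr p"
    by (simp add: norm_divide powr_divide)
  also have "\<dots> \<le> 2 powr p * (cmod a powr p + cmod b powr p)"
  proof (intro mult_left_mono)
    have "(u + v) / 2 \<le> u + v" if "u \<ge> 0" "v \<ge> 0" for u v :: real using that by simp
    then show "cmod ((a + b) / 2) powr p \<le> cmod a powr p + cmod b powr p"
      by (rule order_trans[OF powr_norm_midpoint_le[OF assms]]) auto
  qed simp
  finally show ?thesis .
qed

text \<open>The error splits into F(z) - F(z + iw), small for a suitable translation w, and (F (1 -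
  \<phi>))(z + iw). The means of the latter are taken over points y + w, so by monotonicity it is
  enough to make the one over w small.\<close>

lemma truncation_approx:
  fixes F :: "complex^'n \<Rightarrow> complex"
  assumes \<Gamma>: "regular_cone \<Gamma>" and hol: "holomorphic_vec_on F (tube \<Gamma>)" and p: "p > 1"
    and M: "M \<ge> 0" "\<And>y. y \<in> \<Gamma> \<Longrightarrow> slice_integral p F y \<le> ennreal M" and \<epsilon>: "\<epsilon> > 0"
  shows "\<exists>w\<in>\<Gamma>. \<exists>c>0. \<exists>\<phi>. holomorphic_vec_on \<phi> (tube \<Gamma>) \<and>
    (\<forall>x. \<forall>y\<in>\<Gamma>. cmod (\<phi> (cvec x y)) \<le> (\<Prod>i\<in>UNIV. 1 / (1 + (c * x $ i)\<^sup>2))) \<and>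
    (\<forall>y\<in>\<Gamma>. slice_integral p (\<lambda>z. F z - F (z + cvec 0 w) * \<phi> (z + cvec 0 w)) y \<le> ennreal \<epsilon>)"
proof -
  have oc: "open_cone \<Gamma>" and op: "open \<Gamma>" and ne: "interior (dual_cone \<Gamma>) \<noteq> {}"
    using \<Gamma> by (auto simp: regular_cone_def open_cone_def)
  obtain t r where tr: "r > 0" "cball t r \<subseteq> dual_cone \<Gamma>" using ne by (meson ex_in_conv mem_interior_cball)
  define \<delta> where "\<delta> = \<epsilon> / (2 * 2 powr p)"
  have \<delta>: "\<delta> > 0" "2 powr p * (\<delta> + \<delta>) = \<epsilon>" using \<epsilon> by (auto simp: \<delta>_def)
  obtain w where w: "w \<in> \<Gamma>" "\<And>y. y \<in> \<Gamma> \<Longrightarrow> slice_integral p (\<lambda>z. F z - F (z + cvec 0 w)) y \<le> ennreal \<delta>"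
    using translate_approx[OF \<Gamma> hol p M \<delta>(1)] by blast
  define D where "D d z = F z * (1 - cutoff t r d z)" for d z
  have holD: "holomorphic_vec_on (D d) (tube \<Gamma>)" if "d \<ge> 0" for d
    unfolding D_def
    by (intro holomorphic_vec_on_mult hol holomorphic_vec_on_diff holomorphic_vec_on_const
      holomorphic_cutoff[OF tr(2,1) that])
  have phi1: "cmod (cutoff t r d (cvec x y)) \<le> 1" if "d \<ge> 0" "y \<in> \<Gamma>" for d x y
    using norm_cutoff_le[OF tr(2,1) that, of x] prod_inverse_le_1[of "\<lambda>i. (d * r) * x $ i" UNIV] by linarith
  have Dle: "cmod (D d (cvec x y)) powr p \<le> 2 powr p * cmod (F (cvec x y)) powr p" if "d \<ge> 0" "y \<in> \<Gamma>" for d x y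
  proof -
    have "cmod (1 - cutoff t r d (cvec x y)) \<le> 2"
      using norm_triangle_ineq4[of 1 "cutoff t r d (cvec x y)"] phi1[OF that, of x] by simp
    then have "cmod (D d (cvec x y)) \<le> cmod (F (cvec x y)) * 2"
      unfolding D_def norm_mult by (intro mult_left_mono) auto
    then have "cmod (D d (cvec x y)) powr p \<le> (cmod (F (cvec x y)) * 2) powr p"
      using p by (intro powr_mono2) auto
    then show ?thesis by (simp add: powr_mult mult.commute)
  qed
  have Dbd: "slice_integral p (D d) y \<le> ennreal (2 powr p * M)" if "d \<ge> 0" "y \<in> \<Gamma>" for d y
  proof -
    note [measurable] = slice_measurable[OF hol that(2)]
    have "slice_integral p (D d) y \<le> (\<integral>\<^sup>+x. ennreal (2 powr p) * ennreal (cmod (F (cvec x y)) powr p) \<partial>lborel)"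
      unfolding slice_integral_def by (intro nn_integral_mono) (use Dle[OF that] in \<open>auto simp flip: ennreal_mult' intro!: ennreal_leI\<close>)
    also have "\<dots> = ennreal (2 powr p) * slice_integral p F y" unfolding slice_integral_def by (simp add: nn_integral_cmult)
    also have "\<dots> \<le> ennreal (2 powr p) * ennreal M" by (intro mult_left_mono M that) auto
    finally show ?thesis by (simp add: ennreal_mult')
  qed
  define s where "s k = inverse (real (Suc k))" for k
  have s: "s k > 0" for k by (simp add: s_def)
  have slim: "filterlim s (at_right 0) sequentially"
  proof -
    have "s \<longlonglongrightarrow> 0" unfolding s_def by (rule LIMSEQ_inverse_real_of_nat)
    moreover have "s k \<noteq> 0" for k using s[of k] by simp
    ultimately show ?thesis using s by (auto simp: filterlim_at intro!: eventuallyI)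
  qed
  \<comment> \<open>Over the fixed point w, the cutoff tends to 1 pointwise as d tends to 0, and 2^p
    |F|^p is an integrable majorant.\<close>
  have "(\<lambda>k. slice_integral p (D (s k)) w) \<longlonglongrightarrow> (\<integral>\<^sup>+x. 0 \<partial>(lborel :: (real^'n) measure))"
    unfolding slice_integral_def
  proof (rule nn_integral_dominated_convergence[where w="\<lambda>x. ennreal (2 powr p * cmod (F (cvec x w)) powr p)"])
    note [measurable] = slice_measurable[OF hol w(1)]
    show "(\<lambda>x. ennreal (cmod (D (s k) (cvec x w)) powr p)) \<in> borel_measurable lborel" for k
      using slice_measurable[OF holD w(1), of "s k"] s[of k] by simp
    show "(\<lambda>x. ennreal (2 powr p * cmod (F (cvec x w)) powr p)) \<in> borel_measurable lborel" by measurable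
    show "AE x in lborel. ennreal (cmod (D (s k) (cvec x w)) powr p) \<le> ennreal (2 powr p * cmod (F (cvec x w)) powr p)" for k
      using Dle[OF less_imp_le[OF s] w(1)] by (intro AE_I2 ennreal_leI) auto
    have "(\<integral>\<^sup>+x. ennreal (2 powr p * cmod (F (cvec x w)) powr p) \<partial>lborel) = ennreal (2 powr p) * slice_integral p F w"
      unfolding slice_integral_def by (simp add: ennreal_mult' nn_integral_cmult)
    also have "\<dots> \<le> ennreal (2 powr p) * ennreal M" by (intro mult_left_mono M w) auto
    also have "\<dots> < \<infinity>" by (simp add: ennreal_mult_less_top)
    finally show "(\<integral>\<^sup>+x. ennreal (2 powr p * cmod (F (cvec x w)) powr p) \<partial>lborel) < \<infinity>" .
    show "AE x in lborel. (\<lambda>k. ennreal (cmod (D (s k) (cvec x w)) powr p)) \<longlonglongrightarrow> 0"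
    proof (rule AE_I2)
      fix x
      have "(\<lambda>k. cutoff t r (s k) (cvec x w)) \<longlonglongrightarrow> 1"
        by (rule filterlim_compose[OF tendsto_cutoff slim])
      then have "(\<lambda>k. cmod (D (s k) (cvec x w)) powr p) \<longlonglongrightarrow> cmod (F (cvec x w) * (1 - 1)) powr p"
        unfolding D_def using p by (intro tendsto_intros) auto
      then have "(\<lambda>k. cmod (D (s k) (cvec x w)) powr p) \<longlonglongrightarrow> 0" using p by simp
      then have "(\<lambda>k. ennreal (cmod (D (s k) (cvec x w)) powr p)) \<longlonglongrightarrow> ennreal 0" by (rule tendsto_ennrealI)
      then show "(\<lambda>k. ennreal (cmod (D (s k) (cvec x w)) powr p)) \<longlonglongrightarrow> 0" by simp
    qed
  qed auto
  then have "(\<lambda>k. slice_integral p (D (s k)) w) \<longlonglongrightarrow> 0" by simp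
  then have "eventually (\<lambda>k. slice_integral p (D (s k)) w < ennreal \<delta>) sequentially"
    using \<delta>(1) by (intro order_tendstoD(2)) auto
  then obtain k where k: "slice_integral p (D (s k)) w < ennreal \<delta>" by (auto simp: eventually_sequentially)
  define d where "d = s k"
  have d: "d > 0" by (simp add: d_def s)
  define \<phi> where "\<phi> = cutoff t r d"
  have hphi: "holomorphic_vec_on \<phi> (tube \<Gamma>)" unfolding \<phi>_def using holomorphic_cutoff[OF tr(2,1)] d by simp
  \<comment> \<open>Smallness over w spreads to w + y for all y in \<Gamma>; this gives uniformity
    up to the boundary.\<close>
  have Dw: "slice_integral p (D d) (y + w) \<le> ennreal \<delta>" if y: "y \<in> \<Gamma>" for y
  proof -
    have "slice_integral p (D d) (w + y) \<le> slice_integral p (D d) w"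
      by (rule slice_integral_antimono[OF \<Gamma> holD _ _ Dbd w(1) y]) (use d p M in auto)
    then show ?thesis using k by (simp add: d_def add.commute)
  qed
  have "slice_integral p (\<lambda>z. F z - F (z + cvec 0 w) * \<phi> (z + cvec 0 w)) y \<le> ennreal \<epsilon>" if y: "y \<in> \<Gamma>" for y
  proof -
    have yw: "y + w \<in> \<Gamma>" by (rule open_cone_add[OF oc y w(1)])
    have dd: "d \<ge> 0" using d by simp
    note [measurable] = slice_measurable[OF hol y] slice_measurable[OF holD[OF dd] yw]
      slice_measurable[OF hol yw]
    have "slice_integral p (\<lambda>z. F z - F (z + cvec 0 w) * \<phi> (z + cvec 0 w)) y
      \<le> (\<integral>\<^sup>+x. ennreal (2 powr p) * (ennreal (cmod (F (cvec x y) - F (cvec x (y + w))) powr p) + ennreal (cmod (D d (cvec x (y + w))) powr p)) \<partial>lborel)"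
      unfolding slice_integral_def
    proof (rule nn_integral_mono)
      fix x
      have eq: "F (cvec x y) - F (cvec x y + cvec 0 w) * \<phi> (cvec x y + cvec 0 w)
        = (F (cvec x y) - F (cvec x (y + w))) + D d (cvec x (y + w))"
        unfolding D_def \<phi>_def cvec_add_imag by (simp add: algebra_simps)
      show "ennreal (cmod (F (cvec x y) - F (cvec x y + cvec 0 w) * \<phi> (cvec x y + cvec 0 w)) powr p)
        \<le> ennreal (2 powr p) * (ennreal (cmod (F (cvec x y) - F (cvec x (y + w))) powr p) + ennreal (cmod (D d (cvec x (y + w))) powr p))"
        unfolding eq
        using powr_norm_add_le[OF p, of "F (cvec x y) - F (cvec x (y + w))" "D d (cvec x (y + w))"]
        by (simp add: ennreal_mult'[symmetric] ennreal_plus[symmetric] ennreal_leI del: ennreal_plus)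
    qed
    also have "\<dots> = ennreal (2 powr p) * (slice_integral p (\<lambda>z. F z - F (z + cvec 0 w)) y + slice_integral p (D d) (y + w))"
      unfolding slice_integral_def cvec_add_imag by (simp add: nn_integral_cmult nn_integral_add)
    also have "\<dots> \<le> ennreal (2 powr p) * (ennreal \<delta> + ennreal \<delta>)"
      by (intro mult_left_mono add_mono w Dw y) auto
    also have "\<dots> = ennreal \<epsilon>"
      unfolding \<delta>(2)[symmetric] using \<delta>(1) by (simp add: ennreal_mult' ennreal_plus[symmetric] del: ennreal_plus)
    finally show ?thesis .
  qed
  moreover have "cmod (\<phi> (cvec x y)) \<le> (\<Prod>i\<in>UNIV. 1 / (1 + ((d * r) * x $ i)\<^sup>2))" if "y \<in> \<Gamma>" for x y
    unfolding \<phi>_def using norm_cutoff_le[OF tr(2,1) _ that, of d x] d by simp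
  moreover have "d * r > 0" using d tr by simp
  ultimately show ?thesis using w(1) hphi by blast
qed

subsection \<open>Boundary behaviour of the kernel\<close>

text \<open>A ray of the dual cone orthogonal to \<open>\<beta>\<close> carries arbitrarily many disjoint balls on which
  the exponential stays bounded below as \<open>y \<rightarrow> \<beta>\<close>.\<close>

lemma diag_kernel_frontier:
  fixes \<Gamma> :: "(real^'n) set"
  assumes \<Gamma>: "regular_cone \<Gamma>" and \<beta>: "\<beta> \<in> frontier \<Gamma>"
  shows "filterlim (diag_kernel \<Gamma>) at_top (at \<beta> within \<Gamma>)"
proof -
  have oc: "open_cone \<Gamma>" and op: "open \<Gamma>" and ne: "interior (dual_cone \<Gamma>) \<noteq> {}"
    using \<Gamma> by (auto simp: regular_cone_def open_cone_def)
  have "\<beta> \<notin> \<Gamma>" and \<beta>c: "\<beta> \<in> closure \<Gamma>"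
    using \<beta> op by (auto simp: frontier_def interior_open)
  then obtain t0 where t0: "t0 \<in> dual_cone \<Gamma>" "t0 \<noteq> 0" "\<beta> \<bullet> t0 \<le> 0"
    using open_cone_separation[OF oc] by blast
  have "\<beta> \<bullet> t0 \<ge> 0"
  proof -
    have "closure \<Gamma> \<subseteq> {x. x \<bullet> t0 \<ge> 0}"
      using t0(1) by (intro closure_minimal) (auto simp: dual_cone_def inner_commute[of _ t0] closed_halfspace_ge)
    then show ?thesis using \<beta>c by auto
  qed
  then have \<beta>0: "\<beta> \<bullet> t0 = 0" using t0(3) by simp
  obtain t r where tr: "r > 0" "cball t r \<subseteq> dual_cone \<Gamma>" using ne by (meson ex_in_conv mem_interior_cball)
  \<comment> \<open>The centres t + m L t0 are spaced by 3 r, more than two radii, so the balls are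
    disjoint.\<close>
  define L where "L = 3 * r / norm t0"
  have L: "L > 0" using tr t0 by (simp add: L_def)
  define B where "B m = ball (t + (real m * L) *\<^sub>R t0) r" for m
  have Bdual: "B m \<subseteq> dual_cone \<Gamma>" for m
  proof
    fix u assume "u \<in> B m"
    then have "u - (real m * L) *\<^sub>R t0 \<in> cball t r" by (simp add: B_def dist_norm algebra_simps)
    then have "u - (real m * L) *\<^sub>R t0 \<in> dual_cone \<Gamma>" using tr by blast
    then have "(u - (real m * L) *\<^sub>R t0) + (real m * L) *\<^sub>R t0 \<in> dual_cone \<Gamma>"
      using t0 L by (intro dual_cone_add dual_cone_scale) auto
    then show "u \<in> dual_cone \<Gamma>" by simp
  qed
  have Bm[measurable]: "B m \<in> sets borel" for m by (simp add: B_def)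
  have disj: "disjoint_family B"
    unfolding disjoint_family_on_def
  proof (intro ballI impI, rule ccontr)
    fix m k :: nat assume "m \<noteq> k" "\<not> B m \<inter> B k = {}"
    then obtain u where u: "dist (t + (real m * L) *\<^sub>R t0) u < r" "dist (t + (real k * L) *\<^sub>R t0) u < r"
      by (auto simp: B_def)
    have "dist (t + (real m * L) *\<^sub>R t0) (t + (real k * L) *\<^sub>R t0) < r + r"
      using u by (meson add_strict_mono dist_triangle2 le_less_trans)
    moreover have "dist (t + (real m * L) *\<^sub>R t0) (t + (real k * L) *\<^sub>R t0) = \<bar>real m - real k\<bar> * L * norm t0"
    proof -
      have "(t + (real m * L) *\<^sub>R t0) - (t + (real k * L) *\<^sub>R t0) = ((real m - real k) * L) *\<^sub>R t0"
        by (simp add: algebra_simps)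
      then show ?thesis using L by (simp add: dist_norm abs_mult)
    qed
    moreover have "L * norm t0 = 3 * r" using t0 by (simp add: L_def)
    moreover have "1 * (3 * r) \<le> \<bar>real m - real k\<bar> * (3 * r)" using \<open>m \<noteq> k\<close> tr by (intro mult_right_mono) auto
    ultimately show False using tr by (simp add: mult.assoc)
  qed
  define \<mu> where "\<mu> = measure lborel (ball t r)"
  have \<mu>: "emeasure lborel (B m) = ennreal \<mu>" for m
    unfolding \<mu>_def B_def
    by (simp add: emeasure_ball content_ball tr less_imp_le)
  have \<mu>pos: "\<mu> > 0" unfolding \<mu>_def using tr by (simp add: content_ball_pos)
  \<comment> \<open>For u in one of the first N balls, the part of u in the ball about t contributes
    at most (|\<beta>| + 1)(|t| + r) to \<open>y \<bullet> u\<close>. The part along t0 contributes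
    at most 1 once y is close enough to \<beta>, depending on N.\<close>
  define c where "c = exp (- (4 * pi * ((norm \<beta> + 1) * (norm t + r) + 1)))"
  have cpos: "c > 0" by (simp add: c_def)
  have low: "diag_kernel \<Gamma> y \<ge> real N * (c * \<mu>)"
    if y: "y \<in> \<Gamma>" "norm y \<le> norm \<beta> + 1" "real N * L * (y \<bullet> t0) \<le> 1" for y N
  proof -
    have yt0: "y \<bullet> t0 \<ge> 0" using y t0 by (auto simp: dual_cone_def)
    have pt: "c \<le> exp (- (4 * pi * (y \<bullet> u)))" if m: "m < N" and u: "u \<in> B m" for m u
    proof -
      define u' where "u' = u - (real m * L) *\<^sub>R t0"
      have "norm (u' - t) < r" using u by (simp add: u'_def B_def dist_norm norm_minus_commute algebra_simps)
      then have "norm u' \<le> norm t + r" using norm_triangle_ineq2[of u' t] by linarith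
      then have "y \<bullet> u' \<le> (norm \<beta> + 1) * (norm t + r)"
        using norm_cauchy_schwarz[of y u'] y(2) by (meson mult_mono norm_ge_zero order_trans add_nonneg_nonneg zero_le_one)
      moreover have "real m * L * (y \<bullet> t0) \<le> real N * L * (y \<bullet> t0)"
        using m L yt0 by (intro mult_right_mono) auto
      moreover have "y \<bullet> u = y \<bullet> u' + real m * L * (y \<bullet> t0)" by (simp add: u'_def inner_simps)
      ultimately have "y \<bullet> u \<le> (norm \<beta> + 1) * (norm t + r) + 1" using y(3) by linarith
      then show ?thesis unfolding c_def by (simp add: mult_left_mono)
    qed
    have "ennreal (real N * (c * \<mu>)) = (\<Sum>m<N. ennreal c * emeasure lborel (B m))"
      using cpos \<mu>pos by (simp add: \<mu> ennreal_mult ennreal_of_nat_eq_real_of_nat)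
    also have "\<dots> = (\<Sum>m<N. (\<integral>\<^sup>+u. ennreal c * indicator (B m) u \<partial>lborel))"
      by (simp add: nn_integral_cmult_indicator)
    also have "\<dots> = (\<integral>\<^sup>+u. (\<Sum>m<N. ennreal c * indicator (B m) u) \<partial>lborel)"
      by (subst nn_integral_sum) auto
    also have "\<dots> \<le> (\<integral>\<^sup>+u. ennreal (exp (- (4 * pi * (y \<bullet> u)))) * indicator (dual_cone \<Gamma>) u \<partial>lborel)"
    proof (rule nn_integral_mono)
      fix u
      show "(\<Sum>m<N. ennreal c * indicator (B m) u) \<le> ennreal (exp (- (4 * pi * (y \<bullet> u)))) * indicator (dual_cone \<Gamma>) u"
      proof (cases "\<exists>m<N. u \<in> B m")
        case True
        then obtain m where m: "m < N" "u \<in> B m" by blast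
        have "(\<Sum>k<N. ennreal c * indicator (B k) u) = (\<Sum>k<N. if k = m then ennreal c else 0)"
          using disj m by (intro sum.cong) (auto simp: disjoint_family_on_def indicator_def)
        also have "\<dots> = ennreal c" using m by simp
        also have "\<dots> \<le> ennreal (exp (- (4 * pi * (y \<bullet> u))))" by (intro ennreal_leI pt[OF m])
        finally show ?thesis using Bdual[of m] m by (auto simp: indicator_def)
      qed (auto simp: indicator_def)
    qed
    also have "\<dots> = ennreal (diag_kernel \<Gamma> y)" by (rule nn_integral_diag_kernel[OF op y(1)])
    finally show ?thesis by (subst (asm) ennreal_le_iff) (auto simp: diag_kernel_nonneg)
  qed
  show ?thesis unfolding filterlim_at_top
  proof
    fix Z :: real
    define N where "N = nat \<lceil>Z / (c * \<mu>)\<rceil>"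
    have N: "real N * (c * \<mu>) \<ge> Z"
    proof -
      have "Z / (c * \<mu>) \<le> real N" unfolding N_def by linarith
      then show ?thesis using cpos \<mu>pos by (simp add: pos_divide_le_eq)
    qed
    have "((\<lambda>y. norm y) \<longlongrightarrow> norm \<beta>) (at \<beta> within \<Gamma>)" by (intro tendsto_intros)
    then have 1: "eventually (\<lambda>y. norm y < norm \<beta> + 1) (at \<beta> within \<Gamma>)" by (rule order_tendstoD) simp
    have "((\<lambda>y. real N * L * (y \<bullet> t0)) \<longlongrightarrow> real N * L * (\<beta> \<bullet> t0)) (at \<beta> within \<Gamma>)" by (intro tendsto_intros)
    then have 2: "eventually (\<lambda>y. real N * L * (y \<bullet> t0) < 1) (at \<beta> within \<Gamma>)"
      by (rule order_tendstoD) (simp add: \<beta>0)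
    have 3: "eventually (\<lambda>y. y \<in> \<Gamma>) (at \<beta> within \<Gamma>)" by (simp add: eventually_at_filter)
    from 1 2 3 show "eventually (\<lambda>y. Z \<le> diag_kernel \<Gamma> y) (at \<beta> within \<Gamma>)"
    proof eventually_elim
      case (elim y)
      then show ?case using low[of y N] N by simp
    qed
  qed
qed

text \<open>On the interior of the dual cone, \<open>y \<bullet> t\<close> is at least a multiple of \<open>|y|\<close>, so the integrand
  tends to 0 almost everywhere.\<close>

lemma regular_cone_kernel_vanishes:
  fixes \<Gamma> :: "(real^'n) set"
  assumes \<Gamma>: "regular_cone \<Gamma>"
  shows "kernel_vanishes_at_infinity \<Gamma>"
  unfolding kernel_vanishes_at_infinity_def
proof (intro ballI allI)
  fix y' x assume y': "y' \<in> \<Gamma>"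
  have oc: "open_cone \<Gamma>" and op: "open \<Gamma>" using \<Gamma> by (auto simp: regular_cone_def open_cone_def)
  \<comment> \<open>A closed inequality passes from y' + \<Gamma> to its closure. With r = 0 it
    gives domination by the integrand at y', with r > 0 divergence of the exponent.\<close>
  have shift: "(y - y') \<bullet> t \<ge> r * norm (y - y')"
    if "y \<in> closure ((+) y' ` \<Gamma>)" "\<And>z. z \<in> \<Gamma> \<Longrightarrow> z \<bullet> t \<ge> r * norm z" for y t r
  proof -
    have "closure ((+) y' ` \<Gamma>) \<subseteq> {y. r * norm (y - y') \<le> (y - y') \<bullet> t}"
      using that(2) by (intro closure_minimal closed_Collect_le continuous_intros) auto
    then show ?thesis using that(1) by auto
  qed
  have "eventually (\<lambda>y. diag_kernel \<Gamma> y < e) (inf at_infinity (principal (closure ((+) y' ` \<Gamma>))))" if e: "e > 0" for e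
  \<comment> \<open>Negation produces a sequence, to which dominated convergence applies.\<close>
  proof (rule ccontr)
    assume "\<not> ?thesis"
    then have "\<not> (\<exists>b. \<forall>y. norm y \<ge> b \<longrightarrow> y \<in> closure ((+) y' ` \<Gamma>) \<longrightarrow> diag_kernel \<Gamma> y < e)"
      by (simp add: eventually_inf_principal eventually_at_infinity)
    then have "\<forall>k. \<exists>y. norm y \<ge> real k \<and> y \<in> closure ((+) y' ` \<Gamma>) \<and> diag_kernel \<Gamma> y \<ge> e"
      by (meson not_le)
    then obtain Y where Y: "\<And>k. norm (Y k) \<ge> real k" "\<And>k. Y k \<in> closure ((+) y' ` \<Gamma>)" "\<And>k. diag_kernel \<Gamma> (Y k) \<ge> e"
      by metis
    have mono: "(Y k) \<bullet> t \<ge> y' \<bullet> t" if "t \<in> dual_cone \<Gamma>" for t k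
      using shift[OF Y(2)[of k], of 0 t] that by (auto simp: dual_cone_def inner_diff_left)
    have Yinf: "filterlim (\<lambda>k. norm (Y k - y')) at_top sequentially"
    proof (rule filterlim_at_top_mono)
      show "filterlim (\<lambda>k. real k - norm y') at_top sequentially"
        using filterlim_tendsto_add_at_top[OF tendsto_const[of "- norm y'"] filterlim_real_sequentially] by simp
      show "eventually (\<lambda>k. real k - norm y' \<le> norm (Y k - y')) sequentially"
        using Y(1) norm_triangle_ineq2[of "Y _" y'] by (intro always_eventually allI) (smt (verit))
    qed
    have "(\<lambda>k. diag_kernel \<Gamma> (Y k)) \<longlonglongrightarrow> (LINT t|(lborel :: (real^'n) measure). 0)"
      unfolding diag_kernel_def set_lebesgue_integral_def
    proof (rule integral_dominated_convergence)
      show "integrable lborel (\<lambda>t. indicator (dual_cone \<Gamma>) t *\<^sub>R exp (- (4 * pi * (y' \<bullet> t))))"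
        using integrable_diag_kernel[OF op y'] by (simp add: set_integrable_def)
      show "AE t in lborel. norm (indicator (dual_cone \<Gamma>) t *\<^sub>R exp (- (4 * pi * (Y k \<bullet> t))))
          \<le> indicator (dual_cone \<Gamma>) t *\<^sub>R exp (- (4 * pi * (y' \<bullet> t)))" for k
        using mono by (intro AE_I2) (auto simp: indicator_def)
      \<comment> \<open>The dual cone is convex, so its boundary is a null set and almost every t in
        it is interior.\<close>
      have "frontier (dual_cone \<Gamma>) \<in> null_sets lborel"
      proof -
        have "frontier (dual_cone \<Gamma>) \<in> null_sets lebesgue"
          using negligible_convex_frontier[OF convex_dual_cone] by (simp add: negligible_iff_null_sets)
        then show ?thesis
          by (metis frontier_closed borel_closed null_sets_completion_iff sets_lborel)
      qed
      then have "AE t in lborel. t \<notin> frontier (dual_cone \<Gamma>)" by (rule AE_not_in)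
      then show "AE t in lborel. (\<lambda>k. indicator (dual_cone \<Gamma>) t *\<^sub>R exp (- (4 * pi * (Y k \<bullet> t)))) \<longlonglongrightarrow> 0"
      proof eventually_elim
        case (elim t)
        show ?case
        proof (cases "t \<in> dual_cone \<Gamma>")
          case True
          then have "t \<in> interior (dual_cone \<Gamma>)"
            using elim closure_subset[of "dual_cone \<Gamma>"] by (auto simp: frontier_def)
          then obtain r where r: "r > 0" "\<And>z. z \<in> \<Gamma> \<Longrightarrow> z \<bullet> t \<ge> r * norm z"
            using interior_dual_inner_ge by blast
          have "filterlim (\<lambda>k. (4 * pi * r) * norm (Y k - y')) at_top sequentially"
            using r by (intro filterlim_tendsto_pos_mult_at_top[OF tendsto_const _ Yinf]) auto
          then have "filterlim (\<lambda>k. (4 * pi * (y' \<bullet> t)) + (4 * pi * r) * norm (Y k - y')) at_top sequentially"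
            by (rule filterlim_tendsto_add_at_top[OF tendsto_const])
          moreover have "(4 * pi * (y' \<bullet> t)) + (4 * pi * r) * norm (Y k - y') \<le> 4 * pi * (Y k \<bullet> t)" for k
          proof -
            have "4 * pi * (r * norm (Y k - y')) \<le> 4 * pi * ((Y k - y') \<bullet> t)"
              using shift[OF Y(2)[of k] r(2)] by (intro mult_left_mono) auto
            then show ?thesis by (simp add: inner_diff_left algebra_simps)
          qed
          ultimately have "filterlim (\<lambda>k. 4 * pi * (Y k \<bullet> t)) at_top sequentially"
            by (rule filterlim_at_top_mono[OF _ always_eventually[OF allI]])
          then have "(\<lambda>k. exp (- (4 * pi * (Y k \<bullet> t)))) \<longlonglongrightarrow> 0"
            by (intro filterlim_compose[OF exp_at_bot]) (simp add: filterlim_uminus_at_bot)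
          then show ?thesis using True by simp
        qed simp
      qed
    qed auto
    then have "(\<lambda>k. diag_kernel \<Gamma> (Y k)) \<longlonglongrightarrow> 0" by simp
    then have "eventually (\<lambda>k. diag_kernel \<Gamma> (Y k) < e) sequentially" using e by (rule order_tendstoD)
    then show False using Y(3) by (auto simp: eventually_sequentially not_le[symmetric])
  qed
  then have "(diag_kernel \<Gamma> \<longlongrightarrow> 0) (inf at_infinity (principal (closure ((+) y' ` \<Gamma>))))"
    using diag_kernel_nonneg[of \<Gamma>] by (intro order_tendstoI) (auto intro!: always_eventually elim: less_le_trans)
  then show "((\<lambda>y. cauchy_szego \<Gamma> (cvec x y) (cvec x y)) \<longlongrightarrow> 0) (inf at_infinity (principal (closure ((+) y' ` \<Gamma>))))"
    unfolding cauchy_szego_diag using tendsto_of_real_iff[of "diag_kernel \<Gamma>" 0, where 'a=complex] by simp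
qed

text \<open>After undoing the rotation, N measures the distance to the axis. N is sublinear, which
  gives the cone property; Cauchy-Schwarz off the axis produces interior points of the dual.\<close>

lemma circular_cone_regular:
  fixes \<Gamma> :: "(real^'n) set"
  assumes "circular_cone \<Gamma>"
  shows "regular_cone \<Gamma>"
proof -
  obtain k \<kappa> Q where \<kappa>: "\<kappa> > 0" and Q: "rotation_matrix Q"
    and \<Gamma>: "\<Gamma> = (\<lambda>y. Q *v y) ` {y. sqrt (\<Sum>j\<in>UNIV - {k}. \<bar>y $ j\<bar>\<^sup>2) < \<kappa> * y $ k}"
    using assms unfolding circular_cone_def by blast
  define N where "N y = L2_set (\<lambda>j. y $ j) (UNIV - {k})" for y :: "real^'n"
  have N: "N y = sqrt (\<Sum>j\<in>UNIV - {k}. \<bar>y $ j\<bar>\<^sup>2)" for y by (simp add: N_def L2_set_def)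
  have Nnn: "N y \<ge> 0" for y by (simp add: N_def L2_set_nonneg)
  have Nadd: "N (x + y) \<le> N x + N y" for x y
    using L2_set_triangle_ineq[of "\<lambda>j. x $ j" "\<lambda>j. y $ j" "UNIV - {k}"]
    by (simp only: N_def vector_add_component)
  have Nscale: "N (a *\<^sub>R x) = a * N x" if "a \<ge> 0" for a x
    using L2_set_right_distrib[OF that, of "\<lambda>j. x $ j" "UNIV - {k}"]
    by (simp only: N_def vector_scaleR_component real_scaleR_def)
  have cN: "continuous_on UNIV N" unfolding N by (intro continuous_intros)
  have orth: "Q ** transpose Q = mat 1" "transpose Q ** Q = mat 1"
    using Q by (auto simp: rotation_matrix_def orthogonal_matrix_def)
  have QQ: "Q *v (transpose Q *v y) = y" "transpose Q *v (Q *v y) = y" for y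
    by (simp_all only: matrix_vector_mul_assoc orth matrix_vector_mul_lid)
  have mem: "y \<in> \<Gamma> \<longleftrightarrow> N (transpose Q *v y) < \<kappa> * (transpose Q *v y) $ k" for y
    unfolding \<Gamma> N[symmetric]
  proof
    assume "N (transpose Q *v y) < \<kappa> * (transpose Q *v y) $ k"
    then show "y \<in> (\<lambda>y. Q *v y) ` {y. N y < \<kappa> * y $ k}"
      by (intro image_eqI[of _ _ "transpose Q *v y"]) (simp_all only: QQ mem_Collect_eq)
  qed (auto simp: QQ simp del: transpose_matrix_vector)
  have cT: "continuous_on UNIV (\<lambda>y. transpose Q *v y)"
    by (simp add: linear_continuous_on linear_linear del: transpose_matrix_vector)
  have inner: "y \<bullet> t = (transpose Q *v y) \<bullet> (transpose Q *v t)" for y t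
  proof -
    have "(transpose Q *v y) \<bullet> (transpose Q *v t) = y \<bullet> (Q *v (transpose Q *v t))"
      using dot_lmul_matrix[of y Q "transpose Q *v t"] by simp
    then show ?thesis by (simp only: QQ)
  qed
  have "open_cone \<Gamma>" unfolding open_cone_def
  proof (intro conjI ballI allI impI)
    have "\<Gamma> = {y. N (transpose Q *v y) < \<kappa> * (transpose Q *v y) $ k}" using mem by blast
    also have "open \<dots>"
      by (intro open_Collect_less continuous_intros continuous_on_compose2[OF cN cT] cT) auto
    finally show "open \<Gamma>" .
    have "Q *v axis k 1 \<in> \<Gamma>" unfolding mem QQ using \<kappa> by (simp add: N axis_def)
    then show "\<Gamma> \<noteq> {}" by blast
    show "0 \<notin> \<Gamma>" unfolding mem by (simp add: N)
    fix x y and a b :: real assume xy: "x \<in> \<Gamma>" "y \<in> \<Gamma>" "a > 0" "b > 0"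
    define x' y' where "x' = transpose Q *v x" and "y' = transpose Q *v y"
    have "N (a *\<^sub>R x' + b *\<^sub>R y') \<le> a * N x' + b * N y'"
      using Nadd[of "a *\<^sub>R x'" "b *\<^sub>R y'"] xy by (simp add: Nscale)
    also have "\<dots> < a * (\<kappa> * x' $ k) + b * (\<kappa> * y' $ k)"
      using xy unfolding mem x'_def y'_def by (intro add_strict_mono mult_strict_left_mono)
    also have "\<dots> = \<kappa> * (a *\<^sub>R x' + b *\<^sub>R y') $ k" by (simp add: algebra_simps)
    finally show "a *\<^sub>R x + b *\<^sub>R y \<in> \<Gamma>"
      unfolding mem x'_def y'_def by (simp add: matrix_vector_right_distrib matrix_vector_mult_scaleR del: transpose_matrix_vector)
  qed
  moreover have "interior (dual_cone \<Gamma>) \<noteq> {}"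
  proof -
    \<comment> \<open>The circular cone about the same axis with reciprocal aperture 1/\<kappa>. It
      is open, contains the axis and lies in the dual.\<close>
    define U where "U = {t. \<kappa> * N (transpose Q *v t) < (transpose Q *v t) $ k}"
    have "open U" unfolding U_def
      by (intro open_Collect_less continuous_intros continuous_on_compose2[OF cN cT] cT) auto
    moreover have "Q *v axis k 1 \<in> U" unfolding U_def mem_Collect_eq QQ by (simp add: N axis_def)
    moreover have "U \<subseteq> dual_cone \<Gamma>" unfolding dual_cone_def
    proof (intro subsetI CollectI ballI)
      fix t y assume t: "t \<in> U" and y: "y \<in> \<Gamma>"
      define t' y' where "t' = transpose Q *v t" and "y' = transpose Q *v y"
      have t': "\<kappa> * N t' < t' $ k" using t by (simp add: U_def t'_def del: transpose_matrix_vector)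
      have y': "N y' < \<kappa> * y' $ k" using y unfolding mem y'_def .
      have "0 < \<kappa> * y' $ k" using y' Nnn[of y'] by linarith
      then have yk: "y' $ k > 0" using \<kappa> by (simp add: zero_less_mult_iff)
      have "y' \<bullet> t' = y' $ k * t' $ k + (\<Sum>j\<in>UNIV - {k}. y' $ j * t' $ j)"
        by (simp add: inner_vec_def sum.remove[of UNIV k])
      moreover have "\<bar>\<Sum>j\<in>UNIV - {k}. y' $ j * t' $ j\<bar> \<le> N y' * N t'"
      proof -
        have "\<bar>\<Sum>j\<in>UNIV - {k}. y' $ j * t' $ j\<bar> \<le> (\<Sum>j\<in>UNIV - {k}. \<bar>y' $ j\<bar> * \<bar>t' $ j\<bar>)"
          by (rule order_trans[OF sum_abs]) (simp add: abs_mult)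
        also have "\<dots> \<le> N y' * N t'" unfolding N_def by (rule L2_set_mult_ineq)
        finally show ?thesis .
      qed
      moreover have "N y' * N t' \<le> (\<kappa> * y' $ k) * N t'" using y' Nnn by (intro mult_right_mono) auto
      moreover have "y' $ k * (\<kappa> * N t') \<le> y' $ k * t' $ k" using t' yk by (intro mult_left_mono) auto
      ultimately have "y' \<bullet> t' \<ge> 0" by (simp add: algebra_simps)
      then show "0 \<le> y \<bullet> t" unfolding inner[of y t] t'_def y'_def .
    qed
    ultimately show ?thesis by (metis empty_iff interior_maximal subsetD)
  qed
  ultimately show ?thesis by (simp add: regular_cone_def)
qed

subsection \<open>The theorem\<close>

lemma pointwise_bound_root:
  fixes F :: "complex^'n \<Rightarrow> complex"
  assumes \<Gamma>: "regular_cone \<Gamma>" and hol: "holomorphic_vec_on F (tube \<Gamma>)" and p: "p \<ge> 1"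
    and M: "M \<ge> 0" "\<And>y. y \<in> \<Gamma> \<Longrightarrow> slice_integral p F y \<le> ennreal M"
    and y: "y \<in> \<Gamma>"
  shows "cmod (F (cvec x y)) \<le> (exp (4 * pi) * 2 ^ CARD('n) * real CARD('n) ^ (2 * CARD('n)) * M) powr (1 / p) * diag_kernel \<Gamma> y powr (1 / p)"
proof -
  have "cmod (F (cvec x y)) powr p \<le> (exp (4 * pi) * 2 ^ CARD('n) * real CARD('n) ^ (2 * CARD('n))) * M * diag_kernel \<Gamma> y"
    by (rule pointwise_bound[OF \<Gamma> hol p M(1) M(2)[unfolded slice_integral_def] y])
  then have "(cmod (F (cvec x y)) powr p) powr (1/p) \<le> ((exp (4 * pi) * 2 ^ CARD('n) * real CARD('n) ^ (2 * CARD('n))) * M * diag_kernel \<Gamma> y) powr (1/p)"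
    using p by (intro powr_mono2) auto
  then show ?thesis using p M(1) by (simp add: powr_powr powr_mult diag_kernel_nonneg)
qed

lemma sum_le_prod_1_plus:
  fixes f :: "'a \<Rightarrow> real"
  assumes "finite A" "\<And>i. i \<in> A \<Longrightarrow> f i \<ge> 0"
  shows "1 + (\<Sum>i\<in>A. f i) \<le> (\<Prod>i\<in>A. 1 + f i)"
  using assms
proof (induction rule: finite_induct)
  case (insert a A)
  have "1 + (\<Sum>i\<in>insert a A. f i) \<le> (1 + f a) * (1 + (\<Sum>i\<in>A. f i))"
    using insert by (simp add: algebra_simps sum_nonneg)
  also have "\<dots> \<le> (1 + f a) * (\<Prod>i\<in>A. 1 + f i)"
    using insert by (intro mult_left_mono) auto
  finally show ?case using insert by simp
qed simp

text \<open>Expanding the product of the 1 + (c x_i)^2 and keeping only the constant and quadratic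
  terms leaves 1 + (c |x|)^2. This turns coordinatewise decay into decay in |x|.\<close>

lemma prod_inverse_le_norm:
  fixes x :: "real^'n"
  assumes "c > 0"
  shows "(\<Prod>i\<in>UNIV. 1 / (1 + (c * x $ i)\<^sup>2)) \<le> 1 / (1 + (c * norm x)\<^sup>2)"
proof -
  have "1 + (c * norm x)\<^sup>2 = 1 + (\<Sum>i\<in>UNIV. (c * x $ i)\<^sup>2)"
    by (simp add: power_mult_distrib norm_vec_def L2_set_def sum_nonneg sum_distrib_left)
  also have "\<dots> \<le> (\<Prod>i\<in>UNIV. 1 + (c * x $ i)\<^sup>2)" by (rule sum_le_prod_1_plus) auto
  finally have "1 + (c * norm x)\<^sup>2 \<le> (\<Prod>i\<in>UNIV. 1 + (c * x $ i)\<^sup>2)" .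
  moreover have "1 + (c * norm x)\<^sup>2 > 0" by (simp add: add_pos_nonneg)
  ultimately have "1 / (\<Prod>i\<in>UNIV. 1 + (c * x $ i)\<^sup>2) \<le> 1 / (1 + (c * norm x)\<^sup>2)"
    by (intro divide_left_mono) (auto intro: mult_pos_pos)
  then show ?thesis by (simp add: prod_dividef)
qed

lemma kernel_quotient_eq: "kernel_quotient \<Gamma> p F x y = cmod (F (cvec x y)) / diag_kernel \<Gamma> y powr (1 / p)"
  by (simp add: kernel_quotient_def cauchy_szego_diag)

text \<open>The approximant \<open>G(z) = F(z + iw) \<phi>(z + iw)\<close> belongs to \<open>H\<^sup>1\<close> as well, hence the factor
  \<open>K(z + iw)\<close> in the first bound. The second bound gives the decay in \<open>x\<close>.\<close>

lemma kernel_quotient_bounds: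
  fixes F :: "complex^'n \<Rightarrow> complex"
  assumes \<Gamma>: "regular_cone \<Gamma>" and F: "F \<in> hardy_space p \<Gamma>" and p: "p > 1" and \<eta>: "\<eta> > 0"
  shows "\<exists>w\<in>\<Gamma>. \<exists>c>0. \<exists>B\<ge>0. \<forall>x. \<forall>y\<in>\<Gamma>.
    kernel_quotient \<Gamma> p F x y \<le> \<eta> + B * diag_kernel \<Gamma> (y + w) / diag_kernel \<Gamma> y powr (1 / p) \<and>
    kernel_quotient \<Gamma> p F x y \<le> \<eta> + B / (1 + (c * norm x)\<^sup>2)"
proof -
  have oc: "open_cone \<Gamma>" using \<Gamma> by (simp add: regular_cone_def)
  define A where "A = exp (4 * pi) * 2 ^ CARD('n) * real CARD('n) ^ (2 * CARD('n))"
  have A: "A > 0" by (simp add: A_def)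
  have hol: "holomorphic_vec_on F (tube \<Gamma>)" and fin: "(SUP y\<in>\<Gamma>. slice_integral p F y) < \<infinity>"
    using F by (auto simp: hardy_space_def slice_integral_def)
  obtain M where M: "(SUP y\<in>\<Gamma>. slice_integral p F y) = ennreal M" "M \<ge> 0"
    using fin by (cases "SUP y\<in>\<Gamma>. slice_integral p F y") auto
  have lM: "slice_integral p F y \<le> ennreal M" if "y \<in> \<Gamma>" for y
    unfolding M(1)[symmetric] using that by (rule SUP_upper)
  \<comment> \<open>Chosen so that the pointwise bound converts an error \<epsilon> in the integral
    means into an error \<eta> in the quotient.\<close>
  define \<epsilon> where "\<epsilon> = \<eta> powr p / A"
  have \<epsilon>: "\<epsilon> > 0" using \<eta> A by (simp add: \<epsilon>_def)
  have A\<epsilon>: "(A * \<epsilon>) powr (1 / p) = \<eta>" using A \<eta> p by (simp add: \<epsilon>_def powr_powr)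
  obtain w c \<phi> where w: "w \<in> \<Gamma>" and c: "c > 0" and hphi: "holomorphic_vec_on \<phi> (tube \<Gamma>)"
    and phi: "\<And>x y. y \<in> \<Gamma> \<Longrightarrow> cmod (\<phi> (cvec x y)) \<le> (\<Prod>i\<in>UNIV. 1 / (1 + (c * x $ i)\<^sup>2))"
    and app: "\<And>y. y \<in> \<Gamma> \<Longrightarrow> slice_integral p (\<lambda>z. F z - F (z + cvec 0 w) * \<phi> (z + cvec 0 w)) y \<le> ennreal \<epsilon>"
    using truncation_approx[OF \<Gamma> hol p M(2) lM \<epsilon>] by blast
  define q where "q = p / (p - 1)"
  have q: "q > 1" "1 / p + 1 / q = 1" using p by (auto simp: q_def field_simps)
  define W where "W x = (\<Prod>i\<in>UNIV. 1 / (1 + (c * x $ i)\<^sup>2))" for x :: "real^'n"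
  have Wnn: "W x \<ge> 0" for x unfolding W_def by (intro prod_nonneg) auto
  have W1: "W x \<le> 1" for x unfolding W_def by (rule prod_inverse_le_1)
  have Wm[measurable]: "W \<in> borel_measurable borel" unfolding W_def[abs_def] by measurable
  have "(\<integral>\<^sup>+x. ennreal (W x) \<partial>lborel) < \<infinity>"
    unfolding W_def by (rule nn_integral_prod_inverse_1_plus_square[OF c])
  then obtain I where I: "(\<integral>\<^sup>+x. ennreal (W x) \<partial>lborel) = ennreal I" "I \<ge> 0"
    by (cases "\<integral>\<^sup>+x. ennreal (W x) \<partial>lborel") auto
  \<comment> \<open>By Young's inequality |F \<phi>| \<le> |F|^p + |\<phi>|^q, and |\<phi>|^q \<le>
    W since |\<phi>| \<le> W \<le> 1 and q > 1.\<close>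
  have L1: "slice_integral 1 (\<lambda>z. F z * \<phi> z) y \<le> ennreal (M + I)" if y: "y \<in> \<Gamma>" for y
  proof -
    note [measurable] = slice_measurable[OF hol y]
    have "slice_integral 1 (\<lambda>z. F z * \<phi> z) y \<le> (\<integral>\<^sup>+x. ennreal (cmod (F (cvec x y)) powr p) + ennreal (W x) \<partial>lborel)"
      unfolding slice_integral_def
    proof (rule nn_integral_mono)
      fix x
      define a b where "a = cmod (F (cvec x y))" and "b = cmod (\<phi> (cvec x y))"
      have b: "0 \<le> b" "b \<le> W x" unfolding b_def W_def by (auto intro: phi[OF y])
      have "a * b \<le> a powr p / p + b powr q / q"
        using p q b by (intro Youngs_inequality) (auto simp: a_def)
      also have "\<dots> \<le> a powr p / 1 + b powr q / 1"
        using p q by (intro add_mono divide_left_mono) auto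
      also have "\<dots> \<le> a powr p + W x"
      proof -
        have "b powr q \<le> b powr 1" using b W1[of x] q by (intro powr_mono') auto
        then show ?thesis using b by simp
      qed
      finally have "a * b \<le> a powr p + W x" .
      then show "ennreal (cmod (F (cvec x y) * \<phi> (cvec x y)) powr 1) \<le> ennreal (cmod (F (cvec x y)) powr p) + ennreal (W x)"
        using Wnn[of x] by (simp add: a_def b_def norm_mult ennreal_plus[symmetric] ennreal_leI del: ennreal_plus)
    qed
    also have "\<dots> = slice_integral p F y + ennreal I" unfolding slice_integral_def by (simp add: nn_integral_add I)
    also have "\<dots> \<le> ennreal M + ennreal I" by (intro add_mono lM y) auto
    finally show ?thesis using M I by simp
  qed
  define B where "B = max (A * (M + I)) ((A * M) powr (1 / p))"
  have B: "B \<ge> 0" "A * (M + I) \<le> B" "(A * M) powr (1 / p) \<le> B"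
    using A M I by (auto simp: B_def le_max_iff_disj)
  have holG: "holomorphic_vec_on (\<lambda>z. F z * \<phi> z) (tube \<Gamma>)" by (rule holomorphic_vec_on_mult[OF hol hphi])
  have bounds: "kernel_quotient \<Gamma> p F x y \<le> \<eta> + B * diag_kernel \<Gamma> (y + w) / diag_kernel \<Gamma> y powr (1 / p) \<and>
    kernel_quotient \<Gamma> p F x y \<le> \<eta> + B / (1 + (c * norm x)\<^sup>2)" if y: "y \<in> \<Gamma>" for x y
  proof -
    define k where "k = diag_kernel \<Gamma> y powr (1 / p)"
    have k: "k > 0" using diag_kernel_pos[OF \<Gamma> y] by (simp add: k_def)
    have yw: "y + w \<in> \<Gamma>" by (rule open_cone_add[OF oc y w])
    define G where "G = F (cvec x (y + w)) * \<phi> (cvec x (y + w))"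
    have holD: "holomorphic_vec_on (\<lambda>z. F z - F (z + cvec 0 w) * \<phi> (z + cvec 0 w)) (tube \<Gamma>)"
      by (intro holomorphic_vec_on_diff hol holomorphic_vec_on_shift[OF holG oc w])
    have "cmod (F (cvec x y) - G) \<le> \<eta> * k"
      using pointwise_bound_root[OF \<Gamma> holD _ _ app y, of x] p \<epsilon> A\<epsilon>
      by (simp add: G_def cvec_add_imag A_def k_def)
    then have "cmod (F (cvec x y)) \<le> \<eta> * k + cmod G"
      using norm_triangle_ineq2[of "F (cvec x y)" G] by linarith
    then have "kernel_quotient \<Gamma> p F x y \<le> (\<eta> * k + cmod G) / k"
      using k unfolding kernel_quotient_eq k_def[symmetric] by (intro divide_right_mono) auto
    then have main: "kernel_quotient \<Gamma> p F x y \<le> \<eta> + cmod G / k"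
      using k by (simp add: add_divide_distrib)
    \<comment> \<open>The pointwise bound with exponent 1, evaluated at y + w; this is where the
      full power of the kernel comes from.\<close>
    have "cmod G \<le> (A * (M + I)) * diag_kernel \<Gamma> (y + w)"
      using pointwise_bound_root[OF \<Gamma> holG _ _ L1 yw, of x] M I A
      by (simp add: G_def A_def diag_kernel_nonneg)
    also have "\<dots> \<le> B * diag_kernel \<Gamma> (y + w)" by (intro mult_right_mono B diag_kernel_nonneg)
    finally have "cmod G / k \<le> B * diag_kernel \<Gamma> (y + w) / k" using k by (intro divide_right_mono) auto
    moreover have "cmod G / k \<le> B / (1 + (c * norm x)\<^sup>2)"
    proof -
      \<comment> \<open>For the decay in x the bound with exponent p is used instead: its kernel
        factor is at most that at y and cancels in the quotient, so the estimate is uniform in y,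
        and \<phi> supplies the decay.\<close>
      have "cmod (F (cvec x (y + w))) \<le> (A * M) powr (1 / p) * diag_kernel \<Gamma> (y + w) powr (1 / p)"
        using pointwise_bound_root[OF \<Gamma> hol _ M(2) lM yw, of x] p by (simp add: A_def)
      also have "\<dots> \<le> B * k"
        unfolding k_def using B p diag_kernel_antimono[OF oc y w]
        by (intro mult_mono powr_mono2) (auto simp: diag_kernel_nonneg)
      finally have 1: "cmod (F (cvec x (y + w))) \<le> B * k" .
      have 2: "cmod (\<phi> (cvec x (y + w))) \<le> 1 / (1 + (c * norm x)\<^sup>2)"
        using phi[OF yw, of x] prod_inverse_le_norm[OF c, of x] by linarith
      have "cmod G \<le> (B * k) * (1 / (1 + (c * norm x)\<^sup>2))"
        unfolding G_def norm_mult using 1 2 B k by (intro mult_mono) auto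
      then have "cmod G / k \<le> (B * k) * (1 / (1 + (c * norm x)\<^sup>2)) / k" using k by (intro divide_right_mono) auto
      then show ?thesis using k by simp
    qed
    ultimately show ?thesis using main unfolding k_def[symmetric] by linarith
  qed
  show ?thesis using w c B(1) bounds by blast
qed

lemma filterlim_powr_at_top:
  fixes s :: real
  assumes "s > 0"
  shows "filterlim (\<lambda>x. x powr s) at_top at_top"
  unfolding filterlim_at_top
proof
  fix Z :: real
  \<comment> \<open>The maximum with 1 keeps the base positive, so that the powers cancel also for Z
    \<le> 0.\<close>
  have "eventually (\<lambda>x. x \<ge> (max Z 1) powr (1 / s)) at_top" by (rule eventually_ge_at_top)
  then show "eventually (\<lambda>x. Z \<le> x powr s) at_top"
  proof eventually_elim
    case (elim x)
    then have "((max Z 1) powr (1 / s)) powr s \<le> x powr s" using assms by (intro powr_mono2) auto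
    then show ?case using assms by (simp add: powr_powr)
  qed
qed

lemma kernel_quotient_nonneg: "kernel_quotient \<Gamma> p F x y \<ge> 0"
  by (simp add: kernel_quotient_eq)

lemma hardy_quotient_limits:
  fixes F :: "complex^'n \<Rightarrow> complex"
  assumes \<Gamma>: "regular_cone \<Gamma>" and van: "kernel_vanishes_at_infinity \<Gamma>"
    and p: "p > 1" and F: "F \<in> hardy_space p \<Gamma>"
  shows "\<beta> \<in> frontier \<Gamma> \<Longrightarrow> uniform_limit UNIV (\<lambda>y x. kernel_quotient \<Gamma> p F x y) (\<lambda>x. 0) (at \<beta> within \<Gamma>)"
    and "uniform_limit UNIV (\<lambda>y x. kernel_quotient \<Gamma> p F x y) (\<lambda>x. 0) (inf at_infinity (principal \<Gamma>))"
    and "uniform_limit \<Gamma> (\<lambda>x y. kernel_quotient \<Gamma> p F x y) (\<lambda>y. 0) at_infinity"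
proof -
  have oc: "open_cone \<Gamma>" using \<Gamma> by (simp add: regular_cone_def)
  note bounds = kernel_quotient_bounds[OF \<Gamma> F p]
  show "uniform_limit UNIV (\<lambda>y x. kernel_quotient \<Gamma> p F x y) (\<lambda>x. 0) (at \<beta> within \<Gamma>)"
    if \<beta>: "\<beta> \<in> frontier \<Gamma>"
  proof (rule uniform_limitI)
    fix e :: real assume "e > 0"
    then obtain w c B where w: "w \<in> \<Gamma>" and B: "B \<ge> 0"
      and b: "\<And>x y. y \<in> \<Gamma> \<Longrightarrow> kernel_quotient \<Gamma> p F x y \<le> e/2 + B * diag_kernel \<Gamma> (y + w) / diag_kernel \<Gamma> y powr (1 / p)"
      using bounds[of "e/2"] by auto
    have "filterlim (\<lambda>y. diag_kernel \<Gamma> y powr (1 / p)) at_top (at \<beta> within \<Gamma>)"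
      by (rule filterlim_compose[OF filterlim_powr_at_top diag_kernel_frontier[OF \<Gamma> \<beta>]]) (use p in simp)
    then have "((\<lambda>y. B * diag_kernel \<Gamma> w / diag_kernel \<Gamma> y powr (1 / p)) \<longlongrightarrow> 0) (at \<beta> within \<Gamma>)"
      by (intro real_tendsto_divide_at_top[OF tendsto_const])
    then have "eventually (\<lambda>y. B * diag_kernel \<Gamma> w / diag_kernel \<Gamma> y powr (1 / p) < e/2) (at \<beta> within \<Gamma>)"
      using \<open>e > 0\<close> by (intro order_tendstoD(2)) auto
    moreover have "eventually (\<lambda>y. y \<in> \<Gamma>) (at \<beta> within \<Gamma>)" by (simp add: eventually_at_filter)
    ultimately show "eventually (\<lambda>y. \<forall>x\<in>UNIV. dist (kernel_quotient \<Gamma> p F x y) 0 < e) (at \<beta> within \<Gamma>)"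
    proof eventually_elim
      case (elim y)
      have "diag_kernel \<Gamma> (y + w) \<le> diag_kernel \<Gamma> w"
        using diag_kernel_antimono[OF oc w elim(2)] by (simp add: add.commute)
      then have "B * diag_kernel \<Gamma> (y + w) / diag_kernel \<Gamma> y powr (1 / p) \<le> B * diag_kernel \<Gamma> w / diag_kernel \<Gamma> y powr (1 / p)"
        using B by (intro divide_right_mono mult_left_mono) auto
      then have "kernel_quotient \<Gamma> p F x y < e" for x using elim b[OF elim(2), of x] by linarith
      then show ?case by (simp add: kernel_quotient_nonneg)
    qed
  qed
  show "uniform_limit UNIV (\<lambda>y x. kernel_quotient \<Gamma> p F x y) (\<lambda>x. 0) (inf at_infinity (principal \<Gamma>))"
  proof (rule uniform_limitI)
    fix e :: real assume "e > 0"
    then obtain w c B where w: "w \<in> \<Gamma>" and B: "B \<ge> 0"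
      and b: "\<And>x y. y \<in> \<Gamma> \<Longrightarrow> kernel_quotient \<Gamma> p F x y \<le> e/2 + B * diag_kernel \<Gamma> (y + w) / diag_kernel \<Gamma> y powr (1 / p)"
      using bounds[of "e/2"] by auto
    have "((\<lambda>y. cauchy_szego \<Gamma> (cvec 0 y) (cvec 0 y)) \<longlongrightarrow> 0) (inf at_infinity (principal (closure ((+) w ` \<Gamma>))))"
      using van w by (auto simp: kernel_vanishes_at_infinity_def)
    then have K0: "(diag_kernel \<Gamma> \<longlongrightarrow> 0) (inf at_infinity (principal (closure ((+) w ` \<Gamma>))))"
      unfolding cauchy_szego_diag using tendsto_of_real_iff[of "diag_kernel \<Gamma>" 0, where 'a=complex] by simp
    \<comment> \<open>Translation by w carries \<Gamma> into the closed set of the kernel condition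
      for the base point w.\<close>
    have "filterlim (\<lambda>y. y + w) (inf at_infinity (principal (closure ((+) w ` \<Gamma>)))) (inf at_infinity (principal \<Gamma>))"
      unfolding filterlim_inf filterlim_principal
    proof
      have "filterlim (\<lambda>y. y + w) at_infinity at_infinity"
        by (rule tendsto_add_filterlim_at_infinity'[OF filterlim_ident tendsto_const])
      then show "filterlim (\<lambda>y. y + w) at_infinity (inf at_infinity (principal \<Gamma>))"
        by (rule filterlim_mono) auto
      have "y + w \<in> closure ((+) w ` \<Gamma>)" if "y \<in> \<Gamma>" for y
        using that closure_subset by (force simp: add.commute)
      then show "eventually (\<lambda>y. y + w \<in> closure ((+) w ` \<Gamma>)) (inf at_infinity (principal \<Gamma>))"
        by (simp add: eventually_inf_principal)
    qed
    then have K: "((\<lambda>y. diag_kernel \<Gamma> (y + w)) \<longlongrightarrow> 0) (inf at_infinity (principal \<Gamma>))"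
      by (rule filterlim_compose[OF K0])
    then have "((\<lambda>y. B * diag_kernel \<Gamma> (y + w) powr (1 - 1 / p)) \<longlongrightarrow> B * 0 powr (1 - 1 / p)) (inf at_infinity (principal \<Gamma>))"
      using p diag_kernel_nonneg[of \<Gamma>] by (intro tendsto_intros tendsto_powr') (auto simp: field_simps intro!: always_eventually)
    then have "eventually (\<lambda>y. B * diag_kernel \<Gamma> (y + w) powr (1 - 1 / p) < e/2) (inf at_infinity (principal \<Gamma>))"
      using \<open>e > 0\<close> by (intro order_tendstoD(2)) auto
    moreover have "eventually (\<lambda>y. y \<in> \<Gamma>) (inf at_infinity (principal \<Gamma>))" by (simp add: eventually_inf_principal)
    ultimately show "eventually (\<lambda>y. \<forall>x\<in>UNIV. dist (kernel_quotient \<Gamma> p F x y) 0 < e) (inf at_infinity (principal \<Gamma>))"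
    proof eventually_elim
      case (elim y)
      define k k' where "k = diag_kernel \<Gamma> y" and "k' = diag_kernel \<Gamma> (y + w)"
      have k: "k' > 0" "k' \<le> k" "k > 0"
        unfolding k_def k'_def using diag_kernel_pos[OF \<Gamma>] open_cone_add[OF oc elim(2) w] elim(2)
          diag_kernel_antimono[OF oc elim(2) w] by auto
      \<comment> \<open>The unknown k(y) may itself tend to 0; replacing it by the smaller k(y + w)
        leaves a single positive power of a quantity known to vanish.\<close>
      have "k' / k powr (1 / p) \<le> k' / k' powr (1 / p)"
        using k p by (intro divide_left_mono powr_mono2 mult_pos_pos) auto
      also have "\<dots> = k' powr (1 - 1 / p)" using k by (simp add: powr_diff)
      finally have "B * (k' / k powr (1 / p)) \<le> B * k' powr (1 - 1 / p)" using B by (intro mult_left_mono)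
      then have "kernel_quotient \<Gamma> p F x y < e" for x
        using elim(1) b[OF elim(2), of x] unfolding k_def[symmetric] k'_def[symmetric] by simp
      then show ?case by (simp add: kernel_quotient_nonneg)
    qed
  qed
  show "uniform_limit \<Gamma> (\<lambda>x y. kernel_quotient \<Gamma> p F x y) (\<lambda>y. 0) at_infinity"
  proof (rule uniform_limitI)
    fix e :: real assume "e > 0"
    then obtain w c B where c: "c > 0"
      and b: "\<And>x y. y \<in> \<Gamma> \<Longrightarrow> kernel_quotient \<Gamma> p F x y \<le> e/2 + B / (1 + (c * norm x)\<^sup>2)"
      using bounds[of "e/2"] by auto
    have "filterlim (\<lambda>x::real^'n. c * norm x) at_top at_infinity"
      using c by (intro filterlim_tendsto_pos_mult_at_top[OF tendsto_const] filterlim_norm_at_top) auto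
    then have "filterlim (\<lambda>x::real^'n. (c * norm x)\<^sup>2) at_top at_infinity"
      by (rule filterlim_pow_at_top[rotated]) simp
    then have "filterlim (\<lambda>x::real^'n. 1 + (c * norm x)\<^sup>2) at_top at_infinity"
      by (rule filterlim_tendsto_add_at_top[OF tendsto_const])
    then have "((\<lambda>x::real^'n. B / (1 + (c * norm x)\<^sup>2)) \<longlongrightarrow> 0) at_infinity"
      by (intro real_tendsto_divide_at_top[OF tendsto_const])
    then have "eventually (\<lambda>x::real^'n. B / (1 + (c * norm x)\<^sup>2) < e/2) at_infinity"
      using \<open>e > 0\<close> by (intro order_tendstoD(2)) auto
    then show "eventually (\<lambda>x. \<forall>y\<in>\<Gamma>. dist (kernel_quotient \<Gamma> p F x y) 0 < e) at_infinity"
    proof eventually_elim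
      case (elim x)
      then have "kernel_quotient \<Gamma> p F x y < e" if "y \<in> \<Gamma>" for y using b[OF that, of x] by linarith
      then show ?case by (simp add: kernel_quotient_nonneg)
    qed
  qed
qed

theorem theoremB4:
  fixes \<Gamma> :: "(real^'n) set"
  shows "(regular_cone \<Gamma> \<and> kernel_vanishes_at_infinity \<Gamma> \<longrightarrow>
      (\<forall>p F. 1 < p \<and> F \<in> hardy_space p \<Gamma> \<longrightarrow>
        (\<forall>\<beta>\<in>frontier \<Gamma>.
           uniform_limit UNIV (\<lambda>y x. kernel_quotient \<Gamma> p F x y) (\<lambda>x. 0) (at \<beta> within \<Gamma>)) \<and>
        uniform_limit UNIV (\<lambda>y x. kernel_quotient \<Gamma> p F x y) (\<lambda>x. 0)
          (inf at_infinity (principal \<Gamma>)) \<and>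
        uniform_limit \<Gamma> (\<lambda>x y. kernel_quotient \<Gamma> p F x y) (\<lambda>y. 0) at_infinity))
    \<and> ((regular_cone \<Gamma> \<and> CARD('n) = 2) \<or> polygonal_cone \<Gamma> \<or> circular_cone \<Gamma> \<longrightarrow>
        regular_cone \<Gamma> \<and> kernel_vanishes_at_infinity \<Gamma>)"
proof (intro conjI impI)
  assume "regular_cone \<Gamma> \<and> kernel_vanishes_at_infinity \<Gamma>"
  then show "\<forall>p F. 1 < p \<and> F \<in> hardy_space p \<Gamma> \<longrightarrow>
        (\<forall>\<beta>\<in>frontier \<Gamma>.
           uniform_limit UNIV (\<lambda>y x. kernel_quotient \<Gamma> p F x y) (\<lambda>x. 0) (at \<beta> within \<Gamma>)) \<and>
        uniform_limit UNIV (\<lambda>y x. kernel_quotient \<Gamma> p F x y) (\<lambda>x. 0)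
          (inf at_infinity (principal \<Gamma>)) \<and>
        uniform_limit \<Gamma> (\<lambda>x y. kernel_quotient \<Gamma> p F x y) (\<lambda>y. 0) at_infinity"
    by (auto intro: hardy_quotient_limits)
next
  assume "(regular_cone \<Gamma> \<and> CARD('n) = 2) \<or> polygonal_cone \<Gamma> \<or> circular_cone \<Gamma>"
  then show "regular_cone \<Gamma>"
    using circular_cone_regular by (auto simp: polygonal_cone_def)
  then show "kernel_vanishes_at_infinity \<Gamma>"
    by (rule regular_cone_kernel_vanishes)
qed

end
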